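(* Let $M\in\{1,2\}$ and consider the control system $$\dot x(t)=F(x(t))+G(x(t))u(t),\qquad x(0)=0,$$ where $u(\cdot)\in[-1,1]^M$ a.e., and $F:\mathbb{R}^2\to\mathbb{R}^2$, $G:\mathbb{R}^2\to\mathbb{M}_{2\times M}$ (with columns $G_i$, $i=1,\dots,M$) are of class $\mathcal{C}^{1,1}$ with Lipschitz constant $L$ and satisfy: (i) $F(0)=0$; (ii) $\mathrm{Rank}\,[G_i(0),DF(0)G_i(0)]=2$ for $i=1,\dots,M$; (iii) $DG(0)=0$. Let $\mathcal{R}^\tau$ denote the reachable set at time $\tau>0$ for this system. Then there exists $\mathcal{T}>0$, depending only on $L,DF(0),G(0)$, with the following properties: (a) for every $0<\tau\le\mathcal{T}$ and every $x\in\mathrm{bdry}\,\mathcal{R}^\tau$ there exists one and only one admissible control $u$ steering the origin to $x$ in time $\tau$ (and $u$ is bang-bang with finitely many switchings); (b) for every $0<\tau<\mathcal{T}$ the reachable set $\mathcal{R}^\tau$ is strictly convex; more precisely, for every $x_1\in\mathrm{bdry}\,\mathcal{R}^\tau$, $x_2\in\mathcal{R}^\tau$ and $\zeta\in N^P_{\mathcal{R}^\tau}(x_1)$, $$\langle\zeta,x_2-x_1\rangle\le-\gamma\|\zeta\|\,\|x_2-x_1\|^2,$$ where $\gamma$ is a positive constant depending only on $L,DF(0),G(0)$; (c) there exists another time $\mathcal{T}'>\mathcal{T}$, depending only on $L,DF(0),G(0)$, such that for every $0<\tau<\mathcal{T}'$ the reachable set $\mathcal{R}^\tau$ has positive reach;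 more precisely, for every $x_1\in\mathrm{bdry}\,\mathcal{R}^\tau$, $x_2\in\mathcal{R}^\tau$ and $\zeta\in N^P_{\mathcal{R}^\tau}(x_1)$, $$\langle\zeta,x_2-x_1\rangle\le\gamma'\|\zeta\|\,\|x_2-x_1\|^2,$$ where $\gamma'$ is a nonnegative constant depending only on $L,DF(0),G(0)$; (d) there exist another positive constant $\gamma''$ and a positive time $\mathcal{T}''\le\mathcal{T}$, depending only on $L,DF(0),G(0)$, such that the ball $B(0,\gamma''\tau^2)$ is contained in $\mathcal{R}^\tau$ for all $0<\tau<\mathcal{T}''$; (e) the minimum time function $T$ is continuous in $\mathcal{R}^\tau$ for all $0<\tau<\mathcal{T}''$.
   Context: A function is of class $\mathcal{C}^{1,1}$ if its partial derivatives exist and are Lipschitz. $\mathbb{M}_{2\times M}$ denotes the real $2\times M$ matrices. Admissible controls are measurable functions with values a.e. in $[-1,1]^M$; $y^u$ is the solution of the system with control $u$ and $y^u(0)=0$; $\mathcal{R}^\tau=\{y^u(\tau):u\text{ admissible}\}$. Controls are identified if they agree a.e. A control is bang-bang if each component takes values in $\{-1,1\}$ a.e. For closed $K\subset\mathbb{R}^N$ and $x\in K$, the proximal normal cone $N^P_K(x)$ is the set of $v$ such that for some $\sigma\ge0$, $\langle v,y-x\rangle\le\sigma\|y-x\|^2$ for all $y\in K$. A closed set $K\subseteq\mathbb{R}^N$ has positive reach if there is $r>0$ such that every point at distance less than $r$ from $K$ has a unique nearest point in $K$. The minimum time function is $T(x)=\inf_u\min\{t\ge0: y^{x,u}(t)=0\}$,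 the infimum being over admissible controls, where $y^{x,u}$ solves $\dot y=F(y)+G(y)u$, $y(0)=x$ (and the minimum is $+\infty$ if $0$ is not reached). $B(0,r)$ is the ball of radius $r$ centered at $0$. *)

theory Defs
  imports "HOL-Analysis.Analysis"
begin

(* Only the partial derivatives are required to be L-Lipschitz, not f itself. *)
definition C11 :: "real \<Rightarrow> (real^'n \<Rightarrow> 'b::real_normed_vector) \<Rightarrow> bool" where
  "C11 L f \<longleftrightarrow>
    (\<exists>D :: 'n \<Rightarrow> real^'n \<Rightarrow> 'b. \<forall>j.
       (\<forall>x. ((\<lambda>h. f (x + h *\<^sub>R axis j 1)) has_vector_derivative D j x) (at 0)) \<and>
       L-lipschitz_on UNIV (D j))"

definition admissible :: "real set \<Rightarrow> (real \<Rightarrow> real^'m) \<Rightarrow> bool" where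
  "admissible S u \<longleftrightarrow>
    u \<in> borel_measurable (lebesgue_on S) \<and>
    (AE t in lebesgue_on S. \<forall>i. u t $ i \<in> {-1..1})"

(* Caratheodory solution on [0,\<tau>] in integral form. The integral equation at t = 0
   gives y 0 = x. *)
definition is_solution ::
  "(real^'n \<Rightarrow> real^'n) \<Rightarrow> (real^'n \<Rightarrow> real^'m^'n) \<Rightarrow> (real \<Rightarrow> real^'m) \<Rightarrow> real^'n \<Rightarrow> real \<Rightarrow>
   (real \<Rightarrow> real^'n) \<Rightarrow> bool" where
  "is_solution F G u x \<tau> y \<longleftrightarrow>
    continuous_on {0..\<tau>} y \<and>
    (\<forall>t\<in>{0..\<tau>}. ((\<lambda>s. F (y s) + G (y s) *v u s) has_integral (y t - x)) {0..t})"

definition steers ::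
  "(real^'n \<Rightarrow> real^'n) \<Rightarrow> (real^'n \<Rightarrow> real^'m^'n) \<Rightarrow> (real \<Rightarrow> real^'m) \<Rightarrow> real^'n \<Rightarrow> real \<Rightarrow>
   real^'n \<Rightarrow> bool" where
  "steers F G u x \<tau> z \<longleftrightarrow> (\<exists>y. is_solution F G u x \<tau> y \<and> y \<tau> = z)"

definition reachable ::
  "(real^'n \<Rightarrow> real^'n) \<Rightarrow> (real^'n \<Rightarrow> real^'m^'n) \<Rightarrow> real \<Rightarrow> (real^'n) set" where
  "reachable F G \<tau> = {z. \<exists>u. admissible {0..\<tau>} u \<and> steers F G u 0 \<tau> z}"

(* For a fixed control the set of hitting times is closed whenever it is nonempty, so the
   inner infimum is a minimum; it is \<infinity> if the origin is not reached. *)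
definition minimum_time ::
  "(real^'n \<Rightarrow> real^'n) \<Rightarrow> (real^'n \<Rightarrow> real^'m^'n) \<Rightarrow> real^'n \<Rightarrow> ereal" where
  "minimum_time F G x =
    (INF u\<in>{u. admissible {0..} u}. INF t\<in>{t. 0 \<le> t \<and> steers F G u x t 0}. ereal t)"

definition bang_bang :: "real \<Rightarrow> (real \<Rightarrow> real^'m) \<Rightarrow> bool" where
  "bang_bang \<tau> u \<longleftrightarrow> (AE t in lebesgue_on {0..\<tau>}. \<forall>i. u t $ i \<in> {-1, 1})"

(* Controls are classes modulo a.e. equality: some representative is constant on every
   interval that contains no point of a finite set. *)
definition finitely_many_switchings :: "real \<Rightarrow> (real \<Rightarrow> real^'m) \<Rightarrow> bool" where
  "finitely_many_switchings \<tau> u \<longleftrightarrow>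
    (\<exists>v S. finite S \<and> (AE t in lebesgue_on {0..\<tau>}. u t = v t) \<and>
       (\<forall>a b. a \<le> b \<and> {a..b} \<subseteq> {0..\<tau>} - S \<longrightarrow> v a = v b))"

definition proximal_normal_cone :: "'a::real_inner set \<Rightarrow> 'a \<Rightarrow> 'a set" where
  "proximal_normal_cone K x =
    {v. \<exists>\<sigma>\<ge>0. \<forall>y\<in>K. v \<bullet> (y - x) \<le> \<sigma> * (norm (y - x))\<^sup>2}"

definition positive_reach :: "'a::metric_space set \<Rightarrow> bool" where
  "positive_reach K \<longleftrightarrow>
    closed K \<and> (\<exists>r>0. \<forall>x. infdist x K < r \<longrightarrow> (\<exists>!p. p \<in> K \<and> dist x p = infdist x K))"

definition strictly_convex :: "'a::real_normed_vector set \<Rightarrow> bool" where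
  "strictly_convex K \<longleftrightarrow>
    (\<forall>x\<in>K. \<forall>y\<in>K. x \<noteq> y \<longrightarrow> open_segment x y \<subseteq> interior K)"

end

theory Submission
  imports Defs
begin

text \<open>
  For a unit vector \<open>\<zeta>\<close> the payoff \<open>\<zeta> \<bullet> y\<^sup>u(\<tau>)\<close> of a control \<open>u\<close> has the first-order expansion
  \<open>\<Sum>i. \<integral> \<sigma>\<^sub>i (v\<^sub>i - u\<^sub>i)\<close> with an error of order \<open>\<tau> d(u,v)\<^sup>2\<close>, where \<open>d\<close> is the \<open>L\<^sup>1\<close> distance and
  \<open>\<sigma>\<^sub>i = \<lambda> \<bullet> G\<^sub>i(y\<^sup>u)\<close> for the adjoint state \<open>\<lambda>\<close>. The rank condition makes every \<open>\<sigma>\<^sub>i\<close> grow at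
  least linearly away from a single point, so that for small \<open>\<tau>\<close> the payoff is strongly concave with
  respect to \<open>d\<close>: some control beats the average payoff of \<open>u\<close> and \<open>v\<close> by a multiple of
  \<open>d(u,v)\<^sup>2\<close>. Hence maximizing sequences are Cauchy, and every direction has a unique maximizer, which
  is bang-bang and depends continuously on \<open>\<zeta>\<close>. Scaling the maximizers extends the
  resulting map from the sphere to the ball, and Brouwer's theorem shows that
  every point strictly below the support function is reachable. The reachable set is therefore closed
  and convex, and the quadratic gap at the maximizers is the strong convexity estimate. Waiting at the
  origin for time \<open>s\<close> costs at least \<open>s\<close> in the distance to the maximizer, so the support function grows
  by a multiple of \<open>s\<^sup>2\<close>; this yields the ball in the reachable set and, for the time-reversed system,
  the Hoelder continuity of the minimum time.
\<close>

section \<open>Bounded measurable functions on an interval\<close>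

text \<open>The factor \<open>\<tau>\<close> in the error term is the work of
  \<open>DG(0) = 0\<close>. Up to time \<open>\<tau>\<close> trajectories stay within
  \<open>K * \<tau>\<close> of the origin, so the columns \<open>G_i\<close> vary there with a
  Lipschitz constant of order \<open>\<tau>\<close>. Without this, the mixed term
  \<open>(v_i - u_i) * (\<lambda> . (G_i(y^v) - G_i(y^u)))\<close> would integrate to the order of
  \<open>d(u,v)^2\<close>, the same as the gain from switching, and no short time would make it
  smaller. The same fact suppresses the brackets of the columns in the derivative of
  \<open>\<sigma>_i\<close>, which is then close to \<open>- \<zeta> . DF(0) G_i(0)\<close>; if that
  number is small, the rank condition makes \<open>\<zeta> . G_i(0)\<close> large and
  \<open>\<sigma>_i\<close> has no zero at all. The end-point map is not linear, so convexity of the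
  set of controls does not pass to the reachable set; the quadratic gap in the \<open>L^1\<close>
  distance has to supply it. Every constant is computed from an upper bound \<open>K0\<close> for
  the data and the nondegeneracy constant \<open>\<kappa>\<close>. Both are read off from
  \<open>L\<close>, \<open>DF(0)\<close>, \<open>G(0)\<close> and survive time reversal, which gives
  the uniformity in \<open>F\<close> and \<open>G\<close>.\<close>

definition bounded_measurable :: "real \<Rightarrow> (real \<Rightarrow> 'a::euclidean_space) \<Rightarrow> bool" where
  "bounded_measurable \<tau> h \<longleftrightarrow>
     h \<in> borel_measurable (lebesgue_on {0..\<tau>}) \<and> (\<exists>C. \<forall>t\<in>{0..\<tau>}. norm (h t) \<le> C)"

named_theorems bm_intros

lemma bounded_measurableI:
  assumes "h \<in> borel_measurable (lebesgue_on {0..\<tau>})" "\<And>t. t \<in> {0..\<tau>} \<Longrightarrow> norm (h t) \<le> C"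
  shows "bounded_measurable \<tau> h"
  using assms unfolding bounded_measurable_def by blast

lemma bm_const [bm_intros]: "bounded_measurable \<tau> (\<lambda>t. c)"
  by (rule bounded_measurableI[where C="norm c"]) auto

lemma bm_continuous:
  assumes "continuous_on {0..\<tau>} h"
  shows "bounded_measurable \<tau> h"
proof -
  have "bounded (h ` {0..\<tau>})"
    by (rule compact_imp_bounded[OF compact_continuous_image[OF assms]]) simp
  then show ?thesis
    unfolding bounded_measurable_def bounded_iff
    using continuous_imp_measurable_on_sets_lebesgue[OF assms] by auto
qed

lemma bm_add [bm_intros]:
  assumes "bounded_measurable \<tau> h" "bounded_measurable \<tau> k"
  shows "bounded_measurable \<tau> (\<lambda>t. h t + k t)"
proof -
  obtain C D where "\<forall>t\<in>{0..\<tau>}. norm (h t) \<le> C" "\<forall>t\<in>{0..\<tau>}. norm (k t) \<le> D"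
    using assms unfolding bounded_measurable_def by blast
  then show ?thesis
    using assms unfolding bounded_measurable_def
    by (intro conjI exI[where x="C + D"]) (auto intro: norm_triangle_mono)
qed

lemma bm_inner [bm_intros]:
  assumes "bounded_measurable \<tau> h" "bounded_measurable \<tau> k"
  shows "bounded_measurable \<tau> (\<lambda>t. h t \<bullet> k t)"
proof -
  obtain C D where *: "\<forall>t\<in>{0..\<tau>}. norm (h t) \<le> C" "\<forall>t\<in>{0..\<tau>}. norm (k t) \<le> D"
    using assms unfolding bounded_measurable_def by blast
  have "norm (h t \<bullet> k t) \<le> C * D" if "t \<in> {0..\<tau>}" for t
  proof -
    have "norm (h t \<bullet> k t) \<le> norm (h t) * norm (k t)"
      using Cauchy_Schwarz_ineq2 by simp
    also have "\<dots> \<le> C * D"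
      using * that by (intro mult_mono) (auto intro: order_trans[OF norm_ge_zero])
    finally show ?thesis .
  qed
  then show ?thesis
    using assms unfolding bounded_measurable_def by (intro conjI exI[where x="C * D"]) auto
qed

lemma bm_scaleR [bm_intros]:
  assumes "bounded_measurable \<tau> h" "bounded_measurable \<tau> k"
  shows "bounded_measurable \<tau> (\<lambda>t. h t *\<^sub>R k t)"
proof -
  obtain C D where *: "\<forall>t\<in>{0..\<tau>}. norm (h t) \<le> C" "\<forall>t\<in>{0..\<tau>}. norm (k t) \<le> D"
    using assms unfolding bounded_measurable_def by blast
  have "norm (h t *\<^sub>R k t) \<le> C * D" if "t \<in> {0..\<tau>}" for t
    using * that by (auto intro!: mult_mono intro: order_trans[OF norm_ge_zero])
  then show ?thesis
    using assms unfolding bounded_measurable_def by (intro conjI exI[where x="C * D"]) auto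
qed

lemma bm_mult [bm_intros]:
  fixes h k :: "real \<Rightarrow> real"
  shows "bounded_measurable \<tau> h \<Longrightarrow> bounded_measurable \<tau> k \<Longrightarrow>
    bounded_measurable \<tau> (\<lambda>t. h t * k t)"
  using bm_inner[of \<tau> h k] by simp

lemma bm_abs [bm_intros]:
  fixes h :: "real \<Rightarrow> real"
  assumes "bounded_measurable \<tau> h"
  shows "bounded_measurable \<tau> (\<lambda>t. \<bar>h t\<bar>)"
  using assms unfolding bounded_measurable_def by auto

lemma bm_diff [bm_intros]:
  assumes "bounded_measurable \<tau> h" "bounded_measurable \<tau> k"
  shows "bounded_measurable \<tau> (\<lambda>t. h t - k t)"
  using bm_add[OF assms(1) bm_scaleR[OF bm_const[where c="-1"] assms(2)]] by simp

lemma bm_sum [bm_intros]: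
  "finite I \<Longrightarrow> (\<And>i. i \<in> I \<Longrightarrow> bounded_measurable \<tau> (h i)) \<Longrightarrow>
    bounded_measurable \<tau> (\<lambda>t. \<Sum>i\<in>I. h i t)"
  by (induction I rule: finite_induct) (auto intro: bm_intros)

lemma lebesgue_measurable_affine:
  fixes c a :: real
  assumes "c \<noteq> 0"
  shows "(\<lambda>x. a + c * x) \<in> lebesgue \<rightarrow>\<^sub>M lebesgue"
  using lebesgue_affine_measurable[of "\<lambda>_. c" a] assms by simp

lemma bm_integrable:
  assumes "bounded_measurable \<tau> h" "0 \<le> a" "b \<le> \<tau>"
  shows "h integrable_on {a..b}"
proof -
  obtain C where C: "\<forall>t\<in>{0..\<tau>}. norm (h t) \<le> C"
    using assms unfolding bounded_measurable_def by blast
  have "h integrable_on {0..\<tau>}"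
  proof (rule measurable_bounded_by_integrable_imp_integrable[where g="\<lambda>_. C"])
    show "h \<in> borel_measurable (lebesgue_on {0..\<tau>})"
      using assms(1) unfolding bounded_measurable_def by blast
  qed (use C in auto)
  then show ?thesis
    by (rule integrable_on_subinterval) (use assms in auto)
qed

lemma norm_integral_le:
  fixes h :: "real \<Rightarrow> 'a::euclidean_space"
  assumes "h integrable_on {a..b}" "a \<le> b" "\<And>t. t \<in> {a..b} \<Longrightarrow> norm (h t) \<le> C"
  shows "norm (integral {a..b} h) \<le> C * (b - a)"
proof -
  have "norm (integral {a..b} h) \<le> integral {a..b} (\<lambda>_. C)"
    by (rule integral_norm_bound_integral) (use assms in auto)
  then show ?thesis using assms by (simp add: mult.commute)
qed

lemma integral_diff_interval:
  fixes h :: "real \<Rightarrow> 'a::euclidean_space"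
  assumes "bounded_measurable \<tau> h" "0 \<le> s" "s \<le> t" "t \<le> \<tau>"
  shows "integral {0..t} h - integral {0..s} h = integral {s..t} h"
  using Henstock_Kurzweil_Integration.integral_combine[of 0 s t h] bm_integrable[OF assms(1), of 0 t] assms
  by (simp add: algebra_simps)

lemma integral_diff_interval':
  fixes h :: "real \<Rightarrow> 'a::euclidean_space"
  assumes "bounded_measurable \<tau> h" "0 \<le> s" "s \<le> t" "t \<le> \<tau>"
  shows "integral {s..\<tau>} h - integral {t..\<tau>} h = integral {s..t} h"
  using Henstock_Kurzweil_Integration.integral_combine[of s t \<tau> h] bm_integrable[OF assms(1), of s \<tau>] assms
  by (simp add: algebra_simps)

text \<open>A short-time substitute for Gronwall's inequality: the maximum \<open>s\<close> of the
  continuous function is attained, and the step applied to it reads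
  \<open>s \<le> c + s / 2\<close>.\<close>

lemma bootstrap_bound:
  fixes \<phi> :: "real \<Rightarrow> real"
  assumes "continuous_on {0..\<tau>} \<phi>"
    and step: "\<And>s. (\<And>t. t \<in> {0..\<tau>} \<Longrightarrow> \<phi> t \<le> s) \<Longrightarrow> (\<And>t. t \<in> {0..\<tau>} \<Longrightarrow> \<phi> t \<le> c + s / 2)"
    and t: "t \<in> {0..\<tau>}"
  shows "\<phi> t \<le> 2 * c"
proof -
  have "{0..\<tau>} \<noteq> {}" using t by auto
  then obtain t0 where t0: "t0 \<in> {0..\<tau>}" "\<And>t. t \<in> {0..\<tau>} \<Longrightarrow> \<phi> t \<le> \<phi> t0"
    using continuous_attains_sup[OF compact_Icc _ assms(1)] by blast
  have "\<phi> t0 \<le> c + \<phi> t0 / 2"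
    by (rule step[OF t0(2) t0(1)])
  then show ?thesis using t0(2)[OF t] by simp
qed

section \<open>Local solvability of integral equations\<close>

text \<open>The set-valued parameter covers initial value problems (with \<open>J t = {0..t}\<close>) and
  terminal value problems (with \<open>J t = {t..\<tau>}\<close>).\<close>

lemma picard_existence:
  fixes g :: "real \<Rightarrow> 'a::euclidean_space \<Rightarrow> 'a"
  assumes "0 < r" "0 \<le> \<tau>" "0 \<le> K" "K * \<tau> \<le> 1/2" "M * \<tau> \<le> r"
    and J: "(\<forall>t. J t = {0..t}) \<or> (\<forall>t. J t = {t..\<tau>})"
    and int: "\<And>y. continuous_on {0..\<tau>} y \<Longrightarrow> y ` {0..\<tau>} \<subseteq> cball c r \<Longrightarrow>
       (\<lambda>s. g s (y s)) integrable_on {0..\<tau>}"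
    and lip: "\<And>s x x'. s \<in> {0..\<tau>} \<Longrightarrow> x \<in> cball c r \<Longrightarrow> x' \<in> cball c r \<Longrightarrow>
       norm (g s x - g s x') \<le> K * norm (x - x')"
    and bd: "\<And>s x. s \<in> {0..\<tau>} \<Longrightarrow> x \<in> cball c r \<Longrightarrow> norm (g s x) \<le> M"
  obtains y where "continuous_on {0..\<tau>} y" "y ` {0..\<tau>} \<subseteq> cball c r"
    "\<And>t. t \<in> {0..\<tau>} \<Longrightarrow> y t = c + integral (J t) (\<lambda>s. g s (y s))"
proof -
  \<comment> \<open>Clamping time to \<open>{0..\<tau>}\<close> extends candidates to the whole
    line, so that the complete space of bounded continuous functions on \<open>UNIV\<close> is
    available; the fixed point is read off on \<open>{0..\<tau>}\<close> only.\<close>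
  define k where "k = (\<lambda>t::real. max 0 (min \<tau> t))"
  have k: "k t \<in> {0..\<tau>}" for t
    using \<open>0 \<le> \<tau>\<close> by (auto simp: k_def)
  have k_id: "k t = t" if "t \<in> {0..\<tau>}" for t
    using that by (auto simp: k_def)
  have k_cont: "continuous_on UNIV k"
    unfolding k_def by (intro continuous_intros)
  have J': "\<exists>a b. J t = {a..b} \<and> 0 \<le> a \<and> a \<le> b \<and> b \<le> \<tau>" if "t \<in> {0..\<tau>}" for t
    using J
  proof
    assume "\<forall>t. J t = {0..t}"
    then show ?thesis using that by (intro exI[of _ 0] exI[of _ t]) auto
  next
    assume "\<forall>t. J t = {t..\<tau>}"
    then show ?thesis using that by (intro exI[of _ t] exI[of _ \<tau>]) auto
  qed
  have J_int: "h integrable_on J t" if h: "h integrable_on {0..\<tau>}" and t: "t \<in> {0..\<tau>}"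
    for h :: "real \<Rightarrow> 'a" and t
  proof -
    obtain a b where ab: "J t = {a..b}" "0 \<le> a" "a \<le> b" "b \<le> \<tau>" using J'[OF t] by blast
    show ?thesis unfolding ab(1)
      by (rule integrable_on_subinterval[OF h]) (use ab in auto)
  qed
  have J_cont: "continuous_on {0..\<tau>} (\<lambda>t. integral (J t) h)" if h: "h integrable_on {0..\<tau>}"
    for h :: "real \<Rightarrow> 'a"
    using J
  proof
    assume "\<forall>t. J t = {0..t}"
    then show ?thesis using indefinite_integral_continuous_1[OF h] by simp
  next
    assume "\<forall>t. J t = {t..\<tau>}"
    then show ?thesis using indefinite_integral_continuous_1'[OF h] by simp
  qed
  have J_norm: "norm (integral (J t) h) \<le> C * \<tau>"
    if h: "h integrable_on {0..\<tau>}" and t: "t \<in> {0..\<tau>}" and C: "\<And>s. s \<in> {0..\<tau>} \<Longrightarrow> norm (h s) \<le> C"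
    for h :: "real \<Rightarrow> 'a" and t C
  proof -
    obtain a b where ab: "J t = {a..b}" "0 \<le> a" "a \<le> b" "b \<le> \<tau>" using J'[OF t] by blast
    have "norm (integral {a..b} h) \<le> C * (b - a)"
      by (rule norm_integral_le) (use J_int[OF h t] ab C in auto)
    also have "0 \<le> C" using order_trans[OF norm_ge_zero C[of 0]] \<open>0 \<le> \<tau>\<close> by simp
    then have "C * (b - a) \<le> C * \<tau>"
      using ab by (intro mult_left_mono) auto
    finally show ?thesis using ab by simp
  qed
  define S where "S = PiC UNIV (\<lambda>_::real. cball c r)"
  have S: "y t \<in> cball c r" if "y \<in> S" for y t
    using that unfolding S_def mem_PiC_iff by auto
  have S_int: "(\<lambda>s. g s (apply_bcontfun y s)) integrable_on {0..\<tau>}" if "y \<in> S" for y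
    using S[OF that] by (intro int) auto
  define Q where "Q y t = c + integral (J (k t)) (\<lambda>s. g s (apply_bcontfun y s))" for y t
  define P where "P y = Bcontfun (Q y)" for y
  have Q_ball: "Q y t \<in> cball c r" if "y \<in> S" for y t
  proof -
    have "norm (integral (J (k t)) (\<lambda>s. g s (apply_bcontfun y s))) \<le> M * \<tau>"
      by (rule J_norm[OF S_int[OF that] k]) (use bd S[OF that] in auto)
    then show ?thesis using assms(5) by (simp add: Q_def dist_norm)
  qed
  have Q_cont: "continuous_on UNIV (Q y)" if "y \<in> S" for y
    unfolding Q_def
    by (intro continuous_intros continuous_on_compose2[OF J_cont[OF S_int[OF that]] k_cont]) (use k in auto)
  have Q_bc: "Q y \<in> bcontfun" if "y \<in> S" for y
  proof -
    have "range (Q y) \<subseteq> cball c r" using Q_ball[OF that] by auto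
    then show ?thesis unfolding bcontfun_def
      using Q_cont[OF that] bounded_subset[OF bounded_cball] by auto
  qed
  have P_app: "apply_bcontfun (P y) = Q y" if "y \<in> S" for y
    unfolding P_def using Bcontfun_inverse[OF Q_bc[OF that]] .
  have "\<exists>!y\<in>S. P y = y"
  proof (rule Banach_fix[of _ "1/2"])
    show "complete S"
      unfolding complete_eq_closed S_def by (rule closed_PiC) auto
    show "S \<noteq> {}"
      using \<open>0 < r\<close> unfolding S_def
      by (auto intro!: exI[of _ "const_bcontfun c"] simp: mem_PiC_iff const_bcontfun.rep_eq ex_in_conv[symmetric])
    show "P ` S \<subseteq> S"
    proof (rule image_subsetI)
      fix y assume "y \<in> S"
      then show "P y \<in> S"
        unfolding S_def using Q_ball[OF \<open>y \<in> S\<close>] P_app[OF \<open>y \<in> S\<close>] by (auto simp: mem_PiC_iff)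
    qed
    show "dist (P y) (P z) \<le> 1/2 * dist y z" if yz: "y \<in> S" "z \<in> S" for y z
    proof (rule dist_bound)
      fix t
      let ?h = "\<lambda>s. g s (apply_bcontfun y s) - g s (apply_bcontfun z s)"
      have "norm (integral (J (k t)) ?h) \<le> (K * dist y z) * \<tau>"
      proof (rule J_norm[OF _ k])
        show "?h integrable_on {0..\<tau>}"
          by (intro integrable_diff S_int yz)
        fix s assume "s \<in> {0..\<tau>}"
        then have "norm (?h s) \<le> K * norm (apply_bcontfun y s - apply_bcontfun z s)"
          using lip S yz by blast
        also have "\<dots> \<le> K * dist y z"
          using dist_bounded[of y s z] \<open>0 \<le> K\<close> by (intro mult_left_mono) (auto simp: dist_norm)
        finally show "norm (?h s) \<le> K * dist y z" .
      qed
      also have "(K * dist y z) * \<tau> = (K * \<tau>) * dist y z" by simp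
      also have "\<dots> \<le> 1/2 * dist y z"
        using assms(4) by (intro mult_right_mono) auto
      also have "integral (J (k t)) ?h = Q y t - Q z t"
        unfolding Q_def using integral_diff[OF J_int[OF S_int[OF yz(1)] k] J_int[OF S_int[OF yz(2)] k]] by simp
      finally show "dist (P y t) (P z t) \<le> 1/2 * dist y z"
        using P_app yz by (simp add: dist_norm)
    qed
  qed auto
  then obtain y where y: "y \<in> S" "P y = y" by blast
  show thesis
  proof (rule that[of "apply_bcontfun y"])
    show "apply_bcontfun y t = c + integral (J t) (\<lambda>s. g s (apply_bcontfun y s))" if "t \<in> {0..\<tau>}" for t
    proof -
      have "apply_bcontfun y t = Q y t" using P_app[OF y(1)] y(2) by simp
      then show ?thesis using k_id[OF that] by (simp add: Q_def)
    qed
  qed (use S[OF y(1)] in auto)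
qed

text \<open>The difference of both sides has increments that are quadratic in the length of the
  interval, so it is constant; this avoids differentiating almost everywhere.\<close>

lemma integration_by_parts_indefinite:
  fixes p q :: "real \<Rightarrow> 'a::euclidean_space"
  assumes "0 \<le> \<tau>" and bm: "bounded_measurable \<tau> p" "bounded_measurable \<tau> q"
    and l: "\<And>t. t \<in> {0..\<tau>} \<Longrightarrow> l t = \<zeta> + integral {t..\<tau>} p"
    and d: "\<And>t. t \<in> {0..\<tau>} \<Longrightarrow> d t = integral {0..t} q"
  shows "\<zeta> \<bullet> d \<tau> = integral {0..\<tau>} (\<lambda>s. l s \<bullet> q s - p s \<bullet> d s)"
proof -
  obtain C where C: "C \<ge> 0" "\<And>t. t \<in> {0..\<tau>} \<Longrightarrow> norm (p t) \<le> C" "\<And>t. t \<in> {0..\<tau>} \<Longrightarrow> norm (q t) \<le> C"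
  proof -
    obtain C D where "\<forall>t\<in>{0..\<tau>}. norm (p t) \<le> C" "\<forall>t\<in>{0..\<tau>}. norm (q t) \<le> D"
      using bm unfolding bounded_measurable_def by blast
    then show thesis
      by (intro that[of "max 0 (max C D)"]) (auto simp: le_max_iff_disj)
  qed
  have d_inc: "d t - d s = integral {s..t} q" and l_inc: "l t - l s = - integral {s..t} p"
    if "0 \<le> s" "s \<le> t" "t \<le> \<tau>" for s t
    using integral_diff_interval[OF bm(2) that] integral_diff_interval'[OF bm(1) that] that l[of s] l[of t] d[of s] d[of t]
    by (auto simp: algebra_simps)
  have d_lip: "norm (d t - d s) \<le> C * (t - s)" and l_lip: "norm (l t - l s) \<le> C * (t - s)"
    if "0 \<le> s" "s \<le> t" "t \<le> \<tau>" for s t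
  proof -
    have "norm (integral {s..t} q) \<le> C * (t - s)" "norm (integral {s..t} p) \<le> C * (t - s)"
      by (rule norm_integral_le; use bm_integrable that bm C in auto)+
    then show "norm (d t - d s) \<le> C * (t - s)" "norm (l t - l s) \<le> C * (t - s)"
      using d_inc[OF that] l_inc[OF that] by auto
  qed
  have ld: "continuous_on {0..\<tau>} l" "continuous_on {0..\<tau>} d"
  proof -
    have c: "continuous_on {0..\<tau>} (\<lambda>t. \<zeta> + integral {t..\<tau>} p)" "continuous_on {0..\<tau>} (\<lambda>t. integral {0..t} q)"
      using indefinite_integral_continuous_1'[OF bm_integrable[OF bm(1) order_refl order_refl]]
        indefinite_integral_continuous_1[OF bm_integrable[OF bm(2) order_refl order_refl]]
      by (simp_all add: continuous_on_add)
    show "continuous_on {0..\<tau>} l" by (rule continuous_on_eq[OF c(1)]) (simp add: l)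
    show "continuous_on {0..\<tau>} d" by (rule continuous_on_eq[OF c(2)]) (simp add: d)
  qed
  define h where "h s = l s \<bullet> q s - p s \<bullet> d s" for s
  have bmh: "bounded_measurable \<tau> h"
    unfolding h_def by (intro bm_intros bm bm_continuous[OF ld(1)] bm_continuous[OF ld(2)])
  define E where "E t = l t \<bullet> d t - integral {0..t} h" for t
  have E_inc: "\<bar>E t - E s\<bar> \<le> (2 * C * C) * (t - s)\<^sup>2" if "0 \<le> s" "s \<le> t" "t \<le> \<tau>" for s t
  proof -
    \<comment> \<open>The increment of the product is exact when \<open>l\<close> is frozen at the
      right end and \<open>d\<close> at the left end. The integrand that remains pairs an increment
      of one function with a bounded factor, hence is itself of order \<open>t - s\<close>.\<close>
    let ?e = "\<lambda>r. (l t - l r) \<bullet> q r - p r \<bullet> (d s - d r)"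
    have qi: "q integrable_on {s..t}" and pi: "p integrable_on {s..t}" and hi: "h integrable_on {s..t}"
      using bm bmh that by (auto intro: bm_integrable)
    have i1: "integral {s..t} (\<lambda>r. l t \<bullet> q r) = l t \<bullet> (d t - d s)" "(\<lambda>r. l t \<bullet> q r) integrable_on {s..t}"
      using integral_linear[OF qi bounded_linear_inner_right[of "l t"]] integrable_linear[OF qi bounded_linear_inner_right[of "l t"]] d_inc[OF that] by (auto simp: o_def)
    have i2: "integral {s..t} (\<lambda>r. p r \<bullet> d s) = - ((l t - l s) \<bullet> d s)" "(\<lambda>r. p r \<bullet> d s) integrable_on {s..t}"
      using integral_linear[OF pi bounded_linear_inner_left[of "d s"]] integrable_linear[OF pi bounded_linear_inner_left[of "d s"]] l_inc[OF that] by (auto simp: o_def)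
    have "E t - E s = l t \<bullet> (d t - d s) + (l t - l s) \<bullet> d s - integral {s..t} h"
      unfolding E_def using integral_diff_interval[OF bmh that] by (simp add: algebra_simps)
    also have "\<dots> = integral {s..t} (\<lambda>r. l t \<bullet> q r - p r \<bullet> d s - h r)"
      using i1 i2 hi by (simp add: integral_diff integrable_diff)
    also have "(\<lambda>r. l t \<bullet> q r - p r \<bullet> d s - h r) = ?e"
      unfolding h_def by (auto simp: algebra_simps)
    finally have eq: "E t - E s = integral {s..t} ?e" .
    have "norm (integral {s..t} ?e) \<le> (2 * C * C * (t - s)) * (t - s)"
    proof (rule norm_integral_le)
      show "?e integrable_on {s..t}"
        by (rule bm_integrable[of \<tau>]) (use that in \<open>auto intro!: bm_intros bm bm_continuous[OF ld(1)] bm_continuous[OF ld(2)]\<close>)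
      fix r assume r: "r \<in> {s..t}"
      have "\<bar>(l t - l r) \<bullet> q r\<bar> \<le> norm (l t - l r) * norm (q r)" by (rule Cauchy_Schwarz_ineq2)
      also have "\<dots> \<le> (C * (t - s)) * C"
      proof (rule mult_mono)
        have "norm (l t - l r) \<le> C * (t - r)" using l_lip[of r t] r that by auto
        also have "\<dots> \<le> C * (t - s)" using r C by (intro mult_left_mono) auto
        finally show "norm (l t - l r) \<le> C * (t - s)" .
      qed (use C that r in auto)
      finally have 1: "\<bar>(l t - l r) \<bullet> q r\<bar> \<le> (C * (t - s)) * C" .
      have "\<bar>p r \<bullet> (d s - d r)\<bar> \<le> norm (p r) * norm (d s - d r)" by (rule Cauchy_Schwarz_ineq2)
      also have "\<dots> \<le> C * (C * (t - s))"
      proof (rule mult_mono)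
        have "norm (d s - d r) \<le> C * (r - s)" using d_lip[of s r] r that by (auto simp: norm_minus_commute)
        also have "\<dots> \<le> C * (t - s)" using r C by (intro mult_left_mono) auto
        finally show "norm (d s - d r) \<le> C * (t - s)" .
      qed (use C that r in auto)
      finally show "norm (?e r) \<le> 2 * C * C * (t - s)"
        using 1 by (simp add: algebra_simps abs_le_iff)
    qed (use that in auto)
    then show ?thesis using eq by (simp add: power2_eq_square algebra_simps)
  qed
  have E_inc': "\<bar>E t - E s\<bar> \<le> (2 * C * C) * (t - s)\<^sup>2" if "s \<in> {0..\<tau>}" "t \<in> {0..\<tau>}" for s t
    using E_inc[of s t] E_inc[of t s] that by (cases "s \<le> t") (auto simp: abs_minus_commute power2_commute)
  have "(E has_derivative (\<lambda>h. 0)) (at s within {0..\<tau>})" if s: "s \<in> {0..\<tau>}" for s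
  proof (rule has_derivativeI)
    show "((\<lambda>y. ((E y - E s) - 0) /\<^sub>R norm (y - s)) \<longlongrightarrow> 0) (at s within {0..\<tau>})"
    proof (rule Lim_null_comparison)
      show "\<forall>\<^sub>F y in at s within {0..\<tau>}. norm (((E y - E s) - 0) /\<^sub>R norm (y - s)) \<le> (2 * C * C) * \<bar>y - s\<bar>"
        unfolding eventually_at
      proof (intro exI[of _ 1] conjI ballI impI)
        fix y assume y: "y \<in> {0..\<tau>}" "y \<noteq> s \<and> dist y s < 1"
        then have "\<bar>E y - E s\<bar> \<le> (2 * C * C) * \<bar>y - s\<bar> * \<bar>y - s\<bar>"
          using E_inc'[OF s y(1)] by (simp add: power2_eq_square)
        then show "norm (((E y - E s) - 0) /\<^sub>R norm (y - s)) \<le> (2 * C * C) * \<bar>y - s\<bar>"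
          using y by (simp add: divide_simps)
      qed simp
      show "((\<lambda>y. (2 * C * C) * \<bar>y - s\<bar>) \<longlongrightarrow> 0) (at s within {0..\<tau>})"
        by (rule tendsto_eq_intros refl | simp)+
    qed
  qed auto
  then obtain e where "\<And>t. t \<in> {0..\<tau>} \<Longrightarrow> E t = e"
    using has_derivative_zero_constant[of "{0..\<tau>}" E] by auto
  then have "E \<tau> = E 0" using \<open>0 \<le> \<tau>\<close> by auto
  then show ?thesis
    using \<open>0 \<le> \<tau>\<close> l[of \<tau>] d[of 0] unfolding E_def h_def by simp
qed

text \<open>Let \<open>W\<close> be the mass of \<open>w\<close>. A window of radius
  \<open>\<rho>\<close> around \<open>s0\<close> holds mass at most \<open>2 * \<rho>\<close>,
  because \<open>w\<close> is at most 1, and outside it the distance is at least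
  \<open>\<rho>\<close>. So the integral is at least \<open>\<rho> * (W - 2 * \<rho>)\<close>, which
  is largest at \<open>\<rho> = W / 4\<close>. This quadratic growth in an \<open>L^1\<close> norm
  is the source of the strong concavity.\<close>

lemma weighted_integral_lower_bound:
  assumes w: "bounded_measurable \<tau> w" "\<And>s. s \<in> {0..\<tau>} \<Longrightarrow> 0 \<le> w s \<and> w s \<le> 1"
  shows "(integral {0..\<tau>} w)\<^sup>2 / 8 \<le> integral {0..\<tau>} (\<lambda>s. \<bar>s - s0\<bar> * w s)"
proof -
  define W where "W = integral {0..\<tau>} w"
  define \<rho> where "\<rho> = W / 4"
  have iw: "w integrable_on {0..\<tau>}" using w by (auto intro: bm_integrable)
  have "0 \<le> W" unfolding W_def using w by (intro integral_nonneg iw) auto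
  then have "0 \<le> \<rho>" by (simp add: \<rho>_def)
  let ?a = "max 0 (s0 - \<rho>)" and ?b = "min \<tau> (s0 + \<rho>)"
  let ?ind = "\<lambda>s. if s \<in> {?a..?b} then 1 else 0 :: real"
  have ind: "(?ind has_integral measure lborel {?a..?b}) {0..\<tau>}"
    using has_integral_const_real[of "1::real" ?a ?b]
    by (subst has_integral_restrict) (auto simp: max_def min_def)
  have cont: "measure lborel {?a..?b} \<le> 2 * \<rho>"
    using \<open>0 \<le> \<rho>\<close> by (auto simp: content_real_if max_def min_def)
  have iaw: "(\<lambda>s. \<bar>s - s0\<bar> * w s) integrable_on {0..\<tau>}"
    by (rule bm_integrable[of \<tau>])
      (auto intro!: bm_intros w bm_continuous[of \<tau> "\<lambda>s. s"] continuous_intros)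
  have "\<rho> * W - \<rho> * (2 * \<rho>) \<le> \<rho> * W - \<rho> * measure lborel {?a..?b}"
    using cont \<open>0 \<le> \<rho>\<close> by (auto intro: mult_left_mono)
  also have "\<dots> \<le> integral {0..\<tau>} (\<lambda>s. \<bar>s - s0\<bar> * w s)"
  proof (rule has_integral_le)
    show "((\<lambda>s. \<rho> * w s - \<rho> * ?ind s) has_integral (\<rho> * W - \<rho> * measure lborel {?a..?b})) {0..\<tau>}"
      using ind integrable_integral[OF iw] unfolding W_def
      by (intro has_integral_diff has_integral_mult_right)
    show "((\<lambda>s. \<bar>s - s0\<bar> * w s) has_integral integral {0..\<tau>} (\<lambda>s. \<bar>s - s0\<bar> * w s)) {0..\<tau>}"
      by (rule integrable_integral[OF iaw])
    fix s assume s: "s \<in> {0..\<tau>}"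
    show "\<rho> * w s - \<rho> * ?ind s \<le> \<bar>s - s0\<bar> * w s"
    proof (cases "s \<in> {?a..?b}")
      case True
      have "\<rho> * w s \<le> \<rho> * 1" using w(2)[OF s] \<open>0 \<le> \<rho>\<close> by (intro mult_left_mono) auto
      moreover have "0 \<le> \<bar>s - s0\<bar> * w s" using w(2)[OF s] by simp
      ultimately show ?thesis using True by simp
    next
      case False
      then have "\<rho> \<le> \<bar>s - s0\<bar>" using s by (auto simp: max_def min_def split: if_splits)
      then have "\<rho> * w s \<le> \<bar>s - s0\<bar> * w s" using w(2)[OF s] by (intro mult_right_mono) auto
      then show ?thesis using False by auto
    qed
  qed
  finally show ?thesis unfolding W_def[symmetric] \<rho>_def by (simp add: power2_eq_square field_simps)
qed

text \<open>If \<open>z\<close> were missed, the normalized vector opposite to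
  \<open>f x - z\<close> would define a continuous map of the ball into its sphere. A Brouwer fixed
  point would be a unit vector that is a negative multiple of \<open>f x - z\<close>, against the
  outward condition.\<close>

lemma surjective_if_outward_on_sphere:
  fixes f :: "'a::euclidean_space \<Rightarrow> 'a"
  assumes cont: "continuous_on (cball 0 1) f"
    and out: "\<And>x. norm x = 1 \<Longrightarrow> 0 < x \<bullet> (f x - z)"
  shows "z \<in> f ` cball 0 1"
proof (rule ccontr)
  assume "z \<notin> f ` cball 0 1"
  then have nz: "norm (f x - z) \<noteq> 0" if "x \<in> cball 0 1" for x using that by force
  define g where "g x = - ((1 / norm (f x - z)) *\<^sub>R (f x - z))" for x
  have "continuous_on (cball 0 1) g"
    unfolding g_def by (intro continuous_intros cont) (use nz in auto)
  moreover have g1: "norm (g x) = 1" if "x \<in> cball 0 1" for x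
    unfolding g_def using nz[OF that] by simp
  then have "g \<in> cball 0 1 \<rightarrow> cball 0 1" by auto
  ultimately obtain x where x: "x \<in> cball 0 1" "g x = x"
    using brouwer_ball[of 1 0 g] by auto
  then have nx: "norm x = 1" using g1[OF x(1)] by simp
  have "x \<bullet> x = - (1 / norm (f x - z)) * (x \<bullet> (f x - z))"
    using x(2) unfolding g_def by (metis inner_minus_right inner_scaleR_right mult_minus_left)
  moreover have "0 < (1 / norm (f x - z)) * (x \<bullet> (f x - z))"
    using out[OF nx] nz[OF x(1)] by simp
  moreover have "0 \<le> x \<bullet> x" by simp
  ultimately show False by linarith
qed

section \<open>Controls\<close>

text \<open>Bounds hold at every time and measurability on the whole line, so that one control
  serves all horizons, and midpoints, delays and reflections stay in the set without exceptional
  null sets. Bounds that hold only almost everywhere are handled by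
  \<open>admissible_representative\<close>.\<close>

definition controls :: "('m::finite \<Rightarrow> real \<Rightarrow> real) set" where
  "controls = {u. \<forall>i. u i \<in> borel_measurable lebesgue \<and> (\<forall>t. \<bar>u i t\<bar> \<le> 1)}"

definition control_dist :: "real \<Rightarrow> ('m::finite \<Rightarrow> real \<Rightarrow> real) \<Rightarrow> ('m \<Rightarrow> real \<Rightarrow> real) \<Rightarrow> real" where
  "control_dist \<tau> u v = integral {0..\<tau>} (\<lambda>t. \<Sum>i\<in>UNIV. \<bar>u i t - v i t\<bar>)"

lemma controls_measurable: "u \<in> controls \<Longrightarrow> u i \<in> borel_measurable lebesgue"
  and controls_abs_le: "u \<in> controls \<Longrightarrow> \<bar>u i t\<bar> \<le> 1"
  by (auto simp: controls_def)

lemma controlsI: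
  "(\<And>i. u i \<in> borel_measurable lebesgue) \<Longrightarrow> (\<And>i t. \<bar>u i t\<bar> \<le> 1) \<Longrightarrow> u \<in> controls"
  by (auto simp: controls_def)

lemma zero_in_controls: "(\<lambda>_ _. 0) \<in> controls"
  by (auto simp: controls_def)

lemma bm_control: "u \<in> controls \<Longrightarrow> bounded_measurable \<tau> (u i)"
  by (rule bounded_measurableI[where C=1])
    (auto intro: measurable_restrict_space1 controls_measurable simp: controls_abs_le)

lemma bm_control_sum:
  "u \<in> controls \<Longrightarrow> v \<in> controls \<Longrightarrow> bounded_measurable \<tau> (\<lambda>t. \<Sum>i\<in>UNIV. \<bar>u i t - v i t\<bar>)"
  by (intro bm_intros bm_control) auto

lemma control_dist_nonneg: "0 \<le> control_dist \<tau> u v"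
proof (cases "(\<lambda>t. \<Sum>i\<in>UNIV. \<bar>u i t - v i t\<bar>) integrable_on {0..\<tau>}")
  case True
  then show ?thesis unfolding control_dist_def by (rule integral_nonneg) (auto intro: sum_nonneg)
qed (simp add: control_dist_def not_integrable_integral)

lemma control_dist_commute: "control_dist \<tau> u v = control_dist \<tau> v u"
  unfolding control_dist_def by (simp add: abs_minus_commute)

lemma control_dist_integral_mono:
  assumes "u \<in> controls" "v \<in> controls" "bounded_measurable \<tau> h"
    and "\<And>t. t \<in> {0..\<tau>} \<Longrightarrow> (\<Sum>i\<in>UNIV. \<bar>u i t - v i t\<bar>) \<le> h t"
  shows "control_dist \<tau> u v \<le> integral {0..\<tau>} h"
  unfolding control_dist_def
  by (rule integral_le) (use assms in \<open>auto intro!: bm_integrable[of \<tau>] bm_control_sum\<close>)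

lemma control_dist_triangle:
  assumes "u \<in> controls" "v \<in> controls" "w \<in> controls"
  shows "control_dist \<tau> u w \<le> control_dist \<tau> u v + control_dist \<tau> v w"
proof -
  have "control_dist \<tau> u w \<le>
    integral {0..\<tau>} (\<lambda>t. (\<Sum>i\<in>UNIV. \<bar>u i t - v i t\<bar>) + (\<Sum>i\<in>UNIV. \<bar>v i t - w i t\<bar>))"
  proof (rule control_dist_integral_mono)
    show "bounded_measurable \<tau> (\<lambda>t. (\<Sum>i\<in>UNIV. \<bar>u i t - v i t\<bar>) + (\<Sum>i\<in>UNIV. \<bar>v i t - w i t\<bar>))"
      by (intro bm_add bm_control_sum assms)
  qed (auto intro!: sum_mono simp: sum.distrib[symmetric] assms)
  also have "\<dots> = control_dist \<tau> u v + control_dist \<tau> v w"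
    unfolding control_dist_def
    by (rule integral_add) (auto intro!: bm_integrable[of \<tau>] bm_control_sum assms)
  finally show ?thesis .
qed

lemma bm_lebesgue_integral:
  fixes h :: "real \<Rightarrow> 'a::euclidean_space"
  assumes "bounded_measurable \<tau> h"
  shows "integrable (lebesgue_on {0..\<tau>}) h" "integral\<^sup>L (lebesgue_on {0..\<tau>}) h = integral {0..\<tau>} h"
proof -
  obtain C where C: "\<forall>t\<in>{0..\<tau>}. norm (h t) \<le> C"
    using assms unfolding bounded_measurable_def by blast
  interpret finite_measure "lebesgue_on {0..\<tau>}"
    by (rule finite_measure_lebesgue_on) simp
  show "integrable (lebesgue_on {0..\<tau>}) h"
    by (rule integrable_const_bound[where B=C])
      (use assms C in \<open>auto simp: bounded_measurable_def intro!: AE_I2\<close>)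
  then show "integral\<^sup>L (lebesgue_on {0..\<tau>}) h = integral {0..\<tau>} h"
    by (rule lebesgue_integral_eq_integral) simp
qed

lemma control_dist_eq_0_imp_AE:
  assumes "u \<in> controls" "v \<in> controls" "control_dist \<tau> u v = 0"
  shows "AE t in lebesgue_on {0..\<tau>}. \<forall>i. u i t = v i t"
proof -
  let ?h = "\<lambda>t. \<Sum>i\<in>UNIV. \<bar>u i t - v i t\<bar>"
  have "AE t in lebesgue_on {0..\<tau>}. ?h t = 0"
    using integral_nonneg_eq_0_iff_AE[OF bm_lebesgue_integral(1)[OF bm_control_sum[OF assms(1,2), of \<tau>]]]
      bm_lebesgue_integral(2)[OF bm_control_sum[OF assms(1,2), of \<tau>]] assms(3)
    unfolding control_dist_def by (auto simp: sum_nonneg)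
  then show ?thesis
    by eventually_elim (auto simp: sum_nonneg_eq_0_iff)
qed

text \<open>The Riesz-Fischer argument: along a subsequence with geometrically small steps the total
  variation of the sequence in time-pointwise sense has finite integral, so almost every point
  converges. Dominated convergence gives \<open>L^1\<close> convergence of the subsequence, and the
  Cauchy property transfers it to the whole sequence.\<close>

lemma controls_complete:
  fixes u :: "nat \<Rightarrow> 'm::finite \<Rightarrow> real \<Rightarrow> real"
  assumes u: "\<And>n. u n \<in> controls"
    and Cauchy: "\<And>e. 0 < e \<Longrightarrow> \<exists>N. \<forall>m\<ge>N. \<forall>n\<ge>N. control_dist \<tau> (u m) (u n) < e"
  obtains v where "v \<in> controls" "(\<lambda>n. control_dist \<tau> (u n) v) \<longlonglongrightarrow> 0"
proof -
  let ?M = "lebesgue_on {0..\<tau>}"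
  have "\<exists>N. \<forall>m\<ge>N. \<forall>n\<ge>N. control_dist \<tau> (u m) (u n) < (1/2) ^ k" for k
    by (rule Cauchy) simp
  then obtain N where N: "\<And>k m n. m \<ge> N k \<Longrightarrow> n \<ge> N k \<Longrightarrow> control_dist \<tau> (u m) (u n) < (1/2) ^ k"
    by metis
  \<comment> \<open>Adding up all thresholds so far puts both \<open>r k\<close> and
    \<open>r (Suc k)\<close> beyond \<open>N k\<close>; the summand \<open>k\<close> makes
    \<open>r\<close> unbounded even if the thresholds vanish.\<close>
  define r where "r k = (\<Sum>j\<le>k. N j) + k" for k
  have rN: "r k \<ge> N k" "r (Suc k) \<ge> N k" for k
    unfolding r_def using member_le_sum[of k "{..k}" N] member_le_sum[of k "{..Suc k}" N] by auto
  let ?f = "\<lambda>k t. \<Sum>i\<in>UNIV. \<bar>u (r k) i t - u (r (Suc k)) i t\<bar>"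
  have fb: "bounded_measurable \<tau> (?f k)" for k by (intro bm_control_sum u)
  have fm: "?f k \<in> borel_measurable ?M" for k using fb[of k] unfolding bounded_measurable_def by blast
  have nn: "(\<integral>\<^sup>+t. ennreal (?f k t) \<partial>?M) \<le> ennreal ((1/2) ^ k)" for k
  proof -
    have "(\<integral>\<^sup>+t. ennreal (?f k t) \<partial>?M) = ennreal (integral\<^sup>L ?M (?f k))"
      by (rule nn_integral_eq_integral) (auto intro: bm_lebesgue_integral fb sum_nonneg)
    also have "\<dots> = ennreal (control_dist \<tau> (u (r k)) (u (r (Suc k))))"
      unfolding control_dist_def by (simp add: bm_lebesgue_integral(2)[OF fb])
    also have "\<dots> \<le> ennreal ((1/2) ^ k)"
      using N[OF rN] by (intro ennreal_leI less_imp_le)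
    finally show ?thesis .
  qed
  have "(\<integral>\<^sup>+t. (\<Sum>k. ennreal (?f k t)) \<partial>?M) = (\<Sum>k. \<integral>\<^sup>+t. ennreal (?f k t) \<partial>?M)"
    by (rule nn_integral_suminf) (use fm in auto)
  also have "\<dots> \<le> (\<Sum>k. ennreal ((1/2) ^ k))"
    by (intro suminf_le nn) auto
  also have "\<dots> < \<infinity>"
    by (subst suminf_ennreal2) (auto intro: summable_geometric)
  finally have "AE t in ?M. (\<Sum>k. ennreal (?f k t)) \<noteq> \<infinity>"
    by (intro nn_integral_PInf_AE) (use fm in auto)
  then have conv: "AE t in ?M. \<forall>i. convergent (\<lambda>k. u (r k) i t)"
  proof eventually_elim
    case (elim t)
    then have s: "summable (\<lambda>k. ?f k t)"
      by (intro summable_suminf_not_top) (auto simp: sum_nonneg)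
    show ?case
    proof
      fix i
      have "summable (\<lambda>k. u (r (Suc k)) i t - u (r k) i t)"
      proof (rule summable_comparison_test'[OF s])
        fix k
        show "norm (u (r (Suc k)) i t - u (r k) i t) \<le> ?f k t"
          using member_le_sum[of i UNIV "\<lambda>i. \<bar>u (r k) i t - u (r (Suc k)) i t\<bar>"]
          by (simp add: abs_minus_commute)
      qed
      from tendsto_add[OF summable_LIMSEQ[OF this] tendsto_const[of "u (r 0) i t"]]
      show "convergent (\<lambda>k. u (r k) i t)"
        using sum_lessThan_telescope[of "\<lambda>k. u (r k) i t"] by (auto simp: convergent_def)
    qed
  qed
  \<comment> \<open>Limits exist only almost everywhere. Clamping makes \<open>v\<close> a control
    at every time and changes nothing where the sequence converges.\<close>
  define v where "v i t = max (-1) (min 1 (lim (\<lambda>k. u (r k) i t)))" for i t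
  have v: "v \<in> controls"
  proof (rule controlsI)
    fix i
    have "u (r k) i \<in> borel_measurable lebesgue" for k by (rule controls_measurable[OF u])
    then show "v i \<in> borel_measurable lebesgue"
      unfolding v_def by (intro borel_measurable_max borel_measurable_min borel_measurable_const borel_measurable_lim_metric)
  qed (auto simp: v_def)
  have lim: "AE t in ?M. (\<lambda>k. \<Sum>i\<in>UNIV. \<bar>u (r k) i t - v i t\<bar>) \<longlonglongrightarrow> 0"
    using conv
  proof eventually_elim
    case (elim t)
    have "(\<lambda>k. u (r k) i t) \<longlonglongrightarrow> v i t" for i
    proof -
      have l: "(\<lambda>k. u (r k) i t) \<longlonglongrightarrow> lim (\<lambda>k. u (r k) i t)"
        using elim by (simp add: convergent_LIMSEQ_iff)
      have "-1 \<le> u (r k) i t" "u (r k) i t \<le> 1" for k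
        using controls_abs_le[OF u, of "r k" i t] by auto
      then have "-1 \<le> lim (\<lambda>k. u (r k) i t)" "lim (\<lambda>k. u (r k) i t) \<le> 1"
        by (auto intro!: LIMSEQ_le_const[OF l] LIMSEQ_le_const2[OF l])
      then show ?thesis using l by (simp add: v_def)
    qed
    then have "(\<lambda>k. \<Sum>i\<in>UNIV. \<bar>u (r k) i t - v i t\<bar>) \<longlonglongrightarrow> (\<Sum>i\<in>(UNIV::'m set). \<bar>v i t - v i t\<bar>)"
      by (intro tendsto_intros)
    then show ?case by simp
  qed
  have "(\<lambda>k. integral\<^sup>L ?M (\<lambda>t. \<Sum>i\<in>UNIV. \<bar>u (r k) i t - v i t\<bar>)) \<longlonglongrightarrow> integral\<^sup>L ?M (\<lambda>_. 0::real)"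
  proof (rule integral_dominated_convergence[where w="\<lambda>_. 2 * real CARD('m)"])
    show "(\<lambda>t. \<Sum>i\<in>UNIV. \<bar>u (r k) i t - v i t\<bar>) \<in> borel_measurable ?M" for k
      using bm_control_sum[OF u v] unfolding bounded_measurable_def by blast
    show "integrable ?M (\<lambda>_. 2 * real CARD('m))"
      by (rule bm_lebesgue_integral) (rule bm_intros)
    have "(\<Sum>i\<in>UNIV. \<bar>u (r k) i t - v i t\<bar>) \<le> (\<Sum>i\<in>(UNIV::'m set). 2)" for k t
      by (rule sum_mono) (use controls_abs_le[OF u, of "r k" _ t] controls_abs_le[OF v, of _ t] in \<open>smt (verit)\<close>)
    then show "AE t in ?M. norm (\<Sum>i\<in>UNIV. \<bar>u (r k) i t - v i t\<bar>) \<le> 2 * real CARD('m)" for k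
      by (intro AE_I2) (simp add: sum_nonneg mult.commute)
  qed (use lim in auto)
  then have sub: "(\<lambda>k. control_dist \<tau> (u (r k)) v) \<longlonglongrightarrow> 0"
    unfolding control_dist_def by (simp add: bm_lebesgue_integral(2)[OF bm_control_sum[OF u v]])
  have "(\<lambda>n. control_dist \<tau> (u n) v) \<longlonglongrightarrow> 0"
  proof (rule LIMSEQ_I)
    fix e :: real assume "0 < e"
    obtain N1 where N1: "\<And>m n. m \<ge> N1 \<Longrightarrow> n \<ge> N1 \<Longrightarrow> control_dist \<tau> (u m) (u n) < e / 2"
      using Cauchy[of "e/2"] \<open>0 < e\<close> by auto
    obtain N2 where N2: "\<And>k. k \<ge> N2 \<Longrightarrow> control_dist \<tau> (u (r k)) v < e / 2"
      using LIMSEQ_D[OF sub, of "e/2"] \<open>0 < e\<close> by (auto simp: abs_of_nonneg control_dist_nonneg)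
    show "\<exists>no. \<forall>n\<ge>no. norm (control_dist \<tau> (u n) v - 0) < e"
    proof (intro exI allI impI)
      fix n assume n: "N1 \<le> n"
      define k where "k = max N1 N2"
      have "r k \<ge> N1" "k \<ge> N2" unfolding r_def k_def by auto
      then have k: "k \<ge> N2" "control_dist \<tau> (u n) (u (r k)) < e / 2"
        using N1[OF n] by auto
      have "control_dist \<tau> (u n) v \<le> control_dist \<tau> (u n) (u (r k)) + control_dist \<tau> (u (r k)) v"
        by (rule control_dist_triangle[OF u u v])
      then show "norm (control_dist \<tau> (u n) v - 0) < e"
        using k(2) N2[OF k(1)] control_dist_nonneg[of \<tau> "u n" v] by simp
    qed
  qed
  then show thesis using that v by blast
qed

section \<open>Trajectories\<close>

text \<open>Smoothness enters only through inequalities on the unit ball with one constant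
  \<open>K0\<close>, which is what makes the later constants uniform. The factors
  \<open>norm x + norm x'\<close> in \<open>g_lip\<close> and \<open>norm x\<close> in
  \<open>Dg_near\<close> record that the columns have zero derivative at the origin.
  \<open>nondegenerate\<close> is the rank condition, made quantitative and uniform over unit
  directions.\<close>

locale control_system =
  fixes F :: "'a::euclidean_space \<Rightarrow> 'a" and g :: "'m::finite \<Rightarrow> 'a \<Rightarrow> 'a"
    and DF :: "'a \<Rightarrow> 'a \<Rightarrow> 'a" and Dg :: "'m \<Rightarrow> 'a \<Rightarrow> 'a \<Rightarrow> 'a" and K0 \<kappa> :: real
  assumes F0: "F 0 = 0" and K0: "1 \<le> K0" and kappa: "0 < \<kappa>"
    and contF: "continuous_on UNIV F" and contg: "\<And>i. continuous_on UNIV (g i)"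
    and contDF: "\<And>h. continuous_on UNIV (\<lambda>x. DF x h)"
    and contDg: "\<And>i h. continuous_on UNIV (\<lambda>x. Dg i x h)"
    and linDF: "\<And>x. linear (DF x)" and linDg: "\<And>i x. linear (Dg i x)"
    and F_lip: "\<And>x x'. norm x \<le> 1 \<Longrightarrow> norm x' \<le> 1 \<Longrightarrow> norm (F x - F x') \<le> K0 * norm (x - x')"
    and F_quad: "\<And>x x'. norm x \<le> 1 \<Longrightarrow> norm x' \<le> 1 \<Longrightarrow>
      norm (F x - F x' - DF x' (x - x')) \<le> K0 * (norm (x - x'))\<^sup>2"
    and DF_near: "\<And>x h. norm x \<le> 1 \<Longrightarrow> norm (DF x h - DF 0 h) \<le> K0 * norm x * norm h"
    and DF_bd: "\<And>x h. norm x \<le> 1 \<Longrightarrow> norm (DF x h) \<le> K0 * norm h"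
    and g_bd: "\<And>i x. norm x \<le> 1 \<Longrightarrow> norm (g i x) \<le> K0"
    and g_lip: "\<And>i x x'. norm x \<le> 1 \<Longrightarrow> norm x' \<le> 1 \<Longrightarrow>
      norm (g i x - g i x') \<le> K0 * (norm x + norm x') * norm (x - x')"
    and g_quad: "\<And>i x x'. norm x \<le> 1 \<Longrightarrow> norm x' \<le> 1 \<Longrightarrow>
      norm (g i x - g i x' - Dg i x' (x - x')) \<le> K0 * (norm (x - x'))\<^sup>2"
    and Dg_near: "\<And>i x h. norm x \<le> 1 \<Longrightarrow> norm (Dg i x h) \<le> K0 * norm x * norm h"
    and nondegenerate: "\<And>i \<zeta>. norm \<zeta> = 1 \<Longrightarrow> \<kappa> \<le> \<bar>\<zeta> \<bullet> g i 0\<bar> \<or> \<kappa> \<le> \<bar>\<zeta> \<bullet> DF 0 (g i 0)\<bar>"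
begin

text \<open>One share of \<open>K0\<close> for \<open>F\<close> and \<open>2 * K0\<close> for each
  of the columns, since the factor \<open>norm x + norm x'\<close> can reach 2 in the unit
  ball.\<close>

definition K :: real where "K = (1 + 2 * real CARD('m)) * K0"

text \<open>Below this time the expansion error is at most half of the gain from switching, and
  trajectories from the origin stay in the unit ball, where the estimates of the locale hold.\<close>

definition T0 :: real where "T0 = min (1 / (2 * K)) (\<kappa> / (1024 * real CARD('m) * K ^ 3))"

definition field :: "'a \<Rightarrow> ('m \<Rightarrow> real) \<Rightarrow> 'a" where
  "field x v = F x + (\<Sum>i\<in>UNIV. v i *\<^sub>R g i x)"

definition Dfield :: "'a \<Rightarrow> ('m \<Rightarrow> real) \<Rightarrow> 'a \<Rightarrow> 'a" where
  "Dfield x v h = DF x h + (\<Sum>i\<in>UNIV. v i *\<^sub>R Dg i x h)"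

lemma CARD_ge: "1 \<le> real CARD('m)"
  by (simp add: Suc_leI)

lemma K0_le_K: "K0 \<le> K"
  using K0 by (simp add: K_def)

lemma K_ge: "1 \<le> K"
  using K0 K0_le_K by linarith

lemma T0_pos: "0 < T0"
  unfolding T0_def using K_ge kappa CARD_ge by auto

lemma
  assumes "0 \<le> \<tau>" "\<tau> \<le> T0"
  shows K_tau: "K * \<tau> \<le> 1/2" and tau_le: "\<tau> \<le> 1/2"
    and K3_tau: "1024 * real CARD('m) * (K ^ 3 * \<tau>) \<le> \<kappa>"
proof -
  have "\<tau> \<le> 1 / (2 * K)" "\<tau> \<le> \<kappa> / (1024 * real CARD('m) * K ^ 3)"
    using assms unfolding T0_def by auto
  then show *: "K * \<tau> \<le> 1/2" "1024 * real CARD('m) * (K ^ 3 * \<tau>) \<le> \<kappa>"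
    using K_ge CARD_ge by (simp_all add: field_simps)
  have "1 * \<tau> \<le> K * \<tau>" by (rule mult_right_mono) (use K_ge assms in auto)
  then show "\<tau> \<le> 1/2" using * by simp
qed

lemma norm_weighted_sum_le:
  fixes h :: "'m \<Rightarrow> 'a"
  assumes "\<And>i. \<bar>v i\<bar> \<le> 1" "\<And>i. norm (h i) \<le> C"
  shows "norm (\<Sum>i\<in>UNIV. v i *\<^sub>R h i) \<le> real CARD('m) * C"
proof -
  have "norm (v i *\<^sub>R h i) \<le> 1 * C" for i
    unfolding norm_scaleR by (rule mult_mono) (use assms in auto)
  then have "norm (\<Sum>i\<in>UNIV. v i *\<^sub>R h i) \<le> of_nat (card (UNIV::'m set)) * C"
    by (intro sum_norm_bound) auto
  then show ?thesis by simp
qed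

lemma norm_weighted_sum_le':
  fixes h :: "'m \<Rightarrow> 'a"
  assumes "\<And>i. norm (h i) \<le> C"
  shows "norm (\<Sum>i\<in>UNIV. v i *\<^sub>R h i) \<le> C * (\<Sum>i\<in>UNIV. \<bar>v i\<bar>)"
  unfolding sum_distrib_left
proof (rule sum_norm_le)
  fix i
  show "norm (v i *\<^sub>R h i) \<le> C * \<bar>v i\<bar>"
    using mult_right_mono[OF assms[of i], of "\<bar>v i\<bar>"] by (simp add: mult.commute)
qed

lemma K_bound: "K0 * a + real CARD('m) * (2 * K0 * a) = K * a"
  unfolding K_def by (simp add: algebra_simps)

lemma field_norm_le:
  assumes "norm x \<le> 1" "\<And>i. \<bar>v i\<bar> \<le> 1"
  shows "norm (field x v) \<le> K"
proof -
  have "norm (F x) \<le> K0"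
    using F_lip[OF assms(1), of 0] F0 assms(1) K0 mult_left_mono[of "norm x" 1 K0]
    by (simp add: order_trans[of _ "K0 * norm x" K0])
  moreover have "norm (\<Sum>i\<in>UNIV. v i *\<^sub>R g i x) \<le> real CARD('m) * (2 * K0)"
    by (rule norm_weighted_sum_le[OF assms(2)], rule order_trans[OF g_bd[OF assms(1)]]) (use K0 in simp)
  ultimately show ?thesis
    unfolding field_def using K_bound[of 1] norm_triangle_ineq[of "F x"] by (smt (verit) mult_cancel_left2)
qed

lemma field_lipschitz:
  assumes "norm x \<le> 1" "norm x' \<le> 1" "\<And>i. \<bar>v i\<bar> \<le> 1"
  shows "norm (field x v - field x' v) \<le> K * norm (x - x')"
proof -
  have "norm (\<Sum>i\<in>UNIV. v i *\<^sub>R (g i x - g i x')) \<le> real CARD('m) * (2 * K0 * norm (x - x'))"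
  proof (rule norm_weighted_sum_le[OF assms(3)])
    fix i
    have "norm (g i x - g i x') \<le> K0 * (norm x + norm x') * norm (x - x')"
      by (rule g_lip[OF assms(1,2)])
    also have "\<dots> \<le> K0 * 2 * norm (x - x')"
      using assms K0 by (intro mult_right_mono mult_left_mono) auto
    finally show "norm (g i x - g i x') \<le> 2 * K0 * norm (x - x')" by simp
  qed
  moreover have "field x v - field x' v = (F x - F x') + (\<Sum>i\<in>UNIV. v i *\<^sub>R (g i x - g i x'))"
    unfolding field_def by (simp add: scaleR_diff_right sum_subtractf)
  ultimately show ?thesis
    using F_lip[OF assms(1,2)] K_bound[of "norm (x - x')"] norm_triangle_ineq[of "F x - F x'"]
    by (smt (verit))
qed

lemma field_quad:
  assumes "norm x \<le> 1" "norm x' \<le> 1" "\<And>i. \<bar>v i\<bar> \<le> 1"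
  shows "norm (field x v - field x' v - Dfield x' v (x - x')) \<le> K * (norm (x - x'))\<^sup>2"
proof -
  have "norm (\<Sum>i\<in>UNIV. v i *\<^sub>R (g i x - g i x' - Dg i x' (x - x'))) \<le> real CARD('m) * (2 * K0 * (norm (x - x'))\<^sup>2)"
  proof (rule norm_weighted_sum_le[OF assms(3)])
    fix i
    have "norm (g i x - g i x' - Dg i x' (x - x')) \<le> K0 * (norm (x - x'))\<^sup>2"
      by (rule g_quad[OF assms(1,2)])
    also have "\<dots> \<le> 2 * K0 * (norm (x - x'))\<^sup>2"
      using K0 by (intro mult_right_mono) auto
    finally show "norm (g i x - g i x' - Dg i x' (x - x')) \<le> 2 * K0 * (norm (x - x'))\<^sup>2" .
  qed
  moreover have "field x v - field x' v - Dfield x' v (x - x') =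
    (F x - F x' - DF x' (x - x')) + (\<Sum>i\<in>UNIV. v i *\<^sub>R (g i x - g i x' - Dg i x' (x - x')))"
    unfolding field_def Dfield_def by (simp add: scaleR_diff_right sum_subtractf)
  ultimately show ?thesis
    using F_quad[OF assms(1,2)] K_bound[of "(norm (x - x'))\<^sup>2"] norm_triangle_ineq[of "F x - F x' - DF x' (x - x')"]
    by (smt (verit))
qed

lemma Dfield_norm_le:
  assumes "norm x \<le> 1" "\<And>i. \<bar>v i\<bar> \<le> 1"
  shows "norm (Dfield x v h) \<le> K * norm h"
    and "norm (Dfield x v h - DF 0 h) \<le> K * norm x * norm h"
proof -
  have le: "norm (\<Sum>i\<in>UNIV. v i *\<^sub>R Dg i x h) \<le> real CARD('m) * (K0 * norm x * norm h)"
    by (rule norm_weighted_sum_le[OF assms(2)]) (rule Dg_near[OF assms(1)])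
  also have "\<dots> \<le> real CARD('m) * (2 * K0 * (norm x * norm h))"
    using K0 by (intro mult_left_mono) auto
  finally have le2: "norm (\<Sum>i\<in>UNIV. v i *\<^sub>R Dg i x h) \<le> real CARD('m) * (2 * K0 * (norm x * norm h))" .
  also have "\<dots> \<le> real CARD('m) * (2 * K0 * (1 * norm h))"
    using K0 assms by (intro mult_left_mono mult_right_mono) auto
  finally have le3: "norm (\<Sum>i\<in>UNIV. v i *\<^sub>R Dg i x h) \<le> real CARD('m) * (2 * K0 * norm h)" by simp
  show "norm (Dfield x v h) \<le> K * norm h"
    unfolding Dfield_def using le3 DF_bd[OF assms(1), of h] K_bound[of "norm h"]
      norm_triangle_ineq[of "DF x h" "\<Sum>i\<in>UNIV. v i *\<^sub>R Dg i x h"] by linarith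
  have "Dfield x v h - DF 0 h = (DF x h - DF 0 h) + (\<Sum>i\<in>UNIV. v i *\<^sub>R Dg i x h)"
    unfolding Dfield_def by simp
  then show "norm (Dfield x v h - DF 0 h) \<le> K * norm x * norm h"
    using norm_triangle_mono[OF DF_near[OF assms(1), of h] le2] K_bound[of "norm x * norm h"]
    unfolding mult.assoc by (simp only:)
qed

lemma linear_Dfield: "linear (Dfield x v)"
  unfolding Dfield_def using linear_add[OF linDF] linear_add[OF linDg] linear_scale[OF linDF] linear_scale[OF linDg]
  by (intro linearI) (auto simp: algebra_simps sum.distrib scaleR_sum_right)

lemma bm_compose:
  assumes "continuous_on UNIV \<phi>" "continuous_on {0..\<tau>} y"
  shows "bounded_measurable \<tau> (\<lambda>s. \<phi> (y s))"
  by (rule bm_continuous, rule continuous_on_compose2[OF assms]) auto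

lemma bm_field:
  assumes "u \<in> controls" "continuous_on {0..\<tau>} y"
  shows "bounded_measurable \<tau> (\<lambda>s. field (y s) (\<lambda>i. u i s))"
  unfolding field_def
  by (intro bm_intros bm_compose[OF contF] bm_compose[OF contg] bm_control assms) auto

lemma bm_Dfield:
  assumes "u \<in> controls" "continuous_on {0..\<tau>} y"
  shows "bounded_measurable \<tau> (\<lambda>s. Dfield (y s) (\<lambda>i. u i s) h)"
  unfolding Dfield_def
  by (intro bm_intros bm_compose[OF contDF] bm_compose[OF contDg] bm_control assms) auto

definition integral_solution :: "real \<Rightarrow> ('m \<Rightarrow> real \<Rightarrow> real) \<Rightarrow> (real \<Rightarrow> 'a) \<Rightarrow> bool" where
  "integral_solution \<tau> u y \<longleftrightarrow> continuous_on {0..\<tau>} y \<and>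
     (\<forall>t\<in>{0..\<tau>}. y t = integral {0..t} (\<lambda>s. field (y s) (\<lambda>i. u i s)))"

text \<open>Chosen once on the longest interval \<open>{0..T0}\<close>; by
  \<open>integral_solution_unique\<close> it is the solution for every shorter horizon as well, so
  the horizon is not an argument.\<close>

definition traj :: "('m \<Rightarrow> real \<Rightarrow> real) \<Rightarrow> real \<Rightarrow> 'a" where
  "traj u = (SOME y. integral_solution T0 u y \<and> y ` {0..T0} \<subseteq> cball 0 1)"

lemma traj_exists:
  assumes u: "u \<in> controls"
  shows "\<exists>y. integral_solution T0 u y \<and> y ` {0..T0} \<subseteq> cball 0 1"
proof -
  have ub: "\<bar>u i s\<bar> \<le> 1" for i s by (rule controls_abs_le[OF u])
  have "0 \<le> T0" using T0_pos by simp
  obtain y where y: "continuous_on {0..T0} y" "y ` {0..T0} \<subseteq> cball 0 1"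
    "\<And>t. t \<in> {0..T0} \<Longrightarrow> y t = 0 + integral {0..t} (\<lambda>s. field (y s) (\<lambda>i. u i s))"
  proof (rule picard_existence[of 1 T0 K K "\<lambda>t. {0..t}" 0 "\<lambda>s x. field x (\<lambda>i. u i s)"])
    show "(\<lambda>s. field (y s) (\<lambda>i. u i s)) integrable_on {0..T0}" if "continuous_on {0..T0} y" for y
      by (rule bm_integrable[OF bm_field[OF u that]]) auto
  qed (use K_tau[OF \<open>0 \<le> T0\<close> order_refl] \<open>0 \<le> T0\<close> K_ge field_lipschitz ub field_norm_le in \<open>auto simp: norm_minus_commute\<close>)
  then have "integral_solution T0 u y" unfolding integral_solution_def by simp
  then show ?thesis using y(2) by blast
qed

lemma
  assumes "u \<in> controls"
  shows traj_solution: "integral_solution T0 u (traj u)"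
    and traj_ball: "t \<in> {0..T0} \<Longrightarrow> norm (traj u t) \<le> 1"
  using someI_ex[OF traj_exists[OF assms]] unfolding traj_def[symmetric]
  by (auto simp: image_subset_iff)

lemma traj_continuous: "u \<in> controls \<Longrightarrow> \<tau> \<le> T0 \<Longrightarrow> continuous_on {0..\<tau>} (traj u)"
  using traj_solution[of u] unfolding integral_solution_def
  by (auto intro: continuous_on_subset[of "{0..T0}"])

lemma traj_eq:
  "u \<in> controls \<Longrightarrow> t \<in> {0..T0} \<Longrightarrow>
    traj u t = integral {0..t} (\<lambda>s. field (traj u s) (\<lambda>i. u i s))"
  using traj_solution unfolding integral_solution_def by blast

text \<open>Uniqueness must cover solutions not known in advance to stay in the unit ball, where
  alone the estimates are available. Up to the first time \<open>r\<close> at which the norm is 1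
  the speed bound \<open>K\<close> is valid, which would give
  \<open>1 \<le> K * r \<le> 1/2\<close>.\<close>

lemma integral_solution_ball:
  assumes u: "u \<in> controls" and "\<tau> \<le> T0" and y: "integral_solution \<tau> u y" and t: "t \<in> {0..\<tau>}"
  shows "norm (y t) < 1"
proof (rule ccontr)
  assume "\<not> norm (y t) < 1"
  have yc: "continuous_on {0..\<tau>} y"
    and ye: "\<And>t. t \<in> {0..\<tau>} \<Longrightarrow> y t = integral {0..t} (\<lambda>s. field (y s) (\<lambda>i. u i s))"
    using y unfolding integral_solution_def by auto
  let ?S = "{s \<in> {0..\<tau>}. 1 \<le> norm (y s)}"
  have "closed ?S"
    by (intro continuous_on_closed_Collect_le continuous_intros yc)
  then have "compact ?S"
    by (metis (no_types, lifting) compact_Icc closed_Int_compact inf.absorb_iff1 mem_Collect_eq subsetI)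
  moreover have "?S \<noteq> {}" using t \<open>\<not> norm (y t) < 1\<close> by force
  ultimately obtain r where r: "r \<in> ?S" "\<And>s. s \<in> ?S \<Longrightarrow> r \<le> s"
    using compact_attains_inf[of ?S] by blast
  have y0: "y 0 = 0" using ye[of 0] t by auto
  have "continuous_on {0..r} (\<lambda>s. norm (y s))"
    using r by (auto intro!: continuous_intros continuous_on_subset[OF yc])
  then obtain s where s: "0 \<le> s" "s \<le> r" "norm (y s) = 1"
    using IVT'[of "\<lambda>s. norm (y s)" 0 1 r] r y0 by auto
  have "s = r" using r(2)[of s] s r(1) by auto
  have ball: "norm (y q) \<le> 1" if "q \<in> {0..r}" for q
  proof (cases "q = r")
    case False
    then show ?thesis using r(2)[of q] that r(1) by force
  qed (use s \<open>s = r\<close> in simp)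
  have "norm (integral {0..r} (\<lambda>s. field (y s) (\<lambda>i. u i s))) \<le> K * (r - 0)"
  proof (rule norm_integral_le)
    show "(\<lambda>s. field (y s) (\<lambda>i. u i s)) integrable_on {0..r}"
      by (rule bm_integrable[OF bm_field[OF u yc]]) (use r in auto)
  qed (use r ball in \<open>auto intro!: field_norm_le controls_abs_le[OF u]\<close>)
  then have "1 \<le> K * r" using ye[of r] r(1) by simp
  moreover have "K * r \<le> 1/2" by (rule K_tau) (use r assms(2) in auto)
  ultimately show False by simp
qed

lemma integral_solution_unique:
  assumes u: "u \<in> controls" and "\<tau> \<le> T0" and y: "integral_solution \<tau> u y" and t: "t \<in> {0..\<tau>}"
  shows "y t = traj u t"
proof -
  have yc: "continuous_on {0..\<tau>} y"
    and ye: "\<And>t. t \<in> {0..\<tau>} \<Longrightarrow> y t = integral {0..t} (\<lambda>s. field (y s) (\<lambda>i. u i s))"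
    using y unfolding integral_solution_def by auto
  have tc: "continuous_on {0..\<tau>} (traj u)" by (rule traj_continuous[OF u assms(2)])
  have "norm (y t - traj u t) \<le> 2 * 0"
  proof (rule bootstrap_bound[OF _ _ t])
    show "continuous_on {0..\<tau>} (\<lambda>t. norm (y t - traj u t))"
      by (intro continuous_intros yc tc)
    fix s t assume s: "\<And>t. t \<in> {0..\<tau>} \<Longrightarrow> norm (y t - traj u t) \<le> s" and t: "t \<in> {0..\<tau>}"
    have "0 \<le> s" using order_trans[OF norm_ge_zero s[OF t]] .
    have i: "(\<lambda>s. field (y s) (\<lambda>i. u i s)) integrable_on {0..t}"
      "(\<lambda>s. field (traj u s) (\<lambda>i. u i s)) integrable_on {0..t}"
      using bm_integrable[OF bm_field[OF u yc]] bm_integrable[OF bm_field[OF u tc]] t by auto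
    have "norm (integral {0..t} (\<lambda>s. field (y s) (\<lambda>i. u i s) - field (traj u s) (\<lambda>i. u i s))) \<le> (K * s) * (t - 0)"
    proof (rule norm_integral_le)
      fix r assume r: "r \<in> {0..t}"
      have "norm (field (y r) (\<lambda>i. u i r) - field (traj u r) (\<lambda>i. u i r)) \<le> K * norm (y r - traj u r)"
        using integral_solution_ball[OF u assms(2) y, of r] traj_ball[OF u, of r] r t assms(2)
        by (intro field_lipschitz controls_abs_le[OF u]) auto
      also have "\<dots> \<le> K * s" using s[of r] r t K_ge by (intro mult_left_mono) auto
      finally show "norm (field (y r) (\<lambda>i. u i r) - field (traj u r) (\<lambda>i. u i r)) \<le> K * s" .
    qed (use t i in \<open>auto intro: integrable_diff\<close>)
    also have "\<dots> = (K * t) * s" by simp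
    also have "\<dots> \<le> 1/2 * s" using K_tau[of t] t assms(2) \<open>0 \<le> s\<close> by (intro mult_right_mono) auto
    finally show "norm (y t - traj u t) \<le> 0 + s / 2"
      using ye[OF t] traj_eq[OF u, of t] t assms(2) integral_diff[OF i] by simp
  qed
  then show ?thesis by simp
qed

lemma traj_norm_le:
  assumes u: "u \<in> controls" and t: "t \<in> {0..T0}"
  shows "norm (traj u t) \<le> K * t"
proof -
  have "norm (integral {0..t} (\<lambda>s. field (traj u s) (\<lambda>i. u i s))) \<le> K * (t - 0)"
  proof (rule norm_integral_le)
    show "(\<lambda>s. field (traj u s) (\<lambda>i. u i s)) integrable_on {0..t}"
      by (rule bm_integrable[OF bm_field[OF u traj_continuous[OF u order_refl]]]) (use t in auto)
  qed (use t traj_ball[OF u] in \<open>auto intro!: field_norm_le controls_abs_le[OF u]\<close>)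
  then show ?thesis using traj_eq[OF u t] by simp
qed

lemma field_control_diff:
  "field x v - field x w = (\<Sum>i\<in>UNIV. (v i - w i) *\<^sub>R g i x)"
  unfolding field_def by (simp add: scaleR_diff_left sum_subtractf)

lemma traj_diff_eq:
  assumes u: "u \<in> controls" and v: "v \<in> controls" and t: "t \<in> {0..T0}"
  shows "traj v t - traj u t =
    integral {0..t} (\<lambda>s. field (traj v s) (\<lambda>i. v i s) - field (traj u s) (\<lambda>i. u i s))"
proof -
  have i: "(\<lambda>s. field (traj v s) (\<lambda>i. v i s)) integrable_on {0..t}"
    "(\<lambda>s. field (traj u s) (\<lambda>i. u i s)) integrable_on {0..t}"
    by (rule bm_integrable[OF bm_field[OF v traj_continuous[OF v order_refl]]]
          bm_integrable[OF bm_field[OF u traj_continuous[OF u order_refl]]]; use t in auto)+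
  show ?thesis using integral_diff[OF i] traj_eq u v t by simp
qed

text \<open>The velocities differ through the state and through the control. If \<open>s\<close>
  bounds the difference of the trajectories, the first part contributes at most
  \<open>K * t * s \<le> s / 2\<close> and is absorbed by \<open>bootstrap_bound\<close>; the second
  contributes \<open>K\<close> times the \<open>L^1\<close> distance of the controls.\<close>

lemma traj_lipschitz:
  assumes u: "u \<in> controls" and v: "v \<in> controls" and tau: "\<tau> \<le> T0" and t: "t \<in> {0..\<tau>}"
  shows "norm (traj v t - traj u t) \<le> 2 * K * control_dist \<tau> u v"
proof -
  let ?d = "\<lambda>t. \<Sum>i\<in>UNIV. \<bar>u i t - v i t\<bar>"
  have tc: "continuous_on {0..\<tau>} (traj u)" "continuous_on {0..\<tau>} (traj v)"
    by (rule traj_continuous[OF _ tau], fact)+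
  have "norm (traj v t - traj u t) \<le> 2 * (K * control_dist \<tau> u v)"
  proof (rule bootstrap_bound[OF _ _ t])
    show "continuous_on {0..\<tau>} (\<lambda>t. norm (traj v t - traj u t))"
      by (intro continuous_intros tc)
    fix s t assume s: "\<And>t. t \<in> {0..\<tau>} \<Longrightarrow> norm (traj v t - traj u t) \<le> s" and t: "t \<in> {0..\<tau>}"
    have "0 \<le> s" using order_trans[OF norm_ge_zero s[OF t]] .
    have dint: "?d integrable_on {0..b}" if "b \<le> \<tau>" for b
      by (rule bm_integrable[OF bm_control_sum[OF u v]]) (use that in auto)
    let ?f = "\<lambda>s. field (traj v s) (\<lambda>i. v i s) - field (traj u s) (\<lambda>i. u i s)"
    have "norm (integral {0..t} ?f) \<le> integral {0..t} (\<lambda>r. K * s + K * ?d r)"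
    proof (rule integral_norm_bound_integral)
      show "?f integrable_on {0..t}"
        by (rule bm_integrable[of \<tau>]) (use t in \<open>auto intro!: bm_diff bm_field u v tc\<close>)
      show "(\<lambda>r. K * s + K * ?d r) integrable_on {0..t}"
        by (intro integrable_add integrable_on_mult_right dint) (use t in auto)
      fix r assume r: "r \<in> {0..t}"
      have nb: "norm (traj v r) \<le> 1" "norm (traj u r) \<le> 1"
        using traj_ball u v r t tau by auto
      have "norm (field (traj v r) (\<lambda>i. v i r) - field (traj u r) (\<lambda>i. v i r)) \<le> K * norm (traj v r - traj u r)"
        by (intro field_lipschitz controls_abs_le[OF v] nb)
      also have "\<dots> \<le> K * s" using s[of r] r t K_ge by (intro mult_left_mono) auto
      finally have 1: "norm (field (traj v r) (\<lambda>i. v i r) - field (traj u r) (\<lambda>i. v i r)) \<le> K * s" .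
      have "norm (field (traj u r) (\<lambda>i. v i r) - field (traj u r) (\<lambda>i. u i r)) \<le> K * (\<Sum>i\<in>UNIV. \<bar>v i r - u i r\<bar>)"
        unfolding field_control_diff
        by (rule norm_weighted_sum_le') (use g_bd[OF nb(2)] K0_le_K in \<open>auto intro: order_trans\<close>)
      then have 2: "norm (field (traj u r) (\<lambda>i. v i r) - field (traj u r) (\<lambda>i. u i r)) \<le> K * ?d r"
        by (simp add: abs_minus_commute)
      show "norm (?f r) \<le> K * s + K * ?d r"
        using norm_triangle_mono[OF 1 2] by simp
    qed
    also have "\<dots> = K * s * t + K * integral {0..t} ?d"
      using t dint[of t] by (subst integral_add) (auto intro!: integrable_on_mult_right)
    also have "integral {0..t} ?d \<le> control_dist \<tau> u v"
      unfolding control_dist_def using t dint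
      by (intro integral_subset_le) (auto intro: sum_nonneg)
    also have "K * s * t = (K * t) * s" by simp
    also have "\<dots> \<le> 1/2 * s" using K_tau[of t] t tau \<open>0 \<le> s\<close> by (intro mult_right_mono) auto
    finally show "norm (traj v t - traj u t) \<le> K * control_dist \<tau> u v + s / 2"
      using traj_diff_eq[OF u v, of t] t tau K_ge by (simp add: mult_left_mono)
  qed
  then show ?thesis by simp
qed

end

section \<open>First-order expansion of the end-point map\<close>

text \<open>With slope at least \<open>k\<close>, either there is a zero, which serves as
  \<open>s0\<close>, or the function keeps one sign and \<open>s0\<close> is the end of the interval
  where it is closest to zero.\<close>

lemma monotone_linear_lower_bound:
  fixes \<sigma> :: "real \<Rightarrow> real"
  assumes cont: "continuous_on {0..\<tau>} \<sigma>" and "0 \<le> k" "0 \<le> \<tau>"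
    and inc: "\<And>s t. 0 \<le> s \<Longrightarrow> s \<le> t \<Longrightarrow> t \<le> \<tau> \<Longrightarrow> k * (t - s) \<le> \<sigma> t - \<sigma> s"
  shows "\<exists>s0. \<forall>s\<in>{0..\<tau>}. k * \<bar>s - s0\<bar> \<le> \<bar>\<sigma> s\<bar>"
proof -
  have pos: "0 \<le> k * (t - s)" if "s \<le> t" for s t using that \<open>0 \<le> k\<close> by simp
  consider "0 \<le> \<sigma> 0" | "\<sigma> \<tau> \<le> 0" | "\<sigma> 0 \<le> 0" "0 \<le> \<sigma> \<tau>" by linarith
  then show ?thesis
  proof cases
    case 1
    have "k * \<bar>s - 0\<bar> \<le> \<bar>\<sigma> s\<bar>" if "s \<in> {0..\<tau>}" for s
      using inc[of 0 s] that 1 by auto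
    then show ?thesis by blast
  next
    case 2
    have "k * \<bar>s - \<tau>\<bar> \<le> \<bar>\<sigma> s\<bar>" if "s \<in> {0..\<tau>}" for s
      using inc[of s \<tau>] that 2 by (auto simp: abs_minus_commute)
    then show ?thesis by blast
  next
    case 3
    then obtain s0 where s0: "0 \<le> s0" "s0 \<le> \<tau>" "\<sigma> s0 = 0"
      using IVT'[of \<sigma> 0 0 \<tau>] cont \<open>0 \<le> \<tau>\<close> by auto
    have "k * \<bar>s - s0\<bar> \<le> \<bar>\<sigma> s\<bar>" if "s \<in> {0..\<tau>}" for s
      using inc[of s s0] inc[of s0 s] s0 that by (cases "s \<le> s0") (auto simp: abs_minus_commute)
    then show ?thesis by blast
  qed
qed

text \<open>The perturbation \<open>k\<close> takes away at most half of the slope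
  \<open>\<beta>\<close>, so \<open>\<sigma>\<close> or \<open>- \<sigma>\<close>, according to the
  sign of \<open>\<beta>\<close>, increases with slope at least \<open>k\<close>.\<close>

lemma almost_affine_linear_lower_bound:
  fixes \<sigma> :: "real \<Rightarrow> real"
  assumes cont: "continuous_on {0..\<tau>} \<sigma>" and "0 \<le> k" "0 \<le> \<tau>" "2 * k \<le> \<bar>\<beta>\<bar>"
    and inc: "\<And>s t. 0 \<le> s \<Longrightarrow> s \<le> t \<Longrightarrow> t \<le> \<tau> \<Longrightarrow> \<bar>\<sigma> t - \<sigma> s - (t - s) * \<beta>\<bar> \<le> k * (t - s)"
  shows "\<exists>s0. \<forall>s\<in>{0..\<tau>}. k * \<bar>s - s0\<bar> \<le> \<bar>\<sigma> s\<bar>"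
proof (cases "0 \<le> \<beta>")
  case True
  show ?thesis
  proof (rule monotone_linear_lower_bound[OF cont assms(2,3)])
    fix s t :: real assume st: "0 \<le> s" "s \<le> t" "t \<le> \<tau>"
    have "(t - s) * (2 * k) \<le> (t - s) * \<beta>" using True assms(4) st by (intro mult_left_mono) auto
    then show "k * (t - s) \<le> \<sigma> t - \<sigma> s" using inc[OF st] by (simp add: algebra_simps abs_le_iff)
  qed
next
  case False
  have "\<exists>s0. \<forall>s\<in>{0..\<tau>}. k * \<bar>s - s0\<bar> \<le> \<bar>- \<sigma> s\<bar>"
  proof (rule monotone_linear_lower_bound[OF _ assms(2,3)])
    fix s t :: real assume st: "0 \<le> s" "s \<le> t" "t \<le> \<tau>"
    have "(t - s) * (2 * k) \<le> (t - s) * (- \<beta>)" using False assms(4) st by (intro mult_left_mono) auto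
    then show "k * (t - s) \<le> - \<sigma> t - - \<sigma> s" using inc[OF st] by (simp add: algebra_simps abs_le_iff)
  qed (intro continuous_intros cont)
  then show ?thesis by simp
qed

section \<open>Adjoint states and switching functions\<close>

context control_system
begin

text \<open>The transpose of the linear map \<open>Dfield x v\<close>, as \<open>adj_inner\<close>
  shows. Writing it in coordinates makes its measurability along a trajectory immediate.\<close>

definition adj :: "'a \<Rightarrow> ('m \<Rightarrow> real) \<Rightarrow> 'a \<Rightarrow> 'a" where
  "adj x v l = (\<Sum>b\<in>Basis. (l \<bullet> Dfield x v b) *\<^sub>R b)"

lemma adj_inner: "adj x v l \<bullet> h = l \<bullet> Dfield x v h"
proof -
  have "l \<bullet> Dfield x v h = l \<bullet> Dfield x v (\<Sum>b\<in>Basis. (h \<bullet> b) *\<^sub>R b)"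
    by (simp add: euclidean_representation)
  also have "\<dots> = (\<Sum>b\<in>Basis. (h \<bullet> b) * (l \<bullet> Dfield x v b))"
    by (simp add: linear_sum[OF linear_Dfield] linear_scale[OF linear_Dfield] inner_sum_right)
  finally show ?thesis
    unfolding adj_def inner_sum_left inner_scaleR_left
    by (simp add: mult.commute inner_commute[of _ h])
qed

lemma adj_diff: "adj x v l - adj x v l' = adj x v (l - l')"
  unfolding adj_def by (simp add: inner_diff_left scaleR_diff_left sum_subtractf)

lemma adj_norm_le:
  assumes "norm x \<le> 1" "\<And>i. \<bar>v i\<bar> \<le> 1"
  shows "norm (adj x v l) \<le> K * norm l"
proof -
  have "(norm (adj x v l))\<^sup>2 = l \<bullet> Dfield x v (adj x v l)"
    unfolding power2_norm_eq_inner adj_inner ..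
  also have "\<dots> \<le> norm l * norm (Dfield x v (adj x v l))" by (rule norm_cauchy_schwarz)
  also have "\<dots> \<le> norm l * (K * norm (adj x v l))"
    by (intro mult_left_mono Dfield_norm_le assms) auto
  finally have "norm (adj x v l) * norm (adj x v l) \<le> (K * norm l) * norm (adj x v l)"
    by (simp add: power2_eq_square mult.commute mult.left_commute)
  then show ?thesis
    using K_ge by (cases "adj x v l = 0") (auto simp: mult_le_cancel_right)
qed

text \<open>The fixed point lemma is run backwards from the terminal value \<open>\<zeta>\<close>.
  The speed is at most \<open>2 * K\<close>, and \<open>K * \<tau> \<le> 1/2\<close>, so the
  solution stays in the unit ball around \<open>\<zeta>\<close>; this is the origin of the bound
  2.\<close>

lemma adjoint_exists:
  assumes u: "u \<in> controls" and \<zeta>: "norm \<zeta> = 1" and tau: "0 \<le> \<tau>" "\<tau> \<le> T0"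
  obtains l p where "continuous_on {0..\<tau>} l" "bounded_measurable \<tau> p"
    "\<And>t. t \<in> {0..\<tau>} \<Longrightarrow> l t = \<zeta> + integral {t..\<tau>} p"
    "\<And>t h. p t \<bullet> h = l t \<bullet> Dfield (traj u t) (\<lambda>i. u i t) h"
    "\<And>t. t \<in> {0..\<tau>} \<Longrightarrow> norm (l t - \<zeta>) \<le> 2 * (K * \<tau>)" "\<And>t. t \<in> {0..\<tau>} \<Longrightarrow> norm (l t) \<le> 2"
    "\<And>t. t \<in> {0..\<tau>} \<Longrightarrow> norm (p t) \<le> 2 * K"
proof -
  have ub: "\<bar>u i s\<bar> \<le> 1" for i s by (rule controls_abs_le[OF u])
  have nb: "norm (traj u s) \<le> 1" if "s \<in> {0..\<tau>}" for s
    using traj_ball[OF u, of s] that tau by auto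
  have tc: "continuous_on {0..\<tau>} (traj u)" by (rule traj_continuous[OF u tau(2)])
  have bm_adj: "bounded_measurable \<tau> (\<lambda>s. adj (traj u s) (\<lambda>i. u i s) (l s))"
    if "continuous_on {0..\<tau>} l" for l
    unfolding adj_def by (intro bm_intros bm_continuous[OF that] bm_Dfield u tc) auto
  have n2: "norm x \<le> 2" if "x \<in> cball \<zeta> 1" for x
    using that \<zeta> norm_triangle_sub[of x \<zeta>] by (auto simp: dist_norm norm_minus_commute)
  have adj_b: "norm (adj (traj u s) (\<lambda>i. u i s) x) \<le> 2 * K" if "s \<in> {0..\<tau>}" "x \<in> cball \<zeta> 1" for s x
  proof -
    have "norm (adj (traj u s) (\<lambda>i. u i s) x) \<le> K * norm x"
      by (intro adj_norm_le ub nb that)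
    also have "\<dots> \<le> K * 2" by (intro mult_left_mono n2 that) (use K_ge in simp)
    finally show ?thesis by simp
  qed
  obtain l where l: "continuous_on {0..\<tau>} l" "l ` {0..\<tau>} \<subseteq> cball \<zeta> 1"
    "\<And>t. t \<in> {0..\<tau>} \<Longrightarrow> l t = \<zeta> + integral {t..\<tau>} (\<lambda>s. adj (traj u s) (\<lambda>i. u i s) (l s))"
  proof (rule picard_existence[of 1 \<tau> K "2 * K" "\<lambda>t. {t..\<tau>}" \<zeta> "\<lambda>s x. adj (traj u s) (\<lambda>i. u i s) x"])
    show "(\<lambda>s. adj (traj u s) (\<lambda>i. u i s) (l s)) integrable_on {0..\<tau>}" if "continuous_on {0..\<tau>} l" for l
      by (rule bm_integrable[OF bm_adj[OF that]]) auto
    show "norm (adj (traj u s) (\<lambda>i. u i s) x - adj (traj u s) (\<lambda>i. u i s) x') \<le> K * norm (x - x')"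
      if "s \<in> {0..\<tau>}" for s x x'
      unfolding adj_diff by (intro adj_norm_le ub nb that)
  qed (use K_tau[OF tau] tau K_ge adj_b in auto)
  define p where "p s = adj (traj u s) (\<lambda>i. u i s) (l s)" for s
  have p: "bounded_measurable \<tau> p" unfolding p_def by (rule bm_adj[OF l(1)])
  have lb: "l t \<in> cball \<zeta> 1" if "t \<in> {0..\<tau>}" for t using l(2) that by blast
  show thesis
  proof (rule that[OF l(1) p])
    show "l t = \<zeta> + integral {t..\<tau>} p" if "t \<in> {0..\<tau>}" for t
      using l(3)[OF that] unfolding p_def[symmetric] .
    show "p t \<bullet> h = l t \<bullet> Dfield (traj u t) (\<lambda>i. u i t) h" for t h
      unfolding p_def by (rule adj_inner)
    show pb: "norm (p t) \<le> 2 * K" if "t \<in> {0..\<tau>}" for t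
      unfolding p_def by (intro adj_b lb that)
    show "norm (l t - \<zeta>) \<le> 2 * (K * \<tau>)" if t: "t \<in> {0..\<tau>}" for t
    proof -
      have "norm (integral {t..\<tau>} p) \<le> (2 * K) * (\<tau> - t)"
        by (rule norm_integral_le) (use t pb bm_integrable[OF p, of t \<tau>] in auto)
      also have "\<dots> \<le> (2 * K) * \<tau>" using t K_ge by (intro mult_left_mono) auto
      finally show ?thesis using l(3)[OF t] unfolding p_def[symmetric] by simp
    qed
  qed (use lb n2 in blast)
qed

lemma sum_weighted_bound:
  fixes \<sigma> w :: "'m \<Rightarrow> real"
  assumes "\<And>i. \<bar>\<sigma> i\<bar> \<le> C"
  shows "\<bar>\<Sum>i\<in>UNIV. w i * \<sigma> i\<bar> \<le> C * (\<Sum>i\<in>UNIV. \<bar>w i\<bar>)"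
proof -
  have "\<bar>\<Sum>i\<in>UNIV. w i * \<sigma> i\<bar> \<le> (\<Sum>i\<in>UNIV. \<bar>w i * \<sigma> i\<bar>)" by (rule sum_abs)
  also have "\<dots> \<le> (\<Sum>i\<in>UNIV. C * \<bar>w i\<bar>)"
    by (rule sum_mono) (use assms in \<open>auto simp: abs_mult mult.commute intro: mult_right_mono\<close>)
  finally show ?thesis by (simp add: sum_distrib_left)
qed

lemma g_lip_K:
  assumes "norm x \<le> 1" "norm x' \<le> 1" "norm x \<le> a" "norm x' \<le> a"
  shows "norm (g i x - g i x') \<le> 2 * K * a * norm (x - x')"
proof -
  have "norm (g i x - g i x') \<le> K0 * (norm x + norm x') * norm (x - x')" by (rule g_lip[OF assms(1,2)])
  also have "\<dots> \<le> K * (2 * a) * norm (x - x')"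
    using assms K0_le_K K0 by (intro mult_right_mono mult_mono) auto
  finally show ?thesis by simp
qed

text \<open>The adjoint state is made so that the terms linear in the difference of the trajectories
  cancel after integration by parts. Two errors remain: the Taylor remainder of the field, and the
  change of the columns between the two trajectories, which carries a factor
  \<open>K * \<tau>\<close> because the columns are flat at the origin. With
  \<open>D = 2 * K * d\<close>, where \<open>d\<close> is the control distance, each of them
  integrates to at most \<open>8 * K ^ 3 * \<tau> * d^2\<close>.\<close>

lemma end_point_expansion:
  assumes u: "u \<in> controls" and v: "v \<in> controls" and tau: "0 \<le> \<tau>" "\<tau> \<le> T0"
    and l: "continuous_on {0..\<tau>} l" and p: "bounded_measurable \<tau> p"
    and lp: "\<And>t. t \<in> {0..\<tau>} \<Longrightarrow> l t = \<zeta> + integral {t..\<tau>} p"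
    and pD: "\<And>t h. p t \<bullet> h = l t \<bullet> Dfield (traj u t) (\<lambda>i. u i t) h"
    and l2: "\<And>t. t \<in> {0..\<tau>} \<Longrightarrow> norm (l t) \<le> 2"
  shows "\<bar>\<zeta> \<bullet> (traj v \<tau> - traj u \<tau>) -
     (\<Sum>i\<in>UNIV. integral {0..\<tau>} (\<lambda>t. (v i t - u i t) * (l t \<bullet> g i (traj u t))))\<bar>
    \<le> 16 * K ^ 3 * \<tau> * (control_dist \<tau> u v)\<^sup>2"
proof -
  let ?d = "\<lambda>t. traj v t - traj u t"
  let ?q = "\<lambda>s. field (traj v s) (\<lambda>i. v i s) - field (traj u s) (\<lambda>i. u i s)"
  let ?w = "\<lambda>t. \<Sum>i\<in>UNIV. \<bar>u i t - v i t\<bar>"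
  let ?\<sigma> = "\<lambda>i t. l t \<bullet> g i (traj u t)"
  define D where "D = 2 * K * control_dist \<tau> u v"
  have D: "norm (?d t) \<le> D" if "t \<in> {0..\<tau>}" for t
    unfolding D_def by (rule traj_lipschitz[OF u v tau(2) that])
  have D0: "0 \<le> D" using order_trans[OF norm_ge_zero D[of 0]] tau by simp
  have tc: "continuous_on {0..\<tau>} (traj u)" "continuous_on {0..\<tau>} (traj v)"
    by (rule traj_continuous[OF _ tau(2)], fact)+
  have bq: "bounded_measurable \<tau> ?q" by (intro bm_diff bm_field u v tc)
  have b\<sigma>: "bounded_measurable \<tau> (\<lambda>t. (v i t - u i t) * ?\<sigma> i t)" for i
    by (intro bm_intros bm_control u v bm_continuous[OF l] bm_compose[OF contg tc(1)])
  have main: "\<zeta> \<bullet> ?d \<tau> = integral {0..\<tau>} (\<lambda>s. l s \<bullet> ?q s - p s \<bullet> ?d s)"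
    by (rule integration_by_parts_indefinite[OF tau(1) p bq lp]) (use traj_diff_eq[OF u v] tau in auto)
  let ?R = "\<lambda>t. l t \<bullet> ?q t - p t \<bullet> ?d t - (\<Sum>i\<in>UNIV. (v i t - u i t) * ?\<sigma> i t)"
  have bL: "bounded_measurable \<tau> (\<lambda>s. l s \<bullet> ?q s - p s \<bullet> ?d s)"
    by (intro bm_diff bm_inner bq p bm_continuous[OF l] bm_continuous tc)
  have eq: "\<zeta> \<bullet> ?d \<tau> - (\<Sum>i\<in>UNIV. integral {0..\<tau>} (\<lambda>t. (v i t - u i t) * ?\<sigma> i t)) = integral {0..\<tau>} ?R"
    unfolding main
    by (subst integral_sum[symmetric], simp, rule bm_integrable[OF b\<sigma>], simp, simp)
      (rule integral_diff[symmetric]; rule bm_integrable[of \<tau>], auto intro!: bL bm_sum b\<sigma>)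
  have "norm (integral {0..\<tau>} ?R) \<le> integral {0..\<tau>} (\<lambda>t. 4 * K * (K * \<tau>) * D * ?w t + 2 * K * D\<^sup>2)"
  proof (rule integral_norm_bound_integral)
    show "?R integrable_on {0..\<tau>}"
      by (rule bm_integrable[of \<tau>]) (auto intro!: bm_diff[OF bL] bm_sum b\<sigma>)
    show "(\<lambda>t. 4 * K * (K * \<tau>) * D * ?w t + 2 * K * D\<^sup>2) integrable_on {0..\<tau>}"
      by (rule bm_integrable[of \<tau>]) (auto intro!: bm_add bm_mult bm_const bm_control_sum u v)
    fix t assume t: "t \<in> {0..\<tau>}"
    have tT: "t \<in> {0..T0}" using t tau by auto
    have nb: "norm (traj v t) \<le> 1" "norm (traj u t) \<le> 1" using traj_ball u v tT by auto
    have "K * t \<le> K * \<tau>" using t K_ge by (intro mult_left_mono) auto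
    then have nb': "norm (traj v t) \<le> K * \<tau>" "norm (traj u t) \<le> K * \<tau>"
      using traj_norm_le[OF u tT] traj_norm_le[OF v tT] by auto
    let ?e = "field (traj v t) (\<lambda>i. u i t) - field (traj u t) (\<lambda>i. u i t) - Dfield (traj u t) (\<lambda>i. u i t) (?d t)"
    have "?q t = ?e + Dfield (traj u t) (\<lambda>i. u i t) (?d t) + (field (traj v t) (\<lambda>i. v i t) - field (traj v t) (\<lambda>i. u i t))"
      by simp
    then have "l t \<bullet> ?q t - p t \<bullet> ?d t = l t \<bullet> ?e + (\<Sum>i\<in>UNIV. (v i t - u i t) * (l t \<bullet> g i (traj v t)))"
      unfolding pD field_control_diff by (simp only: inner_add_right inner_sum_right inner_scaleR_right)
    then have R: "?R t = l t \<bullet> ?e + (\<Sum>i\<in>UNIV. (v i t - u i t) * (l t \<bullet> (g i (traj v t) - g i (traj u t))))"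
      by (simp add: inner_diff_right right_diff_distrib sum_subtractf)
    have "\<bar>l t \<bullet> ?e\<bar> \<le> norm (l t) * norm ?e" by (rule Cauchy_Schwarz_ineq2)
    also have "\<dots> \<le> 2 * (K * D\<^sup>2)"
    proof (rule mult_mono[OF l2[OF t]])
      have "norm ?e \<le> K * (norm (?d t))\<^sup>2"
        by (intro field_quad nb controls_abs_le[OF u])
      also have "\<dots> \<le> K * D\<^sup>2" using D[OF t] K_ge by (intro mult_left_mono power_mono) auto
      finally show "norm ?e \<le> K * D\<^sup>2" .
    qed auto
    finally have 1: "\<bar>l t \<bullet> ?e\<bar> \<le> 2 * K * D\<^sup>2" by simp
    have "\<bar>l t \<bullet> (g i (traj v t) - g i (traj u t))\<bar> \<le> 4 * K * (K * \<tau>) * D" for i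
    proof -
      have "\<bar>l t \<bullet> (g i (traj v t) - g i (traj u t))\<bar> \<le> norm (l t) * norm (g i (traj v t) - g i (traj u t))"
        by (rule Cauchy_Schwarz_ineq2)
      also have "\<dots> \<le> 2 * (2 * K * (K * \<tau>) * D)"
      proof (rule mult_mono[OF l2[OF t]])
        have "norm (g i (traj v t) - g i (traj u t)) \<le> 2 * K * (K * \<tau>) * norm (?d t)"
          by (rule g_lip_K[OF nb nb'])
        also have "\<dots> \<le> 2 * K * (K * \<tau>) * D" using D[OF t] K_ge tau by (intro mult_left_mono) auto
        finally show "norm (g i (traj v t) - g i (traj u t)) \<le> 2 * K * (K * \<tau>) * D" .
      qed auto
      finally show ?thesis by simp
    qed
    from sum_weighted_bound[OF this, of "\<lambda>i. v i t - u i t"]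
    have 2: "\<bar>\<Sum>i\<in>UNIV. (v i t - u i t) * (l t \<bullet> (g i (traj v t) - g i (traj u t)))\<bar> \<le> 4 * K * (K * \<tau>) * D * ?w t"
      by (simp add: abs_minus_commute)
    show "norm (?R t) \<le> 4 * K * (K * \<tau>) * D * ?w t + 2 * K * D\<^sup>2"
      unfolding R real_norm_def add.commute[of "4 * K * (K * \<tau>) * D * ?w t"]
      by (rule order_trans[OF abs_triangle_ineq add_mono[OF 1 2]])
  qed
  also have "\<dots> = 4 * K * (K * \<tau>) * D * control_dist \<tau> u v + 2 * K * D\<^sup>2 * \<tau>"
    unfolding control_dist_def using tau bm_integrable[OF bm_control_sum[OF u v], of 0 \<tau>]
    by (subst integral_add) (auto intro!: integrable_on_mult_right)
  also have "\<dots> = 16 * K ^ 3 * \<tau> * (control_dist \<tau> u v)\<^sup>2"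
    unfolding D_def by (simp add: power2_eq_square power3_eq_cube algebra_simps)
  finally show ?thesis unfolding eq real_norm_def .
qed

text \<open>The derivative of the switching function is formally
  \<open>- \<zeta> . DF 0 (g i 0)\<close> up to errors of order \<open>K ^ 3 * \<tau>\<close>;
  increments are estimated instead, because the control is merely measurable. If that number has
  size at least \<open>\<kappa>\<close>, the function is almost affine. Otherwise
  \<open>\<zeta> . g i 0\<close> has size at least \<open>\<kappa>\<close>, the function never drops
  below \<open>\<kappa> / 2\<close> in absolute value, and since \<open>\<tau> \<le> 1/2\<close> the
  choice \<open>s0 = 0\<close> works.\<close>

lemma switching_lower_bound:
  assumes u: "u \<in> controls" and \<zeta>: "norm \<zeta> = 1" and tau: "0 \<le> \<tau>" "\<tau> \<le> T0"
    and l: "continuous_on {0..\<tau>} l" and p: "bounded_measurable \<tau> p"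
    and lp: "\<And>t. t \<in> {0..\<tau>} \<Longrightarrow> l t = \<zeta> + integral {t..\<tau>} p"
    and pD: "\<And>t h. p t \<bullet> h = l t \<bullet> Dfield (traj u t) (\<lambda>i. u i t) h"
    and l\<zeta>: "\<And>t. t \<in> {0..\<tau>} \<Longrightarrow> norm (l t - \<zeta>) \<le> 2 * (K * \<tau>)"
    and l2: "\<And>t. t \<in> {0..\<tau>} \<Longrightarrow> norm (l t) \<le> 2"
  shows "\<exists>s0. \<forall>s\<in>{0..\<tau>}. (\<kappa> / 2) * \<bar>s - s0\<bar> \<le> \<bar>l s \<bullet> g i (traj u s)\<bar>"
proof -
  let ?\<sigma> = "\<lambda>t. l t \<bullet> g i (traj u t)"
  have tc: "continuous_on {0..\<tau>} (traj u)" by (rule traj_continuous[OF u tau(2)])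
  have gc: "continuous_on {0..\<tau>} (\<lambda>t. g i (traj u t))"
    by (rule continuous_on_compose2[OF contg tc]) auto
  have \<sigma>c: "continuous_on {0..\<tau>} ?\<sigma>" by (intro continuous_intros l gc)
  have Kt: "K * \<tau> \<le> 1/2" by (rule K_tau[OF tau])
  have Kt0: "0 \<le> K * \<tau>" using K_ge tau by simp
  have KK: "K \<le> K ^ 2" "K ^ 2 \<le> K ^ 3" using K_ge by (auto intro: power_increasing[of 1 2 K, simplified] power_increasing)
  have small: "16 * (K ^ 3 * \<tau>) \<le> \<kappa>"
  proof -
    have "16 * (K ^ 3 * \<tau>) \<le> 1024 * real CARD('m) * (K ^ 3 * \<tau>)"
      by (intro mult_right_mono mult_nonneg_nonneg) (use CARD_ge K_ge tau in \<open>linarith | simp\<close>)+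
    then show ?thesis using K3_tau[OF tau] by linarith
  qed
  have nb: "norm (traj u t) \<le> 1" "norm (traj u t) \<le> K * \<tau>" if "t \<in> {0..\<tau>}" for t
  proof -
    have "K * t \<le> K * \<tau>" using that K_ge by (intro mult_left_mono) auto
    then show "norm (traj u t) \<le> 1" "norm (traj u t) \<le> K * \<tau>"
      using traj_norm_le[OF u, of t] traj_ball[OF u, of t] that tau by auto
  qed
  have gb: "norm (g i (traj u t)) \<le> K" if "t \<in> {0..\<tau>}" for t
    using g_bd[OF nb(1)[OF that]] K0_le_K order_trans by blast
  have g0: "norm (g i (traj u t) - g i 0) \<le> K ^ 2 * \<tau>" if t: "t \<in> {0..\<tau>}" for t
  proof -
    have "norm (g i (traj u t) - g i 0) \<le> 2 * K * (K * \<tau>) * norm (traj u t - 0)"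
      by (rule g_lip_K) (use nb[OF t] Kt0 in auto)
    also have "\<dots> \<le> 2 * K * (K * \<tau>) * (1/2)"
      using nb[OF t] Kt K_ge Kt0 by (intro mult_left_mono) auto
    finally show ?thesis by (simp add: power2_eq_square)
  qed
  show ?thesis
  proof (cases "\<kappa> \<le> \<bar>\<zeta> \<bullet> DF 0 (g i 0)\<bar>")
    case True
    show ?thesis
    proof (rule almost_affine_linear_lower_bound[OF \<sigma>c _ tau(1), where \<beta>="- (\<zeta> \<bullet> DF 0 (g i 0))"])
      fix s t :: real assume st: "0 \<le> s" "s \<le> t" "t \<le> \<tau>"
      then have t: "t \<in> {0..\<tau>}" and s: "s \<in> {0..\<tau>}" by auto
      let ?gt = "g i (traj u t)" and ?\<beta> = "\<zeta> \<bullet> DF 0 (g i 0)"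
      have pst: "p integrable_on {s..t}" by (rule bm_integrable[OF p]) (use st in auto)
      have lin: "l t - l s = - integral {s..t} p"
        using integral_diff_interval'[OF p st] lp[OF t] lp[OF s] by (simp add: algebra_simps)
      have eq: "((\<lambda>r. p r \<bullet> ?gt - ?\<beta>) has_integral (integral {s..t} p \<bullet> ?gt - (t - s) * ?\<beta>)) {s..t}"
        using has_integral_diff[OF has_integral_linear[OF integrable_integral[OF pst] bounded_linear_inner_left[of ?gt]]
            has_integral_const_real[of ?\<beta> s t]] st by (simp add: o_def)
      have "norm (integral {s..t} p \<bullet> ?gt - (t - s) * ?\<beta>) \<le> (4 * (K ^ 3 * \<tau>)) * (t - s)"
        unfolding integral_unique[OF eq, symmetric]
      proof (rule norm_integral_le)
        show "(\<lambda>r. p r \<bullet> ?gt - ?\<beta>) integrable_on {s..t}" using eq by blast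
        fix r assume "r \<in> {s..t}"
        then have r: "r \<in> {0..\<tau>}" using st by auto
        let ?D = "Dfield (traj u r) (\<lambda>i. u i r)"
        have ub: "\<And>i. \<bar>u i r\<bar> \<le> 1" by (rule controls_abs_le[OF u])
        \<comment> \<open>Three replacements lead to the slope at the origin: the adjoint state by
          \<open>\<zeta>\<close>, the linearized field by \<open>DF 0\<close>, the column by
          \<open>g i 0\<close>. They cost 2, 1 and 1 times \<open>K ^ 3 * \<tau>\<close>.\<close>
        have split: "p r \<bullet> ?gt - ?\<beta> = (l r - \<zeta>) \<bullet> ?D ?gt + \<zeta> \<bullet> (?D ?gt - DF 0 ?gt) + \<zeta> \<bullet> DF 0 (?gt - g i 0)"
          unfolding pD linear_diff[OF linDF] by (simp add: inner_diff_left inner_diff_right)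
        have "\<bar>(l r - \<zeta>) \<bullet> ?D ?gt\<bar> \<le> norm (l r - \<zeta>) * norm (?D ?gt)" by (rule Cauchy_Schwarz_ineq2)
        also have "\<dots> \<le> 2 * (K * \<tau>) * (K * K)"
        proof (rule mult_mono[OF l\<zeta>[OF r]])
          have "norm (?D ?gt) \<le> K * norm ?gt" by (rule Dfield_norm_le[OF nb(1)[OF r] ub])
          also have "\<dots> \<le> K * K" using gb[OF t] K_ge by (intro mult_left_mono) auto
          finally show "norm (?D ?gt) \<le> K * K" .
        qed (use Kt0 in auto)
        finally have 1: "\<bar>(l r - \<zeta>) \<bullet> ?D ?gt\<bar> \<le> 2 * (K ^ 3 * \<tau>)" by (simp add: power3_eq_cube algebra_simps)
        have "\<bar>\<zeta> \<bullet> (?D ?gt - DF 0 ?gt)\<bar> \<le> norm \<zeta> * norm (?D ?gt - DF 0 ?gt)" by (rule Cauchy_Schwarz_ineq2)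
        also have "\<dots> \<le> K * norm (traj u r) * norm ?gt"
          using Dfield_norm_le(2)[OF nb(1)[OF r] ub] \<zeta> by simp
        also have "\<dots> \<le> K * (K * \<tau>) * K"
          using nb[OF r] gb[OF t] K_ge Kt0 by (intro mult_mono) auto
        finally have 2: "\<bar>\<zeta> \<bullet> (?D ?gt - DF 0 ?gt)\<bar> \<le> K ^ 3 * \<tau>" by (simp add: power3_eq_cube algebra_simps)
        have "\<bar>\<zeta> \<bullet> DF 0 (?gt - g i 0)\<bar> \<le> norm \<zeta> * norm (DF 0 (?gt - g i 0))" by (rule Cauchy_Schwarz_ineq2)
        also have "\<dots> \<le> K0 * norm (?gt - g i 0)" using DF_bd[of 0] \<zeta> by simp
        also have "\<dots> \<le> K * (K ^ 2 * \<tau>)" using g0[OF t] K0_le_K K0 by (intro mult_mono) auto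
        finally have 3: "\<bar>\<zeta> \<bullet> DF 0 (?gt - g i 0)\<bar> \<le> K ^ 3 * \<tau>"
          by (simp add: power3_eq_cube power2_eq_square algebra_simps)
        show "norm (p r \<bullet> ?gt - ?\<beta>) \<le> 4 * (K ^ 3 * \<tau>)"
          unfolding split real_norm_def using 1 2 3 by linarith
      qed (use st in auto)
      then have A: "\<bar>(l t - l s) \<bullet> ?gt + (t - s) * ?\<beta>\<bar> \<le> (4 * (K ^ 3 * \<tau>)) * (t - s)"
        unfolding lin by (simp add: abs_minus_commute)
      have "norm (traj u t - traj u s) \<le> K * (t - s)"
      proof -
        have b: "bounded_measurable \<tau> (\<lambda>s. field (traj u s) (\<lambda>i. u i s))" by (rule bm_field[OF u tc])
        have "traj u t - traj u s = integral {s..t} (\<lambda>s. field (traj u s) (\<lambda>i. u i s))"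
          using integral_diff_interval[OF b st] traj_eq[OF u, of t] traj_eq[OF u, of s] s t tau by auto
        also have "norm \<dots> \<le> K * (t - s)"
          by (rule norm_integral_le)
            (use bm_integrable[OF b, of s t] st nb in \<open>auto intro!: field_norm_le controls_abs_le[OF u]\<close>)
        finally show ?thesis .
      qed
      then have "2 * K * (K * \<tau>) * norm (traj u t - traj u s) \<le> 2 * K * (K * \<tau>) * (K * (t - s))"
        using K_ge Kt0 by (intro mult_left_mono) auto
      then have "norm (?gt - g i (traj u s)) \<le> 2 * (K ^ 3 * \<tau>) * (t - s)"
        using g_lip_K[OF nb(1)[OF t] nb(1)[OF s] nb(2)[OF t] nb(2)[OF s], of i]
        by (simp add: power3_eq_cube mult_ac)
      then have "norm (l s) * norm (?gt - g i (traj u s)) \<le> 2 * (2 * (K ^ 3 * \<tau>) * (t - s))"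
        using l2[OF s] by (intro mult_mono) auto
      then have B: "\<bar>l s \<bullet> (?gt - g i (traj u s))\<bar> \<le> 4 * (K ^ 3 * \<tau>) * (t - s)"
        using Cauchy_Schwarz_ineq2[of "l s" "?gt - g i (traj u s)"] by simp
      have "?\<sigma> t - ?\<sigma> s - (t - s) * (- ?\<beta>) = ((l t - l s) \<bullet> ?gt + (t - s) * ?\<beta>) + l s \<bullet> (?gt - g i (traj u s))"
        by (simp add: inner_diff_left inner_diff_right)
      then have "\<bar>?\<sigma> t - ?\<sigma> s - (t - s) * (- ?\<beta>)\<bar> \<le> 8 * (K ^ 3 * \<tau>) * (t - s)"
        using A B by (simp add: abs_le_iff algebra_simps)
      also have "\<dots> \<le> (\<kappa> / 2) * (t - s)" using small st by (intro mult_right_mono) auto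
      finally show "\<bar>?\<sigma> t - ?\<sigma> s - (t - s) * (- ?\<beta>)\<bar> \<le> (\<kappa> / 2) * (t - s)" .
    qed (use True kappa in auto)
  next
    case False
    then have \<zeta>B: "\<kappa> \<le> \<bar>\<zeta> \<bullet> g i 0\<bar>" using nondegenerate[OF \<zeta>] by blast
    have "(\<kappa> / 2) * \<bar>s - 0\<bar> \<le> \<bar>?\<sigma> s\<bar>" if s: "s \<in> {0..\<tau>}" for s
    proof -
      have "\<bar>(l s - \<zeta>) \<bullet> g i (traj u s)\<bar> \<le> norm (l s - \<zeta>) * norm (g i (traj u s))" by (rule Cauchy_Schwarz_ineq2)
      also have "\<dots> \<le> 2 * (K * \<tau>) * K" using l\<zeta>[OF s] gb[OF s] Kt0 by (intro mult_mono) auto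
      finally have 1: "\<bar>(l s - \<zeta>) \<bullet> g i (traj u s)\<bar> \<le> 2 * (K ^ 2 * \<tau>)" by (simp add: power2_eq_square mult_ac)
      have 2: "\<bar>\<zeta> \<bullet> (g i (traj u s) - g i 0)\<bar> \<le> K ^ 2 * \<tau>"
        using Cauchy_Schwarz_ineq2[of \<zeta> "g i (traj u s) - g i 0"] g0[OF s] \<zeta> by simp
      have "?\<sigma> s = \<zeta> \<bullet> g i 0 + (l s - \<zeta>) \<bullet> g i (traj u s) + \<zeta> \<bullet> (g i (traj u s) - g i 0)"
        by (simp add: inner_diff_left inner_diff_right)
      then have "\<kappa> - 3 * (K ^ 2 * \<tau>) \<le> \<bar>?\<sigma> s\<bar>" using 1 2 \<zeta>B by linarith
      moreover have "K ^ 2 * \<tau> \<le> K ^ 3 * \<tau>" using KK tau by (intro mult_right_mono) auto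
      ultimately have "\<kappa> / 2 \<le> \<bar>?\<sigma> s\<bar>" using small kappa by linarith
      moreover have "(\<kappa> / 2) * \<bar>s - 0\<bar> \<le> (\<kappa> / 2) * 1"
        using s tau_le[OF tau] kappa by (intro mult_left_mono) auto
      ultimately show ?thesis by linarith
    qed
    then show ?thesis by blast
  qed
qed

text \<open>This packages the adjoint state away: everything after it uses only the switching
  functions, their growth and the expansion.\<close>

lemma switching_function_exists:
  assumes u: "u \<in> controls" and \<zeta>: "norm \<zeta> = 1" and tau: "0 \<le> \<tau>" "\<tau> \<le> T0"
  obtains \<sigma> :: "'m \<Rightarrow> real \<Rightarrow> real" and s0 where
    "\<And>i. continuous_on {0..\<tau>} (\<sigma> i)"
    "\<And>i s. s \<in> {0..\<tau>} \<Longrightarrow> (\<kappa> / 2) * \<bar>s - s0 i\<bar> \<le> \<bar>\<sigma> i s\<bar>"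
    "\<And>v. v \<in> controls \<Longrightarrow> \<bar>\<zeta> \<bullet> (traj v \<tau> - traj u \<tau>) -
       (\<Sum>i\<in>UNIV. integral {0..\<tau>} (\<lambda>t. (v i t - u i t) * \<sigma> i t))\<bar>
      \<le> 16 * K ^ 3 * \<tau> * (control_dist \<tau> u v)\<^sup>2"
proof -
  obtain l p where lp: "continuous_on {0..\<tau>} l" "bounded_measurable \<tau> p"
    "\<And>t. t \<in> {0..\<tau>} \<Longrightarrow> l t = \<zeta> + integral {t..\<tau>} p"
    "\<And>t h. p t \<bullet> h = l t \<bullet> Dfield (traj u t) (\<lambda>i. u i t) h"
    "\<And>t. t \<in> {0..\<tau>} \<Longrightarrow> norm (l t - \<zeta>) \<le> 2 * (K * \<tau>)" "\<And>t. t \<in> {0..\<tau>} \<Longrightarrow> norm (l t) \<le> 2"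
    by (rule adjoint_exists[OF assms]) blast
  have "\<exists>s0. \<forall>s\<in>{0..\<tau>}. (\<kappa> / 2) * \<bar>s - s0\<bar> \<le> \<bar>l s \<bullet> g i (traj u s)\<bar>" for i
    by (rule switching_lower_bound[OF assms lp])
  then obtain s0 where s0: "\<And>i s. s \<in> {0..\<tau>} \<Longrightarrow> (\<kappa> / 2) * \<bar>s - s0 i\<bar> \<le> \<bar>l s \<bullet> g i (traj u s)\<bar>"
    by metis
  show thesis
  proof (rule that[of "\<lambda>i t. l t \<bullet> g i (traj u t)" s0])
    show "continuous_on {0..\<tau>} (\<lambda>t. l t \<bullet> g i (traj u t))" for i
      by (intro continuous_intros lp continuous_on_compose2[OF contg traj_continuous[OF u tau(2)]]) auto
  qed (use s0 end_point_expansion[OF u _ tau lp(1,2,3,4,6)] in auto)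
qed

end

section \<open>Strong concavity and maximizing controls\<close>

lemma AE_lebesgue_on_neq:
  fixes a :: real
  assumes "S \<in> sets lebesgue"
  shows "AE t in lebesgue_on S. t \<noteq> a"
  using AE_completion[OF AE_lborel_singleton[of a]] assms
  by (auto simp: AE_restrict_space_iff)

lemma control_dist_eq_sum:
  assumes "u \<in> controls" "v \<in> controls"
  shows "control_dist \<tau> u v = (\<Sum>i\<in>UNIV. integral {0..\<tau>} (\<lambda>t. \<bar>u i t - v i t\<bar>))"
  unfolding control_dist_def
  by (rule integral_sum, simp, rule bm_integrable[of \<tau>], intro bm_abs bm_diff bm_control assms) auto

lemma control_dist_scale:
  fixes u v :: "'m::finite \<Rightarrow> real \<Rightarrow> real"
  assumes u: "u \<in> controls" and v: "v \<in> controls" and a: "0 \<le> a" "a \<le> 1" and b: "0 \<le> b" "b \<le> 1"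
    and "0 \<le> \<tau>"
  shows "control_dist \<tau> (\<lambda>i t. a * u i t) (\<lambda>i t. b * v i t) \<le>
    a * control_dist \<tau> u v + \<bar>a - b\<bar> * (real CARD('m) * \<tau>)"
    and "(\<lambda>i t. a * u i t) \<in> controls"
proof -
  have sc: "(\<lambda>i t. c * w i t) \<in> controls" if w: "w \<in> controls" and c: "0 \<le> c" "c \<le> 1" for c and w :: "'m \<Rightarrow> real \<Rightarrow> real"
  proof (rule controlsI)
    show "(\<lambda>t. c * w i t) \<in> borel_measurable lebesgue" for i
      by (intro borel_measurable_times borel_measurable_const controls_measurable w)
    show "\<bar>c * w i t\<bar> \<le> 1" for i t
      using mult_mono[OF c(2) controls_abs_le[OF w, of i t]] c by (simp add: abs_mult)
  qed
  show "(\<lambda>i t. a * u i t) \<in> controls" by (rule sc[OF u a])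
  have "control_dist \<tau> (\<lambda>i t. a * u i t) (\<lambda>i t. b * v i t)
    \<le> integral {0..\<tau>} (\<lambda>t. a * (\<Sum>i\<in>UNIV. \<bar>u i t - v i t\<bar>) + \<bar>a - b\<bar> * real CARD('m))"
  proof (rule control_dist_integral_mono[OF sc[OF u a] sc[OF v b]])
    show "bounded_measurable \<tau> (\<lambda>t. a * (\<Sum>i\<in>UNIV. \<bar>u i t - v i t\<bar>) + \<bar>a - b\<bar> * real CARD('m))"
      by (intro bm_add bm_mult bm_const bm_control_sum u v)
    fix t
    have "\<bar>a * u i t - b * v i t\<bar> \<le> a * \<bar>u i t - v i t\<bar> + \<bar>a - b\<bar>" for i
    proof -
      have "a * u i t - b * v i t = a * (u i t - v i t) + (a - b) * v i t" by (simp add: algebra_simps)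
      also have "\<bar>\<dots>\<bar> \<le> \<bar>a * (u i t - v i t)\<bar> + \<bar>(a - b) * v i t\<bar>" by (rule abs_triangle_ineq)
      also have "\<dots> \<le> a * \<bar>u i t - v i t\<bar> + \<bar>a - b\<bar>"
        using mult_left_mono[OF controls_abs_le[OF v, of i t], of "\<bar>a - b\<bar>"] a by (simp add: abs_mult)
      finally show ?thesis .
    qed
    then have "(\<Sum>i\<in>UNIV. \<bar>a * u i t - b * v i t\<bar>) \<le> (\<Sum>i\<in>UNIV. a * \<bar>u i t - v i t\<bar> + \<bar>a - b\<bar>)"
      by (intro sum_mono)
    then show "(\<Sum>i\<in>UNIV. \<bar>a * u i t - b * v i t\<bar>) \<le> a * (\<Sum>i\<in>UNIV. \<bar>u i t - v i t\<bar>) + \<bar>a - b\<bar> * real CARD('m)"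
      by (simp add: sum.distrib sum_distrib_left mult.commute)
  qed
  also have "\<dots> = a * control_dist \<tau> u v + \<bar>a - b\<bar> * (real CARD('m) * \<tau>)"
    unfolding control_dist_def using assms(7) bm_integrable[OF bm_control_sum[OF u v], of 0 \<tau>]
    by (subst integral_add) (auto intro!: integrable_on_mult_right)
  finally show "control_dist \<tau> (\<lambda>i t. a * u i t) (\<lambda>i t. b * v i t) \<le>
    a * control_dist \<tau> u v + \<bar>a - b\<bar> * (real CARD('m) * \<tau>)" .
qed

text \<open>Completing the square turns the strong support inequality into membership in the ball of
  radius \<open>1 / (2 * g)\<close> that has \<open>e\<close> on its boundary with outward normal
  \<open>\<zeta>\<close>. Since a ball is closed and convex, the inequality then passes to closed
  convex hulls.\<close>

lemma cball_iff_strong_support: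
  fixes \<zeta> x e :: "'a::real_inner"
  assumes \<zeta>: "norm \<zeta> = 1" and g: "0 < g"
  shows "x \<in> cball (e - (1 / (2 * g)) *\<^sub>R \<zeta>) (1 / (2 * g)) \<longleftrightarrow> \<zeta> \<bullet> (x - e) + g * (norm (x - e))\<^sup>2 \<le> 0"
proof -
  define a k where "a = x - e" and "k = 1 / (2 * g)"
  have k: "0 < k" "2 * k * g = 1" using g by (auto simp: k_def)
  have "\<zeta> \<bullet> \<zeta> = 1" using \<zeta> by (simp add: norm_eq_1)
  then have exp: "(norm (a + k *\<^sub>R \<zeta>))\<^sup>2 = (norm a)\<^sup>2 + 2 * k * (\<zeta> \<bullet> a) + k\<^sup>2"
    unfolding power2_norm_eq_inner inner_add_left inner_add_right inner_scaleR_left inner_scaleR_right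
      inner_commute[of a \<zeta>] by (simp add: power2_eq_square distrib_left)
  have "x - (e - k *\<^sub>R \<zeta>) = a + k *\<^sub>R \<zeta>" by (simp add: a_def)
  then have "dist (e - k *\<^sub>R \<zeta>) x = norm (a + k *\<^sub>R \<zeta>)"
    by (metis dist_commute dist_norm)
  then have "x \<in> cball (e - k *\<^sub>R \<zeta>) k \<longleftrightarrow> (norm (a + k *\<^sub>R \<zeta>))\<^sup>2 \<le> k\<^sup>2"
    using k by (simp add: power_mono_iff)
  also have "\<dots> \<longleftrightarrow> (norm a)\<^sup>2 + 2 * k * (\<zeta> \<bullet> a) \<le> 0" unfolding exp by simp
  also have "(norm a)\<^sup>2 + 2 * k * (\<zeta> \<bullet> a) = 2 * k * (\<zeta> \<bullet> a + g * (norm a)\<^sup>2)"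
    using k by (simp add: distrib_left mult.assoc[symmetric])
  also have "\<dots> \<le> 0 \<longleftrightarrow> \<zeta> \<bullet> a + g * (norm a)\<^sup>2 \<le> 0"
    using k by (simp add: mult_le_0_iff)
  finally show ?thesis unfolding a_def k_def .
qed

text \<open>The value 0 outside the interval gives measurability on the whole line. The value
  \<open>sgn 0 = 0\<close> at zeros of \<open>\<sigma>\<close> does no harm, because it is always
  multiplied by \<open>\<sigma>\<close> there.\<close>

definition sign_control :: "real \<Rightarrow> ('m \<Rightarrow> real \<Rightarrow> real) \<Rightarrow> 'm \<Rightarrow> real \<Rightarrow> real" where
  "sign_control \<tau> \<sigma> i t = (if t \<in> {0..\<tau>} then sgn (\<sigma> i t) else 0)"

lemma sign_control_in_controls:
  fixes \<sigma> :: "'m::finite \<Rightarrow> real \<Rightarrow> real"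
  assumes "\<And>i. continuous_on {0..\<tau>} (\<sigma> i)"
  shows "sign_control \<tau> \<sigma> \<in> controls"
proof (rule controlsI)
  fix i
  have "\<sigma> i \<in> borel_measurable (lebesgue_on {0..\<tau>})"
    by (rule continuous_imp_measurable_on_sets_lebesgue[OF assms]) simp
  then have "(\<lambda>t. sgn (\<sigma> i t)) \<in> borel_measurable (lebesgue_on {0..\<tau>})"
    by (rule measurable_compose[OF _ borel_measurable_sgn])
  then show "sign_control \<tau> \<sigma> i \<in> borel_measurable lebesgue"
    unfolding sign_control_def by (rule borel_measurable_if_I) simp
qed (auto simp: sign_control_def sgn_if)

context control_system
begin

text \<open>For a weight \<open>w\<close> with values in \<open>{0..2}\<close> and integral
  \<open>W\<close>, the bound \<open>weighted_integral_lower_bound\<close> for \<open>w / 2\<close>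
  and the slope \<open>\<kappa> / 2\<close> give a gain of \<open>\<kappa> * W^2 / 32\<close>. The
  Cauchy-Schwarz inequality over the components costs the factor \<open>CARD('m)\<close>.\<close>

definition c0 :: real where "c0 = \<kappa> / (32 * real CARD('m))"

lemma c0_pos: "0 < c0"
  using kappa CARD_ge by (simp add: c0_def)

text \<open>The number 1024 in \<open>T0\<close> is 16 times 64: 16 is the factor of the expansion
  error, and \<open>c0 / 2\<close> is \<open>\<kappa> / (64 * CARD('m))\<close>.\<close>

lemma expansion_error_le:
  assumes "0 \<le> \<tau>" "\<tau> \<le> T0"
  shows "16 * K ^ 3 * \<tau> \<le> c0 / 2"
  using K3_tau[OF assms] CARD_ge by (simp add: c0_def field_simps)

lemma switching_gain:
  fixes w \<sigma> :: "'m \<Rightarrow> real \<Rightarrow> real"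
  assumes \<sigma>: "\<And>i. continuous_on {0..\<tau>} (\<sigma> i)"
    and s0: "\<And>i s. s \<in> {0..\<tau>} \<Longrightarrow> (\<kappa> / 2) * \<bar>s - s0 i\<bar> \<le> \<bar>\<sigma> i s\<bar>"
    and w: "\<And>i. bounded_measurable \<tau> (w i)" "\<And>i s. s \<in> {0..\<tau>} \<Longrightarrow> 0 \<le> w i s \<and> w i s \<le> 2"
  shows "c0 * (\<Sum>i\<in>UNIV. integral {0..\<tau>} (w i))\<^sup>2 \<le> (\<Sum>i\<in>UNIV. integral {0..\<tau>} (\<lambda>t. w i t * \<bar>\<sigma> i t\<bar>))"
proof -
  have 1: "(\<kappa> / 32) * (integral {0..\<tau>} (w i))\<^sup>2 \<le> integral {0..\<tau>} (\<lambda>t. w i t * \<bar>\<sigma> i t\<bar>)" for i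
  proof -
    have bw: "bounded_measurable \<tau> (\<lambda>s. w i s / 2)"
      using bm_mult[OF bm_const[of \<tau> "1/2"] w(1)[of i]] by simp
    have "(integral {0..\<tau>} (\<lambda>s. w i s / 2))\<^sup>2 / 8 \<le> integral {0..\<tau>} (\<lambda>s. \<bar>s - s0 i\<bar> * (w i s / 2))"
      by (rule weighted_integral_lower_bound[OF bw]) (use w(2) in auto)
    then have "\<kappa> * ((integral {0..\<tau>} (\<lambda>s. w i s / 2))\<^sup>2 / 8) \<le> \<kappa> * integral {0..\<tau>} (\<lambda>s. \<bar>s - s0 i\<bar> * (w i s / 2))"
      using kappa by (intro mult_left_mono) auto
    also have "\<dots> = integral {0..\<tau>} (\<lambda>s. \<kappa> * (\<bar>s - s0 i\<bar> * (w i s / 2)))" by simp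
    also have "\<dots> \<le> integral {0..\<tau>} (\<lambda>t. w i t * \<bar>\<sigma> i t\<bar>)"
    proof (rule integral_le)
      have "continuous_on {0..\<tau>} (\<lambda>s. \<bar>s - s0 i\<bar>)" by (intro continuous_intros)
      then show "(\<lambda>s. \<kappa> * (\<bar>s - s0 i\<bar> * (w i s / 2))) integrable_on {0..\<tau>}"
        by (intro bm_integrable[of \<tau>] bm_mult bm_const bw bm_continuous) auto
      show "(\<lambda>t. w i t * \<bar>\<sigma> i t\<bar>) integrable_on {0..\<tau>}"
        by (intro bm_integrable[of \<tau>] bm_mult bm_abs w bm_continuous[OF \<sigma>]) auto
      fix s assume s: "s \<in> {0..\<tau>}"
      have "w i s * (\<kappa> / 2 * \<bar>s - s0 i\<bar>) \<le> w i s * \<bar>\<sigma> i s\<bar>"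
        using w(2)[OF s, of i] s0[OF s, of i] by (intro mult_left_mono) auto
      then show "\<kappa> * (\<bar>s - s0 i\<bar> * (w i s / 2)) \<le> w i s * \<bar>\<sigma> i s\<bar>" by (simp add: algebra_simps)
    qed
    finally show ?thesis by (simp add: power2_eq_square)
  qed
  have "c0 * (\<Sum>i\<in>UNIV. integral {0..\<tau>} (w i))\<^sup>2 \<le> c0 * ((\<Sum>i\<in>UNIV. (integral {0..\<tau>} (w i))\<^sup>2) * real CARD('m))"
    using sum_squared_le_sum_of_squares[of "\<lambda>i. integral {0..\<tau>} (w i)" UNIV] c0_pos by (intro mult_left_mono) auto
  also have "\<dots> = (\<Sum>i\<in>UNIV. (\<kappa> / 32) * (integral {0..\<tau>} (w i))\<^sup>2)"
    unfolding sum_distrib_left[symmetric] using CARD_ge by (simp add: c0_def)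
  also have "\<dots> \<le> (\<Sum>i\<in>UNIV. integral {0..\<tau>} (\<lambda>t. w i t * \<bar>\<sigma> i t\<bar>))"
    by (rule sum_mono) (rule 1)
  finally show ?thesis .
qed

text \<open>At the midpoint of two controls there is room to move by half their distance in the direction
  of the sign of the switching function; the gain is quadratic in that distance, since the switching
  function grows at least linearly away from its zero.\<close>

lemma midpoint_gain:
  assumes u: "u \<in> controls" and v: "v \<in> controls" and \<zeta>: "norm \<zeta> = 1" and tau: "0 \<le> \<tau>" "\<tau> \<le> T0"
  obtains w where "w \<in> controls"
    "(\<zeta> \<bullet> traj u \<tau> + \<zeta> \<bullet> traj v \<tau>) / 2 + (c0 / 4) * (control_dist \<tau> u v)\<^sup>2 \<le> \<zeta> \<bullet> traj w \<tau>"
proof -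
  define m where "m i t = (u i t + v i t) / 2" for i t
  have ub: "\<bar>u i t\<bar> \<le> 1" and vb: "\<bar>v i t\<bar> \<le> 1" for i t by (rule controls_abs_le, fact)+
  have m: "m \<in> controls"
  proof (rule controlsI)
    show "m i \<in> borel_measurable lebesgue" for i
      unfolding m_def by (intro borel_measurable_divide borel_measurable_add borel_measurable_const controls_measurable u v)
    show "\<bar>m i t\<bar> \<le> 1" for i t
      using ub[of i t] vb[of i t] unfolding m_def by (simp add: abs_le_iff)
  qed
  obtain \<sigma> s0 where \<sigma>: "\<And>i. continuous_on {0..\<tau>} (\<sigma> i)"
    and s0: "\<And>i s. s \<in> {0..\<tau>} \<Longrightarrow> (\<kappa> / 2) * \<bar>s - s0 i\<bar> \<le> \<bar>\<sigma> i s\<bar>"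
    and ex: "\<And>v. v \<in> controls \<Longrightarrow> \<bar>\<zeta> \<bullet> (traj v \<tau> - traj m \<tau>) -
       (\<Sum>i\<in>UNIV. integral {0..\<tau>} (\<lambda>t. (v i t - m i t) * \<sigma> i t))\<bar>
      \<le> 16 * K ^ 3 * \<tau> * (control_dist \<tau> m v)\<^sup>2"
    by (rule switching_function_exists[OF m \<zeta> tau]) blast
  define s where "s = sign_control \<tau> \<sigma>"
  have s: "s \<in> controls" unfolding s_def by (rule sign_control_in_controls[OF \<sigma>])
  define w where "w i t = m i t + s i t * \<bar>u i t - v i t\<bar> / 2" for i t
  have sb: "\<bar>s i t * \<bar>u i t - v i t\<bar>\<bar> \<le> \<bar>u i t - v i t\<bar>" for i t
    using mult_right_mono[OF controls_abs_le[OF s, of i t], of "\<bar>u i t - v i t\<bar>"] by (simp add: abs_mult)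
  have w: "w \<in> controls"
  proof (rule controlsI)
    show "w i \<in> borel_measurable lebesgue" for i
      unfolding w_def by (intro borel_measurable_divide borel_measurable_add borel_measurable_const
          borel_measurable_times borel_measurable_abs borel_measurable_diff controls_measurable m s u v)
    have "\<bar>(a + b) / 2 + c / 2\<bar> \<le> 1" if "\<bar>a\<bar> \<le> 1" "\<bar>b\<bar> \<le> 1" "\<bar>c\<bar> \<le> \<bar>a - b\<bar>" for a b c :: real
      using that by (cases "a \<le> b") (auto simp: abs_le_iff field_simps)
    from this[OF ub vb sb] show "\<bar>w i t\<bar> \<le> 1" for i t
      unfolding w_def m_def .
  qed
  define d where "d = control_dist \<tau> u v"
  have d0: "0 \<le> d" unfolding d_def by (rule control_dist_nonneg)
  have half: "control_dist \<tau> m x \<le> d / 2" if x: "x \<in> controls" and "\<And>i t. \<bar>m i t - x i t\<bar> \<le> \<bar>u i t - v i t\<bar> / 2" for x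
  proof -
    have "control_dist \<tau> m x \<le> integral {0..\<tau>} (\<lambda>t. (1/2) * (\<Sum>i\<in>UNIV. \<bar>u i t - v i t\<bar>))"
    proof (rule control_dist_integral_mono[OF m x])
      show "bounded_measurable \<tau> (\<lambda>t. (1/2) * (\<Sum>i\<in>UNIV. \<bar>u i t - v i t\<bar>))"
        by (intro bm_mult bm_const bm_control_sum u v)
      show "(\<Sum>i\<in>UNIV. \<bar>m i t - x i t\<bar>) \<le> (1/2) * (\<Sum>i\<in>UNIV. \<bar>u i t - v i t\<bar>)" for t
        unfolding sum_distrib_left by (rule sum_mono) (use that(2) in simp)
    qed
    then show ?thesis unfolding d_def control_dist_def by simp
  qed
  let ?S = "16 * K ^ 3 * \<tau>"
  have S0: "0 \<le> ?S" using K_ge tau by simp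
  let ?I = "\<lambda>x. \<Sum>i\<in>UNIV. integral {0..\<tau>} (\<lambda>t. (x i t - m i t) * \<sigma> i t)"
  have ex': "\<bar>\<zeta> \<bullet> traj x \<tau> - \<zeta> \<bullet> traj m \<tau> - ?I x\<bar> \<le> (c0 / 8) * d\<^sup>2"
    if x: "x \<in> controls" and "\<And>i t. \<bar>m i t - x i t\<bar> \<le> \<bar>u i t - v i t\<bar> / 2" for x
  proof -
    have "?S * (control_dist \<tau> m x)\<^sup>2 \<le> (c0 / 2) * (d / 2)\<^sup>2"
      using half[OF that] control_dist_nonneg[of \<tau> m x] c0_pos
      by (intro mult_mono power_mono expansion_error_le tau) auto
    then show ?thesis using ex[OF x] by (simp add: inner_diff_right power2_eq_square)
  qed
  have neg: "(v i t - m i t) * \<sigma> i t = - ((u i t - m i t) * \<sigma> i t)" for i t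
    unfolding m_def by (simp add: field_simps)
  have aux: "(U + V) / 2 + (c / 4) * D \<le> W"
    if "J = - I" "(c / 2) * D \<le> H" "\<bar>W - M - H\<bar> \<le> (c / 8) * D" "\<bar>U - M - I\<bar> \<le> (c / 8) * D"
      "\<bar>V - M - J\<bar> \<le> (c / 8) * D" for I J H U V W M c D :: real
    using that unfolding abs_le_iff by (auto simp: field_simps)
  have "?I v = - ?I u" unfolding neg by (simp add: sum_negf)
  moreover have "(c0 / 2) * d\<^sup>2 \<le> ?I w"
  proof -
    have "c0 * (\<Sum>i\<in>UNIV. integral {0..\<tau>} (\<lambda>t. \<bar>u i t - v i t\<bar>))\<^sup>2 \<le>
      (\<Sum>i\<in>UNIV. integral {0..\<tau>} (\<lambda>t. \<bar>u i t - v i t\<bar> * \<bar>\<sigma> i t\<bar>))"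
    proof (rule switching_gain[OF \<sigma> s0])
      show "bounded_measurable \<tau> (\<lambda>t. \<bar>u i t - v i t\<bar>)" for i
        by (intro bm_abs bm_diff bm_control u v)
      show "0 \<le> \<bar>u i t - v i t\<bar> \<and> \<bar>u i t - v i t\<bar> \<le> 2" for i t
        using ub[of i t] vb[of i t] by auto
    qed
    also have "\<dots> = 2 * ?I w"
      unfolding sum_distrib_left
    proof (rule sum.cong[OF refl])
      fix i
      have "integral {0..\<tau>} (\<lambda>t. \<bar>u i t - v i t\<bar> * \<bar>\<sigma> i t\<bar>) = integral {0..\<tau>} (\<lambda>t. 2 * ((w i t - m i t) * \<sigma> i t))"
        by (rule integral_cong) (auto simp: w_def s_def sign_control_def abs_sgn)
      then show "integral {0..\<tau>} (\<lambda>t. \<bar>u i t - v i t\<bar> * \<bar>\<sigma> i t\<bar>) = 2 * integral {0..\<tau>} (\<lambda>t. (w i t - m i t) * \<sigma> i t)"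
        by simp
    qed
    finally show ?thesis unfolding d_def control_dist_eq_sum[OF u v] by simp
  qed
  moreover have "\<bar>\<zeta> \<bullet> traj w \<tau> - \<zeta> \<bullet> traj m \<tau> - ?I w\<bar> \<le> (c0 / 8) * d\<^sup>2"
    by (rule ex'[OF w]) (use sb in \<open>auto simp: w_def\<close>)
  moreover have "\<bar>\<zeta> \<bullet> traj u \<tau> - \<zeta> \<bullet> traj m \<tau> - ?I u\<bar> \<le> (c0 / 8) * d\<^sup>2"
    by (rule ex'[OF u]) (auto simp: m_def abs_if field_simps)
  moreover have "\<bar>\<zeta> \<bullet> traj v \<tau> - \<zeta> \<bullet> traj m \<tau> - ?I v\<bar> \<le> (c0 / 8) * d\<^sup>2"
    by (rule ex'[OF v]) (auto simp: m_def abs_if field_simps)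
  ultimately have "(\<zeta> \<bullet> traj u \<tau> + \<zeta> \<bullet> traj v \<tau>) / 2 + (c0 / 4) * d\<^sup>2 \<le> \<zeta> \<bullet> traj w \<tau>"
    by (rule aux)
  then show thesis using that[OF w] unfolding d_def by blast
qed

text \<open>The quadratic gap is part of the notion, since uniqueness, continuity in
  \<open>\<zeta>\<close> and strong convexity are all drawn from it.\<close>

definition is_optimal :: "real \<Rightarrow> 'a \<Rightarrow> ('m \<Rightarrow> real \<Rightarrow> real) \<Rightarrow> bool" where
  "is_optimal \<tau> \<zeta> u \<longleftrightarrow> u \<in> controls \<and>
     (\<forall>v\<in>controls. \<zeta> \<bullet> traj v \<tau> \<le> \<zeta> \<bullet> traj u \<tau> - (c0 / 2) * (control_dist \<tau> v u)\<^sup>2)"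

lemma optimal_exists:
  assumes \<zeta>: "norm \<zeta> = 1" and tau: "0 \<le> \<tau>" "\<tau> \<le> T0"
  shows "\<exists>u. is_optimal \<tau> \<zeta> u"
proof -
  let ?E = "\<lambda>u. \<zeta> \<bullet> traj u \<tau>"
  define h where "h = Sup (?E ` controls)"
  have bdd: "bdd_above (?E ` controls)"
  proof (rule bdd_aboveI2)
    fix u :: "'m \<Rightarrow> real \<Rightarrow> real" assume "u \<in> controls"
    then show "?E u \<le> 1"
      using norm_cauchy_schwarz[of \<zeta> "traj u \<tau>"] traj_ball[of u \<tau>] \<zeta> tau by simp
  qed
  have le_h: "?E u \<le> h" if "u \<in> controls" for u
    unfolding h_def using bdd that by (intro cSup_upper) auto
  have gain: "(?E u + ?E v) / 2 + (c0 / 4) * (control_dist \<tau> u v)\<^sup>2 \<le> h"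
    if "u \<in> controls" "v \<in> controls" for u v
    using midpoint_gain[OF that \<zeta> tau] le_h order_trans by metis
  have "\<exists>u\<in>controls. h - 1 / (real n + 1) < ?E u" for n
    using less_cSup_iff[OF _ bdd, of "h - 1 / (real n + 1)"] zero_in_controls
    unfolding h_def[symmetric] by force
  then obtain u where u: "\<And>n. u n \<in> controls" "\<And>n. h - 1 / (real n + 1) < ?E (u n)" by metis
  obtain us where us: "us \<in> controls" "(\<lambda>n. control_dist \<tau> (u n) us) \<longlonglongrightarrow> 0"
  proof (rule controls_complete[of u \<tau>, OF u(1)])
    fix e :: real assume e: "0 < e"
    then have "0 < (c0 / 4) * e\<^sup>2" using c0_pos by simp
    then obtain N where N: "1 / real (Suc N) < (c0 / 4) * e\<^sup>2" using nat_approx_posE by blast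
    have aux: "y < k" if "(A + B) / 2 + y \<le> c" "c - p < A" "c - q < B" "p \<le> r" "q \<le> r" "r < k"
      for A B y p q r k c :: real
      using that by (simp add: field_simps)
    \<comment> \<open>If both payoffs exceed \<open>h - 1 / Suc N\<close>, a midpoint gain above
      \<open>1 / Suc N\<close> would carry some control past the supremum \<open>h\<close>.\<close>
    have "control_dist \<tau> (u m) (u n) < e" if mn: "m \<ge> N" "n \<ge> N" for m n
    proof -
      have "1 / (real m + 1) \<le> 1 / real (Suc N)" "1 / (real n + 1) \<le> 1 / real (Suc N)"
        using mn by (auto intro!: divide_left_mono)
      then have "(c0 / 4) * (control_dist \<tau> (u m) (u n))\<^sup>2 < (c0 / 4) * e\<^sup>2"
        by (rule aux[OF gain[OF u(1)[of m] u(1)[of n]] u(2)[of m] u(2)[of n] _ _ N])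
      then have "(control_dist \<tau> (u m) (u n))\<^sup>2 < e\<^sup>2" using c0_pos by simp
      then show ?thesis using e by (meson power_less_imp_less_base less_imp_le)
    qed
    then show "\<exists>N. \<forall>m\<ge>N. \<forall>n\<ge>N. control_dist \<tau> (u m) (u n) < e" by blast
  qed
  have "h \<le> ?E us"
  proof (rule LIMSEQ_le_const[of "\<lambda>n. ?E us + 1 / (real n + 1) + 2 * K * control_dist \<tau> (u n) us"])
    have "(\<lambda>n. ?E us + 1 / real (Suc n) + 2 * K * control_dist \<tau> (u n) us) \<longlonglongrightarrow> ?E us + 0 + 2 * K * 0"
      by (intro tendsto_add tendsto_mult tendsto_const us(2) lim_inverse_n'[THEN LIMSEQ_Suc])
    then show "(\<lambda>n. ?E us + 1 / (real n + 1) + 2 * K * control_dist \<tau> (u n) us) \<longlonglongrightarrow> ?E us"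
      by (simp add: add.commute)
    have "h \<le> ?E us + 1 / (real n + 1) + 2 * K * control_dist \<tau> (u n) us" for n
    proof -
      have "?E (u n) - ?E us \<le> norm \<zeta> * norm (traj (u n) \<tau> - traj us \<tau>)"
        unfolding inner_diff_right[symmetric] by (rule norm_cauchy_schwarz)
      also have "\<dots> \<le> 2 * K * control_dist \<tau> (u n) us"
        using traj_lipschitz[OF us(1) u(1)[of n] tau(2), of \<tau>] \<zeta> tau by (simp add: control_dist_commute)
      finally show ?thesis using u(2)[of n] by linarith
    qed
    then show "\<exists>N. \<forall>n\<ge>N. h \<le> ?E us + 1 / (real n + 1) + 2 * K * control_dist \<tau> (u n) us" by blast
  qed
  then have h: "?E us = h" using le_h[OF us(1)] by simp
  \<comment> \<open>Testing \<open>v\<close> against the maximizer gives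
    \<open>(?E v + h) / 2 + (c0 / 4) * d^2 \<le> h\<close>; doubling yields the gap.\<close>
  have "?E v \<le> ?E us - (c0 / 2) * (control_dist \<tau> v us)\<^sup>2" if "v \<in> controls" for v
    using gain[OF that us(1)] h by (simp add: field_simps)
  then show ?thesis unfolding is_optimal_def using us(1) by blast
qed

definition opt :: "real \<Rightarrow> 'a \<Rightarrow> 'm \<Rightarrow> real \<Rightarrow> real" where
  "opt \<tau> \<zeta> = (SOME u. is_optimal \<tau> \<zeta> u)"

lemma
  assumes "norm \<zeta> = 1" "0 \<le> \<tau>" "\<tau> \<le> T0"
  shows opt_control: "opt \<tau> \<zeta> \<in> controls"
    and opt_gap: "v \<in> controls \<Longrightarrow>
      \<zeta> \<bullet> traj v \<tau> \<le> \<zeta> \<bullet> traj (opt \<tau> \<zeta>) \<tau> - (c0 / 2) * (control_dist \<tau> v (opt \<tau> \<zeta>))\<^sup>2"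
proof -
  have "is_optimal \<tau> \<zeta> (opt \<tau> \<zeta>)"
    unfolding opt_def by (rule someI_ex[OF optimal_exists[OF assms]])
  then show "opt \<tau> \<zeta> \<in> controls" "v \<in> controls \<Longrightarrow>
      \<zeta> \<bullet> traj v \<tau> \<le> \<zeta> \<bullet> traj (opt \<tau> \<zeta>) \<tau> - (c0 / 2) * (control_dist \<tau> v (opt \<tau> \<zeta>))\<^sup>2"
    unfolding is_optimal_def by blast+
qed

text \<open>Each of the two maximizers is tested in the gap inequality of the other direction. The
  sum is \<open>c0 * d^2 \<le> (\<zeta> - \<xi>) . (difference of the end points)\<close>, and the
  end points differ by at most \<open>2 * K * d\<close>, so one factor \<open>d\<close>
  cancels.\<close>

lemma opt_lipschitz:
  assumes \<zeta>: "norm \<zeta> = 1" and \<xi>: "norm \<xi> = 1" and tau: "0 \<le> \<tau>" "\<tau> \<le> T0"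
  shows "control_dist \<tau> (opt \<tau> \<zeta>) (opt \<tau> \<xi>) \<le> (2 * K / c0) * norm (\<zeta> - \<xi>)"
proof -
  let ?u = "opt \<tau> \<zeta>" and ?v = "opt \<tau> \<xi>"
  define d where "d = control_dist \<tau> ?u ?v"
  have d0: "0 \<le> d" unfolding d_def by (rule control_dist_nonneg)
  have uv: "?u \<in> controls" "?v \<in> controls" by (auto intro: opt_control \<zeta> \<xi> tau)
  have "c0 * d\<^sup>2 \<le> (\<zeta> - \<xi>) \<bullet> (traj ?u \<tau> - traj ?v \<tau>)"
    using opt_gap[OF \<zeta> tau uv(2)] opt_gap[OF \<xi> tau uv(1)]
    unfolding d_def by (simp add: control_dist_commute inner_diff_left inner_diff_right)
  also have "\<dots> \<le> norm (\<zeta> - \<xi>) * norm (traj ?u \<tau> - traj ?v \<tau>)" by (rule norm_cauchy_schwarz)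
  also have "\<dots> \<le> norm (\<zeta> - \<xi>) * (2 * K * d)"
    using traj_lipschitz[OF uv(2,1) tau(2), of \<tau>] tau unfolding d_def
    by (intro mult_left_mono) (auto simp: control_dist_commute)
  finally have "(c0 * d) * d \<le> (2 * K * norm (\<zeta> - \<xi>)) * d" by (simp add: power2_eq_square mult_ac)
  then have "c0 * d \<le> 2 * K * norm (\<zeta> - \<xi>)" using d0 K_ge by (cases "d = 0") (auto simp: mult_le_cancel_right)
  then show ?thesis using c0_pos unfolding d_def by (simp add: field_simps)
qed

section \<open>Convexity of the reachable set\<close>

definition reach :: "real \<Rightarrow> 'a set" where
  "reach \<tau> = (\<lambda>u. traj u \<tau>) ` controls"

text \<open>The direction \<open>x / norm x\<close> has no limit at the origin, but multiplying the
  maximizer by \<open>norm x\<close> makes the family of controls Lipschitz in \<open>L^1\<close> on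
  the whole ball. On the sphere it consists of the maximizers themselves, whose end points lie
  strictly beyond \<open>z\<close> in direction \<open>x\<close>: the outward condition of the
  Brouwer lemma.\<close>

lemma below_support_in_reach:
  assumes tau: "0 \<le> \<tau>" "\<tau> \<le> T0"
    and z: "\<And>\<zeta>. norm \<zeta> = 1 \<Longrightarrow> \<zeta> \<bullet> z < \<zeta> \<bullet> traj (opt \<tau> \<zeta>) \<tau>"
  shows "z \<in> reach \<tau>"
proof -
  define w :: "'a \<Rightarrow> 'm \<Rightarrow> real \<Rightarrow> real"
    where "w x = (if x = 0 then (\<lambda>_ _. 0) else opt \<tau> ((1 / norm x) *\<^sub>R x))" for x
  have wc: "w x \<in> controls" for x
    unfolding w_def using zero_in_controls by (auto intro!: opt_control tau)
  define \<Phi> where "\<Phi> x = traj (\<lambda>i t. norm x * w x i t) \<tau>" for x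
  have \<Phi>c: "(\<lambda>i t. norm x * w x i t) \<in> controls" if "x \<in> cball 0 1" for x
    using control_dist_scale(2)[OF wc wc, of "norm x" 0 \<tau>] that tau by auto
  define C where "C = 4 * K / c0 + real CARD('m) * \<tau>"
  have C0: "0 \<le> C" unfolding C_def using K_ge c0_pos tau by simp
  have d: "control_dist \<tau> (\<lambda>i t. norm x * w x i t) (\<lambda>i t. norm y * w y i t) \<le> C * norm (x - y)"
    if x: "x \<in> cball 0 1" and y: "y \<in> cball 0 1" for x y
  proof -
    have n: "\<bar>norm x - norm y\<bar> \<le> norm (x - y)" by (rule norm_triangle_ineq3)
    have *: "\<bar>norm x - norm y\<bar> * (real CARD('m) * \<tau>) \<le> real CARD('m) * \<tau> * norm (x - y)"
      using n tau by (subst mult.commute) (intro mult_left_mono, auto)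
    have "real CARD('m) * \<tau> * norm (x - y) \<le> C * norm (x - y)"
      unfolding C_def using K_ge c0_pos by (intro mult_right_mono) auto
    then have **: "\<bar>norm x - norm y\<bar> * (real CARD('m) * \<tau>) \<le> C * norm (x - y)"
      using * by (rule order_trans[rotated])
    \<comment> \<open>Normalized vectors can be far apart for nearby \<open>x\<close> and
      \<open>y\<close> close to 0; the prefactor \<open>norm x\<close> reduces their distance to at
      most \<open>2 * norm (x - y)\<close>.\<close>
    have le: "norm x * control_dist \<tau> (w x) (w y) \<le> (4 * K / c0) * norm (x - y)" if "x \<noteq> 0" "y \<noteq> 0"
    proof -
      let ?x = "(1 / norm x) *\<^sub>R x" and ?y = "(1 / norm y) *\<^sub>R y"
      have "norm x *\<^sub>R (?x - ?y) = (x - y) + (norm y - norm x) *\<^sub>R ?y"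
        using that by (simp add: scaleR_diff_right scaleR_diff_left diff_divide_distrib)
      then have "norm x * norm (?x - ?y) = norm ((x - y) + (norm y - norm x) *\<^sub>R ?y)"
        by (metis abs_norm_cancel norm_scaleR)
      also have "\<dots> \<le> norm (x - y) + norm ((norm y - norm x) *\<^sub>R ?y)" by (rule norm_triangle_ineq)
      also have "\<dots> \<le> 2 * norm (x - y)" using n that by (simp add: abs_minus_commute)
      finally have nn: "norm x * norm (?x - ?y) \<le> 2 * norm (x - y)" .
      have "norm x * control_dist \<tau> (w x) (w y) \<le> norm x * ((2 * K / c0) * norm (?x - ?y))"
        using opt_lipschitz[of ?x ?y] tau that by (intro mult_left_mono) (auto simp: w_def)
      also have "\<dots> = (2 * K / c0) * (norm x * norm (?x - ?y))" by simp
      also have "\<dots> \<le> (2 * K / c0) * (2 * norm (x - y))"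
        using nn K_ge c0_pos by (intro mult_left_mono) auto
      finally show ?thesis by simp
    qed
    consider "x = 0" | "y = 0" | "x \<noteq> 0" "y \<noteq> 0" by blast
    then show ?thesis
    proof cases
      case 1
      have "control_dist \<tau> (\<lambda>i t. norm x * w x i t) (\<lambda>i t. norm y * w y i t) \<le>
        norm x * control_dist \<tau> (w x) (w y) + \<bar>norm x - norm y\<bar> * (real CARD('m) * \<tau>)"
        by (rule control_dist_scale[OF wc wc]) (use x y tau in auto)
      then show ?thesis using ** 1 by simp
    next
      case 2
      have "control_dist \<tau> (\<lambda>i t. norm y * w y i t) (\<lambda>i t. norm x * w x i t) \<le>
        norm y * control_dist \<tau> (w y) (w x) + \<bar>norm y - norm x\<bar> * (real CARD('m) * \<tau>)"
        by (rule control_dist_scale[OF wc wc]) (use x y tau in auto)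
      then show ?thesis using ** 2 by (simp add: control_dist_commute abs_minus_commute)
    next
      case 3
      have "control_dist \<tau> (\<lambda>i t. norm x * w x i t) (\<lambda>i t. norm y * w y i t) \<le>
        norm x * control_dist \<tau> (w x) (w y) + \<bar>norm x - norm y\<bar> * (real CARD('m) * \<tau>)"
        by (rule control_dist_scale[OF wc wc]) (use x y tau in auto)
      then show ?thesis using * le[OF 3] unfolding C_def distrib_right by linarith
    qed
  qed
  have "(2 * K * C)-lipschitz_on (cball 0 1) \<Phi>"
  proof (rule lipschitz_onI)
    fix x y :: 'a assume xy: "x \<in> cball 0 1" "y \<in> cball 0 1"
    have "norm (\<Phi> x - \<Phi> y) \<le> 2 * K * control_dist \<tau> (\<lambda>i t. norm y * w y i t) (\<lambda>i t. norm x * w x i t)"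
      unfolding \<Phi>_def by (rule traj_lipschitz[OF \<Phi>c \<Phi>c tau(2)]) (use xy tau in auto)
    also have "\<dots> \<le> 2 * K * (C * norm (x - y))"
      using d[OF xy] K_ge by (intro mult_left_mono) (auto simp: control_dist_commute)
    finally show "dist (\<Phi> x) (\<Phi> y) \<le> 2 * K * C * dist x y" by (simp add: dist_norm)
  qed (use K_ge C0 in simp)
  then have "continuous_on (cball 0 1) \<Phi>" by (rule lipschitz_on_continuous_on)
  moreover have "0 < x \<bullet> (\<Phi> x - z)" if x: "norm x = 1" for x
  proof -
    have "x \<noteq> 0" using x by auto
    then show ?thesis using z[OF x] x unfolding \<Phi>_def w_def by (simp add: inner_diff_right)
  qed
  ultimately obtain x where "x \<in> cball 0 1" "\<Phi> x = z"
    using surjective_if_outward_on_sphere[of \<Phi> z] by blast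
  then show ?thesis using \<Phi>c[of x] unfolding reach_def \<Phi>_def by blast
qed

text \<open>End points at control distance \<open>d\<close> are at most \<open>2 * K * d\<close>
  apart, so the gap \<open>(c0 / 2) * d^2\<close> for controls becomes \<open>gam\<close> times the
  squared distance of the end points.\<close>

definition gam :: real where "gam = c0 / (8 * K\<^sup>2)"

lemma gam_pos: "0 < gam"
  unfolding gam_def using c0_pos K_ge by simp

lemma reach_strong_support:
  assumes \<zeta>: "norm \<zeta> = 1" and tau: "0 \<le> \<tau>" "\<tau> \<le> T0" and x: "x \<in> reach \<tau>"
  shows "\<zeta> \<bullet> (x - traj (opt \<tau> \<zeta>) \<tau>) \<le> - gam * (norm (x - traj (opt \<tau> \<zeta>) \<tau>))\<^sup>2"
proof -
  obtain v where v: "v \<in> controls" "x = traj v \<tau>" using x unfolding reach_def by blast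
  let ?u = "opt \<tau> \<zeta>"
  have u: "?u \<in> controls" by (rule opt_control[OF \<zeta> tau])
  have "norm (x - traj ?u \<tau>) \<le> 2 * K * control_dist \<tau> v ?u"
    using traj_lipschitz[OF u v(1) tau(2), of \<tau>] tau v(2) by (simp add: control_dist_commute)
  then have "(norm (x - traj ?u \<tau>))\<^sup>2 \<le> (2 * K * control_dist \<tau> v ?u)\<^sup>2" by (rule power_mono) simp
  then have "gam * (norm (x - traj ?u \<tau>))\<^sup>2 \<le> gam * (2 * K * control_dist \<tau> v ?u)\<^sup>2"
    using gam_pos by (intro mult_left_mono) auto
  also have "\<dots> = (c0 / 2) * (control_dist \<tau> v ?u)\<^sup>2"
    unfolding gam_def using K_ge by (simp add: power_mult_distrib)
  finally show ?thesis using opt_gap[OF \<zeta> tau v(1)] v(2) by (simp add: inner_diff_right)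
qed

text \<open>It is enough that the closed convex hull adds nothing. Its points inherit the ball
  condition in every direction. Such a point is either strictly below every support value, hence
  reachable, or it attains one of them, and then the quadratic term forces it to be the maximizing
  end point.\<close>

lemma reach_closed_convex:
  assumes tau: "0 \<le> \<tau>" "\<tau> \<le> T0"
  shows "closed (reach \<tau>)" "convex (reach \<tau>)"
proof -
  let ?C = "closure (convex hull (reach \<tau>))"
  have "?C \<subseteq> reach \<tau>"
  proof
    fix z assume z: "z \<in> ?C"
    have sup: "\<zeta> \<bullet> (z - e) + gam * (norm (z - e))\<^sup>2 \<le> 0"
      if \<zeta>: "norm \<zeta> = 1" and e: "e = traj (opt \<tau> \<zeta>) \<tau>" for \<zeta> e
    proof -
      define c where "c = e - (1 / (2 * gam)) *\<^sub>R \<zeta>"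
      note ball = cball_iff_strong_support[OF \<zeta> gam_pos, of _ e, folded c_def]
      have "reach \<tau> \<subseteq> cball c (1 / (2 * gam))"
        using reach_strong_support[OF \<zeta> tau] unfolding e[symmetric] subset_iff ball by fastforce
      then have "?C \<subseteq> cball c (1 / (2 * gam))"
        by (intro closure_minimal hull_minimal) auto
      then show ?thesis using z ball by blast
    qed
    show "z \<in> reach \<tau>"
    proof (cases "\<forall>\<zeta>. norm \<zeta> = 1 \<longrightarrow> \<zeta> \<bullet> z < \<zeta> \<bullet> traj (opt \<tau> \<zeta>) \<tau>")
      case True
      then show ?thesis using below_support_in_reach[OF tau] by blast
    next
      case False
      then obtain \<zeta> where \<zeta>: "norm \<zeta> = 1" "\<zeta> \<bullet> traj (opt \<tau> \<zeta>) \<tau> \<le> \<zeta> \<bullet> z" by force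
      then have "gam * (norm (z - traj (opt \<tau> \<zeta>) \<tau>))\<^sup>2 \<le> 0"
        using sup[OF \<zeta>(1) refl] by (simp add: inner_diff_right)
      then have "z = traj (opt \<tau> \<zeta>) \<tau>" using gam_pos by (simp add: mult_le_0_iff)
      then show ?thesis unfolding reach_def using opt_control[OF \<zeta>(1) tau] by blast
    qed
  qed
  then have eq: "reach \<tau> = ?C"
    by (rule subset_antisym[OF order_trans[OF hull_subset closure_subset]])
  show "closed (reach \<tau>)" "convex (reach \<tau>)"
    by (subst eq, simp)+
qed

end

text \<open>On the segment from \<open>x\<close> towards \<open>y\<close> the inner product is
  linear in the parameter and the allowed excess quadratic, so a positive inner product
  \<open>p\<close> fails for a small parameter. The choice \<open>p / (2 * (p + q))\<close> also
  covers \<open>q = 0\<close>.\<close>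

lemma proximal_normal_convex:
  assumes K: "convex K" and x: "x \<in> K" and y: "y \<in> K" and v: "v \<in> proximal_normal_cone K x"
  shows "v \<bullet> (y - x) \<le> 0"
proof (rule ccontr)
  assume "\<not> v \<bullet> (y - x) \<le> 0"
  obtain s where s: "0 \<le> s" "\<And>y. y \<in> K \<Longrightarrow> v \<bullet> (y - x) \<le> s * (norm (y - x))\<^sup>2"
    using v unfolding proximal_normal_cone_def by auto
  define p q where "p = v \<bullet> (y - x)" and "q = s * (norm (y - x))\<^sup>2"
  have p: "0 < p" and q: "0 \<le> q" using \<open>\<not> v \<bullet> (y - x) \<le> 0\<close> s(1) by (auto simp: p_def q_def)
  define t where "t = p / (2 * (p + q))"
  have t: "0 < t" "t \<le> 1" using p q by (auto simp: t_def field_simps)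
  have "(1 - t) *\<^sub>R x + t *\<^sub>R y \<in> K" using convexD_alt[OF K x y, of t] t by simp
  from s(2)[OF this] have "t * p \<le> s * (norm (t *\<^sub>R (y - x)))\<^sup>2"
    unfolding p_def by (simp add: algebra_simps inner_diff_right)
  also have "\<dots> = t * (t * q)" unfolding q_def using t by (simp add: power_mult_distrib power2_eq_square mult_ac)
  finally have "p \<le> t * q" using t by simp
  moreover have "t * q < p" unfolding t_def using p q by (simp add: field_simps add_nonneg_pos)
  ultimately show False by simp
qed

section \<open>Bang-bang maximizers, waiting at the origin, and boundary points\<close>

definition delayed :: "real \<Rightarrow> ('m \<Rightarrow> real \<Rightarrow> real) \<Rightarrow> 'm \<Rightarrow> real \<Rightarrow> real" where
  "delayed s u i t = (if t < s then 0 else u i (t - s))"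

lemma delayed_in_controls:
  fixes u :: "'m::finite \<Rightarrow> real \<Rightarrow> real"
  assumes u: "u \<in> controls"
  shows "delayed s u \<in> controls"
proof (rule controlsI)
  fix i
  have "(\<lambda>t. t - s) \<in> lebesgue \<rightarrow>\<^sub>M lebesgue"
    using lebesgue_measurable_affine[of 1 "- s"] by simp
  then have "(\<lambda>t. u i (t - s)) \<in> borel_measurable lebesgue"
    using controls_measurable[OF u] by (rule measurable_compose)
  then have "(\<lambda>t. if t \<in> {s..} then u i (t - s) else 0) \<in> borel_measurable lebesgue"
    by (intro measurable_If_set borel_measurable_const) auto
  moreover have "delayed s u i = (\<lambda>t. if t \<in> {s..} then u i (t - s) else 0)"
    by (auto simp: delayed_def fun_eq_iff)
  ultimately show "delayed s u i \<in> borel_measurable lebesgue" by simp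
qed (use controls_abs_le[OF u] in \<open>auto simp: delayed_def\<close>)

context control_system
begin

text \<open>Comparison with the sign control takes the place of the maximum principle. At distance
  \<open>d\<close> from the maximizer, the sign control gains at least \<open>c0 * d^2\<close> to
  first order and loses at most half of that to the expansion error; as it cannot beat the
  maximizer, \<open>d = 0\<close>.\<close>

lemma opt_bang_bang:
  assumes \<zeta>: "norm \<zeta> = 1" and tau: "0 \<le> \<tau>" "\<tau> \<le> T0"
  obtains \<sigma> :: "'m \<Rightarrow> real \<Rightarrow> real" and s0 where
    "\<And>i. continuous_on {0..\<tau>} (\<sigma> i)" "\<And>i s. s \<in> {0..\<tau>} \<Longrightarrow> s \<noteq> s0 i \<Longrightarrow> \<sigma> i s \<noteq> 0"
    "AE t in lebesgue_on {0..\<tau>}. \<forall>i. opt \<tau> \<zeta> i t = sgn (\<sigma> i t)"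
proof -
  let ?u = "opt \<tau> \<zeta>"
  have u: "?u \<in> controls" by (rule opt_control[OF assms])
  obtain \<sigma> s0 where \<sigma>: "\<And>i. continuous_on {0..\<tau>} (\<sigma> i)"
    and s0: "\<And>i s. s \<in> {0..\<tau>} \<Longrightarrow> (\<kappa> / 2) * \<bar>s - s0 i\<bar> \<le> \<bar>\<sigma> i s\<bar>"
    and ex: "\<And>v. v \<in> controls \<Longrightarrow> \<bar>\<zeta> \<bullet> (traj v \<tau> - traj ?u \<tau>) -
       (\<Sum>i\<in>UNIV. integral {0..\<tau>} (\<lambda>t. (v i t - ?u i t) * \<sigma> i t))\<bar>
      \<le> 16 * K ^ 3 * \<tau> * (control_dist \<tau> ?u v)\<^sup>2"
    by (rule switching_function_exists[OF u \<zeta> tau]) blast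
  define s where "s = sign_control \<tau> \<sigma>"
  have s: "s \<in> controls" unfolding s_def by (rule sign_control_in_controls[OF \<sigma>])
  define d where "d = control_dist \<tau> ?u s"
  have d0: "0 \<le> d" unfolding d_def by (rule control_dist_nonneg)
  have "c0 * (\<Sum>i\<in>UNIV. integral {0..\<tau>} (\<lambda>t. \<bar>?u i t - s i t\<bar>))\<^sup>2 \<le>
      (\<Sum>i\<in>UNIV. integral {0..\<tau>} (\<lambda>t. \<bar>?u i t - s i t\<bar> * \<bar>\<sigma> i t\<bar>))"
  proof (rule switching_gain[OF \<sigma> s0])
    show "bounded_measurable \<tau> (\<lambda>t. \<bar>?u i t - s i t\<bar>)" for i
      by (intro bm_abs bm_diff bm_control u s)
    show "0 \<le> \<bar>?u i t - s i t\<bar> \<and> \<bar>?u i t - s i t\<bar> \<le> 2" for i t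
      using controls_abs_le[OF u, of i t] controls_abs_le[OF s, of i t] by auto
  qed
  also have "\<dots> = (\<Sum>i\<in>UNIV. integral {0..\<tau>} (\<lambda>t. (s i t - ?u i t) * \<sigma> i t))"
  proof (rule sum.cong[OF refl], rule integral_cong)
    fix i t assume "t \<in> {0..\<tau>}"
    then have "s i t = sgn (\<sigma> i t)" by (simp add: s_def sign_control_def)
    then show "\<bar>?u i t - s i t\<bar> * \<bar>\<sigma> i t\<bar> = (s i t - ?u i t) * \<sigma> i t"
      using controls_abs_le[OF u, of i t] by (auto simp: sgn_if abs_if algebra_simps split: if_splits)
  qed
  finally have "c0 * d\<^sup>2 \<le> (\<Sum>i\<in>UNIV. integral {0..\<tau>} (\<lambda>t. (s i t - ?u i t) * \<sigma> i t))"
    unfolding d_def control_dist_eq_sum[OF u s] .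
  moreover have "\<zeta> \<bullet> (traj s \<tau> - traj ?u \<tau>) \<le> 0"
  proof -
    have "0 \<le> (c0 / 2) * (control_dist \<tau> s ?u)\<^sup>2" using c0_pos by simp
    then show ?thesis using opt_gap[OF assms s] by (simp add: inner_diff_right)
  qed
  moreover have "16 * K ^ 3 * \<tau> * d\<^sup>2 \<le> (c0 / 2) * d\<^sup>2"
    by (intro mult_right_mono expansion_error_le tau) auto
  moreover have aux: "c * D \<le> 0" if "c * D \<le> I" "E \<le> 0" "S \<le> (c / 2) * D" "\<bar>E - I\<bar> \<le> S" for c D I E S :: real
    using that unfolding abs_le_iff by (auto simp: field_simps)
  ultimately have "c0 * d\<^sup>2 \<le> 0" using ex[OF s] unfolding d_def by (intro aux) auto
  then have "d = 0" using c0_pos by (simp add: mult_le_0_iff)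
  then have "AE t in lebesgue_on {0..\<tau>}. \<forall>i. ?u i t = s i t"
    unfolding d_def by (rule control_dist_eq_0_imp_AE[OF u s])
  then have "AE t in lebesgue_on {0..\<tau>}. \<forall>i. ?u i t = sgn (\<sigma> i t)"
    by (rule lebesgue_on_mono) (auto simp: s_def sign_control_def)
  moreover have "\<sigma> i r \<noteq> 0" if "r \<in> {0..\<tau>}" "r \<noteq> s0 i" for i r
    using s0[OF that(1), of i] that(2) kappa by (auto simp: mult_le_0_iff)
  ultimately show thesis using that \<sigma> by blast
qed

lemma opt_abs_1:
  assumes "norm \<zeta> = 1" "0 \<le> \<tau>" "\<tau> \<le> T0"
  shows "AE t in lebesgue_on {0..\<tau>}. \<forall>i. \<bar>opt \<tau> \<zeta> i t\<bar> = 1"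
proof -
  obtain \<sigma> :: "'m \<Rightarrow> real \<Rightarrow> real" and s0 where
    *: "\<And>i s. s \<in> {0..\<tau>} \<Longrightarrow> s \<noteq> s0 i \<Longrightarrow> \<sigma> i s \<noteq> 0"
    "AE t in lebesgue_on {0..\<tau>}. \<forall>i. opt \<tau> \<zeta> i t = sgn (\<sigma> i t)"
    by (rule opt_bang_bang[OF assms]) blast
  have "AE t in lebesgue_on {0..\<tau>}. t \<in> {0..\<tau>}" by (auto intro: AE_I2)
  moreover have "AE t in lebesgue_on {0..\<tau>}. \<forall>i\<in>UNIV. t \<noteq> s0 i"
    by (rule AE_finite_allI) (auto intro: AE_lebesgue_on_neq)
  ultimately show ?thesis using *(2)
    by eventually_elim (use *(1) in \<open>auto simp: abs_sgn_eq\<close>)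
qed

lemma support_point_unique:
  assumes "norm \<zeta> = 1" "0 \<le> \<tau>" "\<tau> \<le> T0" and x: "x \<in> reach \<tau>"
    and le: "\<zeta> \<bullet> traj (opt \<tau> \<zeta>) \<tau> \<le> \<zeta> \<bullet> x"
  shows "x = traj (opt \<tau> \<zeta>) \<tau>"
proof -
  have "gam * (norm (x - traj (opt \<tau> \<zeta>) \<tau>))\<^sup>2 \<le> 0"
    using reach_strong_support[OF assms(1-3) x] le by (simp add: inner_diff_right)
  then show ?thesis using gam_pos by (simp add: mult_le_0_iff)
qed

lemma opt_in_reach: "norm \<zeta> = 1 \<Longrightarrow> 0 \<le> \<tau> \<Longrightarrow> \<tau> \<le> T0 \<Longrightarrow> traj (opt \<tau> \<zeta>) \<tau> \<in> reach \<tau>"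
  unfolding reach_def using opt_control by blast

text \<open>\<open>F 0 = 0\<close> makes the origin an equilibrium for the zero control, so a
  waiting time only shifts the trajectory.\<close>

lemma traj_delayed:
  assumes u: "u \<in> controls" and s: "0 \<le> s" "0 \<le> t" "s + t \<le> T0"
  shows "traj (delayed s u) (s + t) = traj u t"
proof -
  define y where "y r = (if r \<le> s then 0 else traj u (r - s))" for r
  have du: "delayed s u \<in> controls" by (rule delayed_in_controls[OF u])
  have tc: "continuous_on {0..t} (traj u)" by (rule traj_continuous[OF u]) (use s in auto)
  have t0: "traj u 0 = 0" using traj_eq[OF u, of 0] T0_pos by simp
  have yc: "continuous_on {0..s + t} y"
  proof -
    have "continuous_on ({0..s} \<union> {s..s + t}) y"
      unfolding y_def
      by (rule continuous_on_cases) (auto simp: t0 intro!: continuous_on_compose2[OF tc] continuous_intros)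
    moreover have "{0..s} \<union> {s..s + t} = {0..s + t}" using s by auto
    ultimately show ?thesis by simp
  qed
  let ?f = "\<lambda>q. field (y q) (\<lambda>i. delayed s u i q)"
  have 0: "(?f has_integral 0) {0..r}" if "r \<le> s" for r
  proof (rule has_integral_spike[where S="{s}" and f="\<lambda>_. 0"])
    show "?f q = 0" if "q \<in> {0..r} - {s}" for q
      using that \<open>r \<le> s\<close> by (auto simp: field_def y_def delayed_def F0)
  qed auto
  have "integral_solution (s + t) (delayed s u) y"
    unfolding integral_solution_def
  proof (intro conjI yc ballI)
    fix r assume r: "r \<in> {0..s + t}"
    show "y r = integral {0..r} ?f"
    proof (cases "r \<le> s")
      case True
      then show ?thesis using integral_unique[OF 0[OF True]] by (simp add: y_def)
    next
      case False
      have ri: "?f integrable_on {0..r}"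
        by (rule bm_integrable[OF bm_field[OF du yc]]) (use r in auto)
      have "integral {0..r} ?f = integral {0..s} ?f + integral {s..r} ?f"
        using Henstock_Kurzweil_Integration.integral_combine[OF _ _ ri, of s] False s by simp
      also have "integral {0..s} ?f = 0" using integral_unique[OF 0[of s]] by simp
      also have "integral {s..r} ?f = integral {0..r - s} (?f \<circ> (+) s)"
        by (simp add: integral_shift_Icc_real)
      also have "\<dots> = integral {0..r - s} (\<lambda>q. field (traj u q) (\<lambda>i. u i q))"
        by (rule integral_cong) (auto simp: y_def delayed_def t0)
      also have "\<dots> = traj u (r - s)"
        by (rule traj_eq[OF u, symmetric]) (use r False s in auto)
      finally show ?thesis using False by (simp add: y_def)
    qed
  qed
  from integral_solution_unique[OF du s(3) this, of "s + t"] have "y (s + t) = traj (delayed s u) (s + t)"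
    using s by simp
  then show ?thesis using s t0 by (auto simp: y_def split: if_splits)
qed

lemma support_growth:
  assumes \<zeta>: "norm \<zeta> = 1" and s: "0 \<le> s" "0 \<le> t" "s + t \<le> T0"
  shows "\<zeta> \<bullet> traj (opt t \<zeta>) t + (c0 / 2) * s\<^sup>2 \<le> \<zeta> \<bullet> traj (opt (s + t) \<zeta>) (s + t)"
proof -
  let ?v = "opt (s + t) \<zeta>" and ?w = "delayed s (opt t \<zeta>)"
  have tT: "t \<le> T0" using s by simp
  have st: "0 \<le> s + t" using s by simp
  have u: "opt t \<zeta> \<in> controls" by (rule opt_control[OF \<zeta> s(2) tT])
  have w: "?w \<in> controls" by (rule delayed_in_controls[OF u])
  have v: "?v \<in> controls" by (rule opt_control[OF \<zeta> st s(3)])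
  \<comment> \<open>During the wait \<open>?w\<close> is 0 while each component of \<open>?v\<close>
    has modulus 1 almost everywhere, so the integrand is at least the indicator of
    \<open>{0..s}\<close>. The time \<open>s\<close> itself is left out because
    \<open>delayed\<close> already runs \<open>u\<close> there.\<close>
  have "s \<le> control_dist (s + t) ?w ?v"
  proof -
    let ?k = "\<lambda>r. if r \<in> {0..s} then 1 else 0 :: real"
    let ?h = "\<lambda>r. \<Sum>i\<in>UNIV. \<bar>?w i r - ?v i r\<bar>"
    have k: "(?k has_integral s) {0..s + t}"
      using has_integral_const_real[of "1::real" 0 s] s by (subst has_integral_restrict) auto
    have "?k \<in> borel_measurable lebesgue" by (rule measurable_If_set) auto
    then have bk: "bounded_measurable (s + t) ?k"
      by (intro bounded_measurableI[where C=1] measurable_restrict_space1) auto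
    have bh: "bounded_measurable (s + t) ?h" by (rule bm_control_sum[OF w v])
    have "integral\<^sup>L (lebesgue_on {0..s + t}) ?k \<le> integral\<^sup>L (lebesgue_on {0..s + t}) ?h"
    proof (rule integral_mono_AE[OF bm_lebesgue_integral(1)[OF bk] bm_lebesgue_integral(1)[OF bh]])
      show "AE r in lebesgue_on {0..s + t}. ?k r \<le> ?h r"
        using opt_abs_1[OF \<zeta> st s(3)] AE_lebesgue_on_neq[of "{0..s + t}" s, simplified]
      proof eventually_elim
        case (elim r)
        show ?case
        proof (cases "r \<in> {0..s}")
          case True
          then have "?h r = real CARD('m)" using elim by (simp add: delayed_def)
          then show ?thesis using True CARD_ge by simp
        next
          case False
          then have "?k r = 0" by simp
          also have "0 \<le> ?h r" by (intro sum_nonneg) auto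
          finally show ?thesis .
        qed
      qed
    qed
    then show ?thesis
      unfolding bm_lebesgue_integral(2)[OF bk] bm_lebesgue_integral(2)[OF bh] integral_unique[OF k] control_dist_def .
  qed
  then have "(c0 / 2) * s\<^sup>2 \<le> (c0 / 2) * (control_dist (s + t) ?w ?v)\<^sup>2"
    using c0_pos s by (intro mult_left_mono power_mono) auto
  then show ?thesis
    using opt_gap[OF \<zeta> st s(3) w] traj_delayed[OF u s] by simp
qed

text \<open>In every direction the support value rises by at least \<open>(c0 / 2) * s^2\<close>, so
  a smaller displacement from a reachable point stays strictly below all support values at the later
  time.\<close>

lemma reach_growth:
  assumes x: "x \<in> reach t" and s: "0 \<le> s" "0 \<le> t" "s + t \<le> T0" and z: "norm (z - x) < (c0 / 2) * s\<^sup>2"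
  shows "z \<in> reach (s + t)"
proof (rule below_support_in_reach)
  fix \<zeta> :: 'a assume \<zeta>: "norm \<zeta> = 1"
  have "0 \<le> gam * (norm (x - traj (opt t \<zeta>) t))\<^sup>2" using gam_pos by simp
  then have "\<zeta> \<bullet> x \<le> \<zeta> \<bullet> traj (opt t \<zeta>) t"
    using reach_strong_support[OF \<zeta> s(2) _ x] s by (simp add: inner_diff_right)
  moreover have "\<zeta> \<bullet> z \<le> \<zeta> \<bullet> x + norm (z - x)"
    using norm_cauchy_schwarz[of \<zeta> "z - x"] \<zeta> by (simp add: inner_diff_right)
  ultimately show "\<zeta> \<bullet> z < \<zeta> \<bullet> traj (opt (s + t) \<zeta>) (s + t)"
    using support_growth[OF \<zeta> s] z by linarith
qed (use s in auto)

lemma zero_in_reach: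
  assumes "0 \<le> t" "t \<le> T0"
  shows "0 \<in> reach t"
proof -
  have "integral_solution T0 (\<lambda>_ _. 0) (\<lambda>_. 0)"
    unfolding integral_solution_def by (auto simp: field_def F0)
  from integral_solution_unique[OF zero_in_controls order_refl this, of t] have "traj (\<lambda>_ _. 0) t = 0"
    using assms by simp
  then show ?thesis unfolding reach_def using zero_in_controls by (metis image_eqI)
qed

lemma ball_subset_reach:
  assumes "0 \<le> \<tau>" "\<tau> \<le> T0"
  shows "ball 0 ((c0 / 2) * \<tau>\<^sup>2) \<subseteq> reach \<tau>"
  using reach_growth[OF zero_in_reach[of 0], of \<tau>] assms T0_pos by auto

lemma reach_bounded:
  assumes "x \<in> reach \<tau>" "0 \<le> \<tau>" "\<tau> \<le> T0"
  shows "norm x \<le> K * \<tau>"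
  using assms traj_norm_le unfolding reach_def by auto

text \<open>The ball around the origin gives nonempty interior, so a frontier point lies outside the
  relative interior and has a supporting hyperplane. The maximizer in its normal direction is unique
  and must be that point.\<close>

lemma frontier_reach:
  assumes x: "x \<in> frontier (reach \<tau>)" and tau: "0 < \<tau>" "\<tau> \<le> T0"
  obtains \<zeta> where "norm \<zeta> = 1" "x = traj (opt \<tau> \<zeta>) \<tau>"
proof -
  have tau': "0 \<le> \<tau>" using tau by simp
  have cl: "closed (reach \<tau>)" "convex (reach \<tau>)" by (rule reach_closed_convex[OF tau' tau(2)])+
  have "ball 0 ((c0 / 2) * \<tau>\<^sup>2) \<subseteq> interior (reach \<tau>)"
    by (rule interior_maximal[OF ball_subset_reach[OF tau' tau(2)]]) simp
  moreover have "0 \<in> ball (0::'a) ((c0 / 2) * \<tau>\<^sup>2)" using tau c0_pos by simp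
  ultimately have "interior (reach \<tau>) \<noteq> {}" by blast
  then have "rel_interior (reach \<tau>) = interior (reach \<tau>)" by (rule rel_interior_nonempty_interior)
  then have "x \<in> closure (reach \<tau>)" "x \<notin> rel_interior (reach \<tau>)" using x unfolding frontier_def by auto
  then obtain a where a: "a \<noteq> 0" "\<And>y. y \<in> closure (reach \<tau>) \<Longrightarrow> a \<bullet> x \<le> a \<bullet> y"
    using supporting_hyperplane_relative_frontier[OF cl(2)] by metis
  have xr: "x \<in> reach \<tau>" using \<open>x \<in> closure (reach \<tau>)\<close> cl(1) by simp
  \<comment> \<open>The supporting functional \<open>a\<close> is minimal at \<open>x\<close>, hence
    the sign.\<close>
  define \<zeta> where "\<zeta> = - ((1 / norm a) *\<^sub>R a)"
  have \<zeta>: "norm \<zeta> = 1" unfolding \<zeta>_def using a(1) by simp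
  have "a \<bullet> x \<le> a \<bullet> traj (opt \<tau> \<zeta>) \<tau>"
    using a(2) closure_subset opt_in_reach[OF \<zeta> tau' tau(2)] by blast
  then have "\<zeta> \<bullet> traj (opt \<tau> \<zeta>) \<tau> \<le> \<zeta> \<bullet> x"
    unfolding \<zeta>_def[symmetric] by (subst (1 2) \<zeta>_def) (use a(1) in \<open>simp add: divide_right_mono\<close>)
  then show thesis using that[OF \<zeta>] support_point_unique[OF \<zeta> tau' tau(2) xr] by blast
qed

text \<open>A frontier point inside a segment would be a unique maximizer in some direction, with
  both end points of the segment strictly below it, yet it is a convex combination of them.\<close>

lemma strictly_convex_reach:
  assumes tau: "0 < \<tau>" "\<tau> \<le> T0"
  shows "strictly_convex (reach \<tau>)"
  unfolding strictly_convex_def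
proof (intro ballI impI subsetI)
  fix x y z assume x: "x \<in> reach \<tau>" and y: "y \<in> reach \<tau>" and "x \<noteq> y" and z: "z \<in> open_segment x y"
  have tau': "0 \<le> \<tau>" using tau by simp
  have cl: "closed (reach \<tau>)" "convex (reach \<tau>)" by (rule reach_closed_convex[OF tau' tau(2)])+
  obtain u where u: "0 < u" "u < 1" "z = (1 - u) *\<^sub>R x + u *\<^sub>R y"
    using z by (auto simp: in_segment)
  show "z \<in> interior (reach \<tau>)"
  proof (rule ccontr)
    assume "z \<notin> interior (reach \<tau>)"
    moreover have "z \<in> reach \<tau>" using convexD_alt[OF cl(2) x y, of u] u by simp
    ultimately have "z \<in> frontier (reach \<tau>)" unfolding frontier_def using closure_subset by auto
    then obtain \<zeta> where \<zeta>: "norm \<zeta> = 1" "z = traj (opt \<tau> \<zeta>) \<tau>"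
      by (rule frontier_reach[OF _ tau])
    have "z \<noteq> x" "z \<noteq> y" using z by (auto simp: open_segment_def)
    then have "0 < gam * (norm (x - z))\<^sup>2" "0 < gam * (norm (y - z))\<^sup>2" using gam_pos by auto
    then have "\<zeta> \<bullet> (x - z) < 0" "\<zeta> \<bullet> (y - z) < 0"
      using reach_strong_support[OF \<zeta>(1) tau' tau(2) x] reach_strong_support[OF \<zeta>(1) tau' tau(2) y]
      unfolding \<zeta>(2)[symmetric] by linarith+
    then have "(1 - u) * (\<zeta> \<bullet> (x - z)) + u * (\<zeta> \<bullet> (y - z)) < 0"
      using u by (intro add_neg_neg mult_pos_neg) auto
    moreover have "(1 - u) *\<^sub>R (x - z) + u *\<^sub>R (y - z) = 0" using u(3) by (simp add: algebra_simps)
    then have "(1 - u) * (\<zeta> \<bullet> (x - z)) + u * (\<zeta> \<bullet> (y - z)) = 0"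
      by (metis inner_add_right inner_scaleR_right inner_zero_right)
    ultimately show False by simp
  qed
qed

text \<open>By convexity a proximal normal is an ordinary outward normal, so \<open>x1\<close>
  maximizes its direction and is the end point of the corresponding \<open>opt\<close>; the strong
  support inequality is then scaled by \<open>norm v\<close>.\<close>

lemma proximal_normal_reach:
  assumes tau: "0 < \<tau>" "\<tau> \<le> T0" and x1: "x1 \<in> frontier (reach \<tau>)" and x2: "x2 \<in> reach \<tau>"
    and v: "v \<in> proximal_normal_cone (reach \<tau>) x1"
  shows "v \<bullet> (x2 - x1) \<le> - gam * norm v * (norm (x2 - x1))\<^sup>2"
proof (cases "v = 0")
  case False
  have tau': "0 \<le> \<tau>" using tau by simp
  have cl: "closed (reach \<tau>)" "convex (reach \<tau>)" by (rule reach_closed_convex[OF tau' tau(2)])+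
  have x1r: "x1 \<in> reach \<tau>" using x1 cl(1) by (auto simp: frontier_def)
  define \<zeta> where "\<zeta> = (1 / norm v) *\<^sub>R v"
  have \<zeta>: "norm \<zeta> = 1" unfolding \<zeta>_def using False by simp
  have v\<zeta>: "v = norm v *\<^sub>R \<zeta>" unfolding \<zeta>_def using False by simp
  have "v \<bullet> (traj (opt \<tau> \<zeta>) \<tau> - x1) \<le> 0"
    by (rule proximal_normal_convex[OF cl(2) x1r opt_in_reach[OF \<zeta> tau' tau(2)] v])
  then have "\<zeta> \<bullet> traj (opt \<tau> \<zeta>) \<tau> \<le> \<zeta> \<bullet> x1"
    by (subst (asm) v\<zeta>) (use False in \<open>simp add: inner_diff_right mult_le_0_iff\<close>)
  then have x1e: "x1 = traj (opt \<tau> \<zeta>) \<tau>" by (rule support_point_unique[OF \<zeta> tau' tau(2) x1r])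
  have "\<zeta> \<bullet> (x2 - x1) \<le> - gam * (norm (x2 - x1))\<^sup>2"
    using reach_strong_support[OF \<zeta> tau' tau(2) x2] unfolding x1e[symmetric] .
  then have "norm v * (\<zeta> \<bullet> (x2 - x1)) \<le> norm v * (- gam * (norm (x2 - x1))\<^sup>2)"
    by (intro mult_left_mono) auto
  moreover have "v \<bullet> (x2 - x1) = norm v * (\<zeta> \<bullet> (x2 - x1))"
    by (subst v\<zeta>) simp
  ultimately show ?thesis by (simp add: mult_ac)
qed simp

end

lemma positive_reach_convex:
  fixes S :: "'a::euclidean_space set"
  assumes "closed S" "convex S" "S \<noteq> {}"
  shows "positive_reach S"
  unfolding positive_reach_def
proof (intro conjI exI[of _ "1::real"] allI impI)
  fix x
  show "\<exists>!p. p \<in> S \<and> dist x p = infdist x S"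
  proof (rule ex1I)
    show "closest_point S x \<in> S \<and> dist x (closest_point S x) = infdist x S"
      using closest_point_in_set[OF assms(1,3), of x] setdist_closest_point[OF assms(1,3), of x]
      by (simp add: infdist_eq_setdist)
  next
    fix p assume p: "p \<in> S \<and> dist x p = infdist x S"
    show "p = closest_point S x"
      by (rule closest_point_unique[OF assms(2,1)]) (use p infdist_le[of _ S x] in auto)
  qed
qed (use assms in auto)

section \<open>Admissible controls and time reversal\<close>

definition control_vec :: "('m::finite \<Rightarrow> real \<Rightarrow> real) \<Rightarrow> real \<Rightarrow> real^'m" where
  "control_vec u t = (\<chi> i. u i t)"

lemma control_vec_nth [simp]: "control_vec u t $ i = u i t"
  by (simp add: control_vec_def)

lemma control_vec_admissible:
  fixes u :: "'m::finite \<Rightarrow> real \<Rightarrow> real"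
  assumes u: "u \<in> controls"
  shows "admissible S (control_vec u)"
proof -
  have "control_vec u \<in> borel_measurable lebesgue"
  proof (subst borel_measurable_euclidean_space, intro ballI)
    fix b :: "real^'m" assume "b \<in> Basis"
    then obtain i where "b = axis i 1" by (auto simp: Basis_vec_def)
    then show "(\<lambda>t. control_vec u t \<bullet> b) \<in> borel_measurable lebesgue"
      using controls_measurable[OF u] by (simp add: inner_axis)
  qed
  moreover have "-1 \<le> u i t" "u i t \<le> 1" for i t using controls_abs_le[OF u, of i t] by auto
  ultimately show ?thesis
    unfolding admissible_def by (auto intro: measurable_restrict_space1)
qed

lemma AE_lebesgue_on_negligible:
  fixes S :: "real set"
  assumes "AE t in lebesgue_on S. P t" "S \<in> sets lebesgue"
  obtains N where "negligible N" "\<And>t. t \<in> S \<Longrightarrow> t \<notin> N \<Longrightarrow> P t"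
proof -
  have "AE t in lebesgue. t \<in> S \<longrightarrow> P t" using assms by (simp add: AE_restrict_space_iff)
  then obtain N where N: "\<And>t. t \<in> space lebesgue - N \<Longrightarrow> t \<in> S \<longrightarrow> P t" "N \<in> null_sets lebesgue"
    by (rule AE_E3) blast
  show thesis
    by (rule that[of N]) (use N in \<open>auto simp: negligible_iff_null_sets\<close>)
qed

lemma is_solution_cong_AE:
  assumes ae: "AE t in lebesgue_on {0..\<tau>}. u t = v t" and sol: "is_solution F G u x \<tau> y"
  shows "is_solution F G v x \<tau> y"
proof -
  obtain N where N: "negligible N" "\<And>t. t \<in> {0..\<tau>} \<Longrightarrow> t \<notin> N \<Longrightarrow> u t = v t"
    by (rule AE_lebesgue_on_negligible[OF ae]) auto
  have "((\<lambda>s. F (y s) + G (y s) *v v s) has_integral (y t - x)) {0..t}" if "t \<in> {0..\<tau>}" for t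
  proof (rule has_integral_spike[OF N(1)])
    show "((\<lambda>s. F (y s) + G (y s) *v u s) has_integral (y t - x)) {0..t}"
      using sol that unfolding is_solution_def by blast
  qed (use N(2) that in auto)
  then show ?thesis using sol unfolding is_solution_def by blast
qed

lemma steers_cong_AE:
  "AE t in lebesgue_on {0..\<tau>}. u t = v t \<Longrightarrow> steers F G u x \<tau> z \<Longrightarrow> steers F G v x \<tau> z"
  unfolding steers_def using is_solution_cong_AE by blast

text \<open>Clamping alters the control on \<open>{0..\<tau>}\<close> only on the null set where its
  bounds fail, and extension by 0 makes it a control on the whole line.\<close>

lemma admissible_representative:
  fixes u :: "real \<Rightarrow> real^'m"
  assumes "admissible {0..\<tau>} u"
  obtains v where "v \<in> controls" "AE t in lebesgue_on {0..\<tau>}. u t = control_vec v t"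
proof -
  define v where "v i t = max (-1) (min 1 (if t \<in> {0..\<tau>} then u t $ i else 0))" for i t
  have v: "v \<in> controls"
  proof (rule controlsI)
    fix i
    have "u \<in> borel_measurable (lebesgue_on {0..\<tau>})" using assms unfolding admissible_def by blast
    then have "(\<lambda>t. u t $ i) \<in> borel_measurable (lebesgue_on {0..\<tau>})"
      by (rule measurable_compose) (intro borel_measurable_continuous_onI continuous_intros)
    then have "(\<lambda>t. if t \<in> {0..\<tau>} then u t $ i else 0) \<in> borel_measurable lebesgue"
      by (rule borel_measurable_if_I) simp
    then show "v i \<in> borel_measurable lebesgue"
      unfolding v_def by (intro borel_measurable_max borel_measurable_min borel_measurable_const)
  qed (auto simp: v_def)
  have "AE t in lebesgue_on {0..\<tau>}. \<forall>i. u t $ i \<in> {-1..1}" using assms unfolding admissible_def by blast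
  then have "AE t in lebesgue_on {0..\<tau>}. u t = control_vec v t"
    by (rule lebesgue_on_mono) (auto simp: vec_eq_iff v_def)
  then show thesis using that v by blast
qed

lemma reachable_eq:
  fixes G :: "real^'n \<Rightarrow> real^'m^'n"
  shows "reachable F G \<tau> = {z. \<exists>u\<in>controls. steers F G (control_vec u) 0 \<tau> z}"
proof (intro set_eqI iffI; clarsimp)
  fix z assume "z \<in> reachable F G \<tau>"
  then obtain u where u: "admissible {0..\<tau>} u" "steers F G u 0 \<tau> z" unfolding reachable_def by blast
  then show "\<exists>u\<in>controls. steers F G (control_vec u) 0 \<tau> z"
    using admissible_representative[OF u(1)] steers_cong_AE[OF _ u(2)] by metis
next
  fix z and u :: "'m \<Rightarrow> real \<Rightarrow> real" assume "u \<in> controls" "steers F G (control_vec u) 0 \<tau> z"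
  then show "z \<in> reachable F G \<tau>" unfolding reachable_def using control_vec_admissible by blast
qed

section \<open>Time reversal and the minimum time\<close>

lemma has_integral_reverse:
  fixes f :: "real \<Rightarrow> 'a::real_normed_vector"
  assumes "(f has_integral I) {t - r..t}"
  shows "((\<lambda>s. f (t - s)) has_integral I) {0..r}"
proof -
  have "((\<lambda>s. f (- s)) has_integral I) {-t..- (t - r)}"
    using assms by (simp only: has_integral_reflect_real)
  then have "((\<lambda>s. f (- s)) has_integral I) {0 + (-t)..r + (-t)}" by simp
  then have "((\<lambda>s. f (- s)) \<circ> (+) (-t) has_integral I) {0..r}"
    by (simp only: has_integral_shift_Icc_real)
  then show ?thesis by (simp add: o_def)
qed

lemma is_solution_reverse:
  assumes t: "0 \<le> t" and sol: "is_solution F G u x t y"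
  shows "is_solution (\<lambda>x. - F x) (\<lambda>x. - G x) (\<lambda>s. u (t - s)) (y t) t (\<lambda>s. y (t - s))"
    and "y 0 = x"
proof -
  have c: "continuous_on {0..t} y"
    and i: "\<And>r. r \<in> {0..t} \<Longrightarrow> ((\<lambda>s. F (y s) + G (y s) *v u s) has_integral (y r - x)) {0..r}"
    using sol unfolding is_solution_def by auto
  have "((\<lambda>s. F (y s) + G (y s) *v u s) has_integral (y 0 - x)) {0}" using i[of 0] t by simp
  then have "y 0 - x = 0" by (rule has_integral_unique[OF _ has_integral_refl(2)])
  then show "y 0 = x" by simp
  have "((\<lambda>s. - F (y (t - s)) + (- G (y (t - s))) *v u (t - s)) has_integral (y (t - r) - y t)) {0..r}"
    if r: "r \<in> {0..t}" for r
  proof -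
    let ?f = "\<lambda>s. F (y s) + G (y s) *v u s"
    have "?f integrable_on {0..t}" using i[of t] t by auto
    then have "?f integrable_on {t - r..t}" by (rule integrable_on_subinterval) (use r in auto)
    then obtain I where I: "(?f has_integral I) {t - r..t}" by blast
    have "(?f has_integral (y (t - r) - x + I)) {0..t}"
      by (rule has_integral_combine[OF _ _ i I]) (use r in auto)
    then have "y (t - r) - x + I = y t - x" by (rule has_integral_unique) (use i[of t] t in simp)
    then have "- I = y (t - r) - y t" by (simp add: algebra_simps)
    moreover have "((\<lambda>s. - ?f (t - s)) has_integral - I) {0..r}"
      by (rule has_integral_neg[OF has_integral_reverse[OF I]])
    moreover have "(- M) *v w = - (M *v w)" for M :: "real^'b^'a" and w
      by (simp add: vec_eq_iff matrix_vector_mult_def sum_negf)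
    ultimately show ?thesis by simp
  qed
  moreover have "continuous_on {0..t} (\<lambda>s. y (t - s))"
    by (rule continuous_on_compose2[OF c]) (auto intro!: continuous_intros)
  ultimately show "is_solution (\<lambda>x. - F x) (\<lambda>x. - G x) (\<lambda>s. u (t - s)) (y t) t (\<lambda>s. y (t - s))"
    unfolding is_solution_def by blast
qed

lemma steers_reverse:
  assumes "0 \<le> t" "steers F G u x t z"
  shows "steers (\<lambda>x. - F x) (\<lambda>x. - G x) (\<lambda>s. u (t - s)) z t x"
proof -
  obtain y where y: "is_solution F G u x t y" "y t = z" using assms unfolding steers_def by blast
  show ?thesis
    unfolding steers_def using is_solution_reverse[OF assms(1) y(1)] y(2)
    by (intro exI[of _ "\<lambda>s. y (t - s)"]) simp
qed

lemma controls_reverse: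
  assumes "u \<in> controls"
  shows "(\<lambda>i s. u i (t - s)) \<in> controls"
proof (rule controlsI)
  have "(\<lambda>s. t - s) \<in> lebesgue \<rightarrow>\<^sub>M lebesgue"
    using lebesgue_measurable_affine[of "-1" t] by simp
  then show "(\<lambda>s. u i (t - s)) \<in> borel_measurable lebesgue" for i
    using controls_measurable[OF assms] by (rule measurable_compose)
qed (use controls_abs_le[OF assms] in auto)

text \<open>Traversed backwards, a trajectory from \<open>x\<close> to the origin is one from the
  origin to \<open>x\<close> for the system with both fields negated. Elements of
  \<open>controls\<close> live on the whole line, so the reversed control is admissible on all of
  \<open>{0..}\<close>, as the minimum time demands.\<close>

lemma steers_to_0_iff:
  fixes G :: "real^'n \<Rightarrow> real^'m^'n"
  assumes t: "0 \<le> t"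
  shows "(\<exists>u\<in>{u. admissible {0..} u}. steers F G u x t 0) \<longleftrightarrow>
    x \<in> reachable (\<lambda>x. - F x) (\<lambda>x. - G x) t"
proof
  assume "\<exists>u\<in>{u. admissible {0..} u}. steers F G u x t 0"
  then obtain u where u: "admissible {0..} u" "steers F G u x t 0" by blast
  have sub: "{0..t} \<subseteq> {0..}" by auto
  have "admissible {0..t} u"
    unfolding admissible_def
  proof
    show "u \<in> borel_measurable (lebesgue_on {0..t})"
      using u(1) sub unfolding admissible_def by (blast intro: measurable_restrict_mono)
    show "AE s in lebesgue_on {0..t}. \<forall>i. u s $ i \<in> {-1..1}"
      using u(1) unfolding admissible_def by (auto simp: AE_restrict_space_iff elim: eventually_mono)
  qed
  then obtain v where v: "v \<in> controls" "AE s in lebesgue_on {0..t}. u s = control_vec v s"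
    by (rule admissible_representative)
  have "steers F G (control_vec v) x t 0" by (rule steers_cong_AE[OF v(2) u(2)])
  from steers_reverse[OF t this]
  have "steers (\<lambda>x. - F x) (\<lambda>x. - G x) (control_vec (\<lambda>i s. v i (t - s))) 0 t x"
    by (simp add: control_vec_def[abs_def])
  then show "x \<in> reachable (\<lambda>x. - F x) (\<lambda>x. - G x) t"
    unfolding reachable_eq using controls_reverse[OF v(1)] by blast
next
  assume "x \<in> reachable (\<lambda>x. - F x) (\<lambda>x. - G x) t"
  then obtain v where v: "v \<in> controls" "steers (\<lambda>x. - F x) (\<lambda>x. - G x) (control_vec v) 0 t x"
    unfolding reachable_eq by blast
  from steers_reverse[OF t this(2)]
  have "steers F G (control_vec (\<lambda>i s. v i (t - s))) x t 0"
    by (simp add: control_vec_def[abs_def])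
  then show "\<exists>u\<in>{u. admissible {0..} u}. steers F G u x t 0"
    using control_vec_admissible[OF controls_reverse[OF v(1)]] by blast
qed

lemma minimum_time_eq:
  "minimum_time F G x =
    (INF t\<in>{t. 0 \<le> t \<and> x \<in> reachable (\<lambda>x. - F x) (\<lambda>x. - G x) t}. ereal t)"
proof (rule antisym)
  show "minimum_time F G x \<le> (INF t\<in>{t. 0 \<le> t \<and> x \<in> reachable (\<lambda>x. - F x) (\<lambda>x. - G x) t}. ereal t)"
  proof (rule INF_greatest)
    fix t assume "t \<in> {t. 0 \<le> t \<and> x \<in> reachable (\<lambda>x. - F x) (\<lambda>x. - G x) t}"
    then obtain u where u: "0 \<le> t" "admissible {0..} u" "steers F G u x t 0"
      using steers_to_0_iff[of t F G x] by blast
    show "minimum_time F G x \<le> ereal t"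
      unfolding minimum_time_def
      by (rule INF_lower2[of u], use u in simp, rule INF_lower) (use u in auto)
  qed
  show "(INF t\<in>{t. 0 \<le> t \<and> x \<in> reachable (\<lambda>x. - F x) (\<lambda>x. - G x) t}. ereal t) \<le> minimum_time F G x"
    unfolding minimum_time_def
  proof (intro INF_greatest)
    fix u t assume "u \<in> {u. admissible {0..} u}" "t \<in> {t. 0 \<le> t \<and> steers F G u x t 0}"
    then have "t \<in> {t. 0 \<le> t \<and> x \<in> reachable (\<lambda>x. - F x) (\<lambda>x. - G x) t}"
      using steers_to_0_iff[of t F G x] by blast
    then show "(INF t\<in>{t. 0 \<le> t \<and> x \<in> reachable (\<lambda>x. - F x) (\<lambda>x. - G x) t}. ereal t) \<le> ereal t"
      by (rule INF_lower)
  qed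
qed

section \<open>The reachable sets of an affine control system\<close>

locale affine_control_system = control_system F "\<lambda>i x. column i (G x)" DF Dg K0 \<kappa>
  for F :: "real^'n \<Rightarrow> real^'n" and G :: "real^'n \<Rightarrow> real^'m^'n" and DF Dg K0 \<kappa>
begin

lemma field_eq: "F x + G x *v v = field x (\<lambda>i. v $ i)"
  unfolding field_def by (simp add: matrix_mult_sum scalar_mult_eq_scaleR)

lemma is_solution_iff:
  assumes u: "u \<in> controls"
  shows "is_solution F G (control_vec u) 0 \<tau> y \<longleftrightarrow> integral_solution \<tau> u y"
proof -
  have eq: "(\<lambda>s. F (y s) + G (y s) *v control_vec u s) = (\<lambda>s. field (y s) (\<lambda>i. u i s))"
    by (simp add: field_eq)
  have "((\<lambda>s. field (y s) (\<lambda>i. u i s)) has_integral (y t - 0)) {0..t} \<longleftrightarrow>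
      y t = integral {0..t} (\<lambda>s. field (y s) (\<lambda>i. u i s))"
    if "continuous_on {0..\<tau>} y" "t \<in> {0..\<tau>}" for t
  proof -
    have "(\<lambda>s. field (y s) (\<lambda>i. u i s)) integrable_on {0..t}"
      by (rule bm_integrable[OF bm_field[OF u that(1)]]) (use that(2) in auto)
    then show ?thesis by (auto simp: has_integral_integrable_integral)
  qed
  then show ?thesis unfolding is_solution_def integral_solution_def eq by blast
qed

lemma steers_iff:
  assumes u: "u \<in> controls" and tau: "0 \<le> \<tau>" "\<tau> \<le> T0"
  shows "steers F G (control_vec u) 0 \<tau> z \<longleftrightarrow> z = traj u \<tau>"
proof
  assume "steers F G (control_vec u) 0 \<tau> z"
  then obtain y where "integral_solution \<tau> u y" "y \<tau> = z"
    unfolding steers_def is_solution_iff[OF u] by blast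
  then show "z = traj u \<tau>" using integral_solution_unique[OF u tau(2), of y \<tau>] tau by auto
next
  assume "z = traj u \<tau>"
  moreover have "integral_solution \<tau> u (traj u)"
    using traj_solution[OF u] tau unfolding integral_solution_def by (auto intro: continuous_on_subset[of "{0..T0}"])
  ultimately show "steers F G (control_vec u) 0 \<tau> z"
    unfolding steers_def is_solution_iff[OF u] by blast
qed

lemma reachable_eq_reach:
  assumes "0 \<le> \<tau>" "\<tau> \<le> T0"
  shows "reachable F G \<tau> = reach \<tau>"
  unfolding reachable_eq reach_def using steers_iff[OF _ assms] by auto

text \<open>A second control with the same end point has the same payoff, so the gap puts it at
  distance 0 from the maximizer. Each switching function vanishes at most at its point
  \<open>s0 i\<close>, so its sign can change only there: one switching per component.\<close>

lemma unique_bang_bang_control: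
  assumes tau: "0 < \<tau>" "\<tau> \<le> T0" and x: "x \<in> frontier (reachable F G \<tau>)"
  shows "\<exists>u. admissible {0..\<tau>} u \<and> steers F G u 0 \<tau> x \<and> bang_bang \<tau> u \<and> finitely_many_switchings \<tau> u \<and>
     (\<forall>v. admissible {0..\<tau>} v \<and> steers F G v 0 \<tau> x \<longrightarrow> (AE t in lebesgue_on {0..\<tau>}. v t = u t))"
proof -
  have tau': "0 \<le> \<tau>" using tau by simp
  obtain \<zeta> where \<zeta>: "norm \<zeta> = 1" "x = traj (opt \<tau> \<zeta>) \<tau>"
    using frontier_reach[OF _ tau] x unfolding reachable_eq_reach[OF tau' tau(2)] by metis
  let ?u = "opt \<tau> \<zeta>"
  have u: "?u \<in> controls" by (rule opt_control[OF \<zeta>(1) tau' tau(2)])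
  obtain \<sigma> :: "'m \<Rightarrow> real \<Rightarrow> real" and s0 where \<sigma>:
    "\<And>i. continuous_on {0..\<tau>} (\<sigma> i)" "\<And>i s. s \<in> {0..\<tau>} \<Longrightarrow> s \<noteq> s0 i \<Longrightarrow> \<sigma> i s \<noteq> 0"
    "AE t in lebesgue_on {0..\<tau>}. \<forall>i. ?u i t = sgn (\<sigma> i t)"
    by (rule opt_bang_bang[OF \<zeta>(1) tau' tau(2)]) blast
  have "bang_bang \<tau> (control_vec ?u)"
    unfolding bang_bang_def
    by (rule lebesgue_on_mono[OF opt_abs_1[OF \<zeta>(1) tau' tau(2)]]) (auto simp: abs_eq_iff')
  moreover have "finitely_many_switchings \<tau> (control_vec ?u)"
    unfolding finitely_many_switchings_def
  proof (intro exI[of _ "control_vec (\<lambda>i t. sgn (\<sigma> i t))"] exI[of _ "range s0"] conjI allI impI)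
    show "AE t in lebesgue_on {0..\<tau>}. control_vec ?u t = control_vec (\<lambda>i t. sgn (\<sigma> i t)) t"
      by (rule lebesgue_on_mono[OF \<sigma>(3)]) (auto simp: vec_eq_iff)
    fix a b assume ab: "a \<le> b \<and> {a..b} \<subseteq> {0..\<tau>} - range s0"
    have "sgn (\<sigma> i a) = sgn (\<sigma> i b)" for i
    proof (rule ccontr)
      assume ne: "sgn (\<sigma> i a) \<noteq> sgn (\<sigma> i b)"
      have nz: "\<sigma> i s \<noteq> 0" if "s \<in> {a..b}" for s
      proof -
        have "s \<in> {0..\<tau>} - range s0" using ab that by blast
        then show ?thesis using \<sigma>(2)[of s i] by blast
      qed
      have c: "continuous_on {a..b} (\<sigma> i)" by (rule continuous_on_subset[OF \<sigma>(1)]) (use ab in auto)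
      have "\<exists>s\<in>{a..b}. \<sigma> i s = 0"
      proof (cases "\<sigma> i a < 0")
        case True
        then have "0 \<le> \<sigma> i b" using ne by (auto simp: sgn_if split: if_splits)
        then show ?thesis using IVT'[of "\<sigma> i" a 0 b] True ab c by auto
      next
        case False
        moreover have "\<sigma> i a \<noteq> 0" using nz[of a] ab by simp
        ultimately have "\<sigma> i b \<le> 0" using ne by (auto simp: sgn_if split: if_splits)
        then show ?thesis using IVT2'[of "\<sigma> i" b 0 a] False ab c by auto
      qed
      then show False using nz by blast
    qed
    then show "control_vec (\<lambda>i t. sgn (\<sigma> i t)) a = control_vec (\<lambda>i t. sgn (\<sigma> i t)) b"
      by (simp add: vec_eq_iff)
  qed simp
  moreover have "AE t in lebesgue_on {0..\<tau>}. v t = control_vec ?u t"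
    if v: "admissible {0..\<tau>} v" "steers F G v 0 \<tau> x" for v
  proof -
    obtain w where w: "w \<in> controls" "AE t in lebesgue_on {0..\<tau>}. v t = control_vec w t"
      by (rule admissible_representative[OF v(1)])
    have "x = traj w \<tau>"
      using steers_cong_AE[OF w(2) v(2)] steers_iff[OF w(1) tau' tau(2)] by blast
    then have "(c0 / 2) * (control_dist \<tau> w ?u)\<^sup>2 \<le> 0"
      using opt_gap[OF \<zeta>(1) tau' tau(2) w(1)] \<zeta>(2) by simp
    then have "control_dist \<tau> w ?u = 0" using c0_pos by (simp add: mult_le_0_iff)
    then have "AE t in lebesgue_on {0..\<tau>}. \<forall>i. w i t = ?u i t"
      by (rule control_dist_eq_0_imp_AE[OF w(1) u])
    with w(2) show ?thesis by eventually_elim (simp add: vec_eq_iff)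
  qed
  moreover have "steers F G (control_vec ?u) 0 \<tau> x"
    unfolding steers_iff[OF u tau' tau(2)] by (rule \<zeta>(2))
  ultimately show ?thesis using control_vec_admissible[OF u] by blast
qed

end

text \<open>If \<open>norm (z - x) < c * s^2\<close>, each of the two points enters at most
  \<open>s\<close> later than the other, so the infima differ by at most \<open>s\<close>: Hoelder
  continuity with exponent 1/2. Since the infima on \<open>S\<close> are at most
  \<open>T / 2\<close>, enough of the interval remains to apply the growth hypothesis.\<close>

lemma INF_time_continuous_on:
  fixes R :: "real \<Rightarrow> 'a::real_normed_vector set"
  assumes c: "0 < c" and T: "0 < T"
    and growth: "\<And>x z s t. x \<in> R t \<Longrightarrow> 0 \<le> s \<Longrightarrow> 0 \<le> t \<Longrightarrow> s + t \<le> T \<Longrightarrow> norm (z - x) < c * s\<^sup>2 \<Longrightarrow> z \<in> R (s + t)"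
    and S: "S \<subseteq> R (T / 2)"
  shows "continuous_on S (\<lambda>x. INF t\<in>{t. 0 \<le> t \<and> x \<in> R t}. ereal t)"
proof -
  define m where "m x = Inf {t. 0 \<le> t \<and> x \<in> R t}" for x
  have bdd: "bdd_below {t. 0 \<le> t \<and> x \<in> R t}" for x by (rule bdd_belowI[of _ 0]) auto
  have mem: "T / 2 \<in> {t. 0 \<le> t \<and> x \<in> R t}" if "x \<in> S" for x using S T that by auto
  have m_le: "m x \<le> t" if "0 \<le> t" "x \<in> R t" for x t
    unfolding m_def by (rule cInf_lower[OF _ bdd]) (use that in simp)
  have step: "m z \<le> m x + s"
    if x: "x \<in> S" and s: "0 < s" "s \<le> T / 4" and z: "norm (z - x) < c * s\<^sup>2" for x z s
  proof (rule field_le_epsilon)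
    fix e :: real assume "0 < e"
    \<comment> \<open>The infimum may not be attained, so \<open>t\<close> is only nearly minimal.
      Capping the slack at \<open>T / 4\<close> keeps \<open>s + t\<close> below
      \<open>T / 4 + T / 2 + T / 4\<close>.\<close>
    define e' where "e' = min e (T / 4)"
    have e': "0 < e'" "e' \<le> e" "e' \<le> T / 4" using \<open>0 < e\<close> T by (auto simp: e'_def)
    have "m x < m x + e'" using e' by simp
    then obtain t where t: "0 \<le> t" "x \<in> R t" "t < m x + e'"
      unfolding m_def using cInf_less_iff[OF _ bdd] mem[OF x] by blast
    have "m x \<le> T / 2" using mem[OF x] by (intro m_le) auto
    then have "s + t \<le> T" using t(3) s e' by (simp add: field_simps)
    then have "z \<in> R (s + t)" using growth[OF t(2) _ t(1) _ z] s by simp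
    then have "m z \<le> s + t" using m_le[of "s + t" z] s t by simp
    then show "m z \<le> m x + s + e" using t(3) e' by simp
  qed
  have "continuous_on S m"
    unfolding continuous_on_iff
  proof (intro ballI allI impI)
    fix x and e :: real assume x: "x \<in> S" and e: "0 < e"
    define s where "s = min (e / 2) (T / 4)"
    have s: "0 < s" "s \<le> T / 4" "s < e" using e T by (auto simp: s_def)
    show "\<exists>d>0. \<forall>x'\<in>S. dist x' x < d \<longrightarrow> dist (m x') (m x) < e"
    proof (intro exI[of _ "c * s\<^sup>2"] conjI ballI impI)
      fix x' assume x': "x' \<in> S" "dist x' x < c * s\<^sup>2"
      have "m x' \<le> m x + s" "m x \<le> m x' + s"
        using step[OF x s(1,2), of x'] step[OF x'(1) s(1,2), of x] x'(2) by (auto simp: dist_norm norm_minus_commute)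
      then show "dist (m x') (m x) < e" using s(3) by (simp add: dist_real_def abs_le_iff)
    qed (use c s in simp)
  qed
  then have "continuous_on S (\<lambda>x. ereal (m x))" by (rule continuous_on_ereal)
  moreover have "ereal (m x) = (INF t\<in>{t. 0 \<le> t \<and> x \<in> R t}. ereal t)" if "x \<in> S" for x
    unfolding m_def by (rule ereal_Inf'[OF bdd]) (use mem[OF that] in blast)
  ultimately show ?thesis by (rule continuous_on_eq)
qed

section \<open>Taylor estimates for functions with Lipschitz partial derivatives\<close>

lemma C11_line_derivative:
  fixes f :: "'a::real_normed_vector \<Rightarrow> 'b::real_normed_vector"
  assumes "\<And>x. ((\<lambda>h. f (x + h *\<^sub>R a)) has_vector_derivative D x) (at 0)"
  shows "((\<lambda>s. f (x + s *\<^sub>R a)) has_vector_derivative D (x + s *\<^sub>R a)) (at s)"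
proof -
  have 1: "((\<lambda>r. r - s) has_vector_derivative 1) (at s)"
    by (auto intro!: derivative_eq_intros)
  have "((\<lambda>h. f ((x + s *\<^sub>R a) + h *\<^sub>R a)) has_vector_derivative D (x + s *\<^sub>R a)) (at ((\<lambda>r. r - s) s))"
    using assms[of "x + s *\<^sub>R a"] by simp
  from vector_diff_chain_at[OF 1 this]
  have "((\<lambda>r. f ((x + s *\<^sub>R a) + (r - s) *\<^sub>R a)) has_vector_derivative D (x + s *\<^sub>R a)) (at s)"
    by (simp add: o_def)
  moreover have "(x + s *\<^sub>R a) + (r - s) *\<^sub>R a = x + r *\<^sub>R a" for r
    by (simp add: scaleR_left_diff_distrib)
  ultimately show ?thesis by (simp only:)
qed

lemma C11_line_bound:
  fixes f :: "'a::real_normed_vector \<Rightarrow> 'b::real_normed_vector"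
  assumes "\<And>x. ((\<lambda>h. f (x + h *\<^sub>R a)) has_vector_derivative D x) (at 0)"
    and lip: "L-lipschitz_on UNIV D" and a: "norm a = 1"
  shows "norm (f (x + s *\<^sub>R a) - f x - s *\<^sub>R D x) \<le> L * s\<^sup>2"
proof -
  have "norm (f (x + s *\<^sub>R a) - f (x + 0 *\<^sub>R a) - (s - 0) *\<^sub>R D (x + 0 *\<^sub>R a)) \<le> norm (s - 0) * (L * \<bar>s\<bar>)"
  proof (rule vector_differentiable_bound_linearization[where S="closed_segment 0 s"])
    show "((\<lambda>s. f (x + s *\<^sub>R a)) has_vector_derivative D (x + r *\<^sub>R a)) (at r within closed_segment 0 s)" for r
      by (rule has_vector_derivative_at_within[OF C11_line_derivative[OF assms(1)]])
    fix r assume "r \<in> closed_segment 0 s"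
    then have "\<bar>r\<bar> \<le> \<bar>s\<bar>" by (auto simp: closed_segment_eq_real_ivl split: if_splits)
    have "norm (D (x + r *\<^sub>R a) - D (x + 0 *\<^sub>R a)) \<le> L * norm (r *\<^sub>R a)"
      using lipschitz_onD[OF lip, of "x + r *\<^sub>R a" x] by (simp add: dist_norm)
    also have "\<dots> \<le> L * \<bar>s\<bar>"
      using \<open>\<bar>r\<bar> \<le> \<bar>s\<bar>\<close> lipschitz_on_nonneg[OF lip] a by (intro mult_left_mono) auto
    finally show "norm (D (x + r *\<^sub>R a) - D (x + 0 *\<^sub>R a)) \<le> L * \<bar>s\<bar>" .
  qed auto
  also have "norm (s - 0) * (L * \<bar>s\<bar>) = L * (\<bar>s\<bar> * \<bar>s\<bar>)" by simp
  also have "\<dots> = L * s\<^sup>2" by (simp add: power2_eq_square)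
  finally show ?thesis by simp
qed

text \<open>Only partial derivatives are given, so an increment is split into two coordinate steps.
  Each leaves a remainder \<open>L * norm h ^ 2\<close>, and moving the base point of the second
  partial derivative back to \<open>x\<close> costs a third. The estimate yields differentiability
  everywhere, so at 0 the derivative built from the partial ones is \<open>f'\<close>.\<close>

lemma C11_Taylor:
  fixes f :: "real^2 \<Rightarrow> 'b::real_normed_vector"
  assumes C11: "C11 L f" and f': "(f has_derivative f') (at 0)"
  obtains Df where "0 \<le> L" "\<And>x. linear (Df x)" "\<And>h. continuous_on UNIV (\<lambda>x. Df x h)" "\<And>h. Df 0 h = f' h"
    "continuous_on UNIV f"
    "\<And>x x'. norm (f x - f x' - Df x' (x - x')) \<le> 3 * L * (norm (x - x'))\<^sup>2"
    "\<And>x h. norm (Df x h - Df 0 h) \<le> 2 * L * norm x * norm h"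
proof -
  obtain D where D: "\<And>j x. ((\<lambda>h. f (x + h *\<^sub>R axis j 1)) has_vector_derivative D j x) (at 0)"
    "\<And>j. L-lipschitz_on UNIV (D j)"
    using C11 unfolding C11_def by metis
  have L: "0 \<le> L" by (rule lipschitz_on_nonneg[OF D(2)])
  define Df where "Df x h = h $ 1 *\<^sub>R D 1 x + h $ 2 *\<^sub>R D 2 x" for x and h :: "real^2"
  have lin: "linear (Df x)" for x
    unfolding Df_def by (rule linearI) (auto simp: algebra_simps)
  have Dlip: "norm (D j x - D j x') \<le> L * norm (x - x')" for j x x'
    using lipschitz_onD[OF D(2), of x x' j] by (simp add: dist_norm)
  have comp: "\<bar>h $ j\<bar> \<le> norm h" for h :: "real^2" and j by (rule component_le_norm_cart)
  have quad: "norm (f (x + h) - f x - Df x h) \<le> 3 * L * (norm h)\<^sup>2" for x h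
  proof -
    let ?p = "x + h $ 1 *\<^sub>R axis 1 1"
    have h: "x + h = ?p + h $ 2 *\<^sub>R axis 2 1"
      by (simp add: vec_eq_iff forall_2 axis_def)
    have "norm (f ?p - f x - h $ 1 *\<^sub>R D 1 x) \<le> L * (h $ 1)\<^sup>2"
      by (rule C11_line_bound[OF D]) (rule norm_axis_1)
    also have "\<dots> \<le> L * (norm h)\<^sup>2"
      using comp[of h 1] L by (intro mult_left_mono) (auto simp: abs_le_square_iff[symmetric])
    finally have 1: "norm (f ?p - f x - h $ 1 *\<^sub>R D 1 x) \<le> L * (norm h)\<^sup>2" .
    have "norm (f (?p + h $ 2 *\<^sub>R axis 2 1) - f ?p - h $ 2 *\<^sub>R D 2 ?p) \<le> L * (h $ 2)\<^sup>2"
      by (rule C11_line_bound[OF D]) (rule norm_axis_1)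
    also have "\<dots> \<le> L * (norm h)\<^sup>2"
      using comp[of h 2] L by (intro mult_left_mono) (auto simp: abs_le_square_iff[symmetric])
    finally have 2: "norm (f (x + h) - f ?p - h $ 2 *\<^sub>R D 2 ?p) \<le> L * (norm h)\<^sup>2" unfolding h .
    have "norm (h $ 2 *\<^sub>R (D 2 ?p - D 2 x)) \<le> norm h * (L * norm h)"
    proof -
      have "norm (D 2 ?p - D 2 x) \<le> L * \<bar>h $ 1\<bar>" using Dlip[of 2 ?p x] by (simp add: norm_axis_1)
      also have "\<dots> \<le> L * norm h" using comp L by (intro mult_left_mono) auto
      finally show ?thesis unfolding norm_scaleR using comp[of h 2] by (intro mult_mono) auto
    qed
    then have 3: "norm (h $ 2 *\<^sub>R (D 2 ?p - D 2 x)) \<le> L * (norm h)\<^sup>2"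
      by (simp add: power2_eq_square mult_ac)
    have "f (x + h) - f x - Df x h =
      (f ?p - f x - h $ 1 *\<^sub>R D 1 x) + (f (x + h) - f ?p - h $ 2 *\<^sub>R D 2 ?p) + h $ 2 *\<^sub>R (D 2 ?p - D 2 x)"
      unfolding Df_def by (simp add: scaleR_diff_right)
    also have "norm \<dots> \<le> L * (norm h)\<^sup>2 + L * (norm h)\<^sup>2 + L * (norm h)\<^sup>2"
      by (intro norm_triangle_mono 1 2 3)
    finally show ?thesis by simp
  qed
  have quad': "norm (f x - f x' - Df x' (x - x')) \<le> 3 * L * (norm (x - x'))\<^sup>2" for x x'
    using quad[of x' "x - x'"] by simp
  have der: "(f has_derivative Df x) (at x)" for x
  proof (rule has_derivativeI_sandwich[where e=1])
    show "bounded_linear (Df x)" using lin[of x] by (rule linear_conv_bounded_linear[THEN iffD1])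
    show "((\<lambda>y. 3 * L * norm (y - x)) \<longlongrightarrow> 0) (at x)"
      by (rule tendsto_eq_intros refl | simp)+
    fix y assume "y \<noteq> x"
    then show "norm (f y - f x - Df x (y - x)) / norm (y - x) \<le> 3 * L * norm (y - x)"
      using quad'[of y x] by (simp add: divide_simps power2_eq_square mult_ac)
  qed simp
  have Df0: "Df 0 = f'" by (rule has_derivative_unique[OF der f'])
  have Dc: "continuous_on UNIV (D j)" for j by (rule lipschitz_on_continuous_on[OF D(2)])
  show thesis
  proof (rule that[OF L lin])
    show "continuous_on UNIV (\<lambda>x. Df x h)" for h
      unfolding Df_def by (intro continuous_intros Dc)
    show "continuous_on UNIV f"
      using der by (meson continuous_at_imp_continuous_on has_derivative_continuous)
    show "norm (Df x h - Df 0 h) \<le> 2 * L * norm x * norm h" for x h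
    proof -
      have "norm (h $ j *\<^sub>R (D j x - D j 0)) \<le> norm h * (L * norm x)" for j
        unfolding norm_scaleR using comp[of h j] Dlip[of j x 0] by (intro mult_mono) auto
      then have "norm (h $ 1 *\<^sub>R (D 1 x - D 1 0) + h $ 2 *\<^sub>R (D 2 x - D 2 0)) \<le> norm h * (L * norm x) + norm h * (L * norm x)"
        by (intro norm_triangle_mono)
      moreover have "Df x h - Df 0 h = h $ 1 *\<^sub>R (D 1 x - D 1 0) + h $ 2 *\<^sub>R (D 2 x - D 2 0)"
        unfolding Df_def by (simp add: scaleR_diff_right)
      ultimately show ?thesis by (simp add: mult_ac)
    qed
  qed (use Df0 quad' in auto)
qed

lemma norm_column_le:
  fixes M :: "real^'m^'n"
  shows "norm (column i M) \<le> norm M"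
proof -
  have "norm (column i M) = L2_set (\<lambda>k. norm (column i M $ k)) UNIV" by (rule norm_vec_def)
  also have "\<dots> \<le> L2_set (\<lambda>k. norm (M $ k)) UNIV"
    by (rule L2_set_mono) (auto simp: column_def component_le_norm_cart)
  also have "\<dots> = norm M" by (rule norm_vec_def[symmetric])
  finally show ?thesis .
qed

lemma linear_column: "linear (column i :: real^'m^'n \<Rightarrow> real^'n)"
  by (rule linearI) (auto simp: column_def vec_eq_iff)

text \<open>The largest demand of \<open>F\<close> on \<open>K0\<close> is its Lipschitz constant on
  the unit ball: \<open>a + 2 * L\<close> from the derivative and \<open>6 * L\<close> from the
  Taylor remainder, as points are at most 2 apart. For \<open>G\<close> the zero derivative at the
  origin leads to \<open>5 * L * (norm x + norm x')\<close>. The absolute value of \<open>L\<close>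
  appears because \<open>K0\<close> is fixed before any function is given that forces
  \<open>L\<close> to be nonnegative.\<close>

lemma affine_control_system_exists:
  fixes F :: "real^2 \<Rightarrow> real^2" and G :: "real^2 \<Rightarrow> real^'m^2"
  assumes F: "C11 L F" "F 0 = 0" "(F has_derivative (\<lambda>h. A *v h)) (at 0)"
    and G: "C11 L G" "G 0 = B" "(G has_derivative (\<lambda>h. 0)) (at 0)"
    and A: "\<And>h. norm (A *v h) \<le> a * norm h" "0 \<le> a"
    and K0: "K0 = 1 + a + 8 * \<bar>L\<bar> + norm B"
    and kappa: "0 < \<kappa>" "\<And>i \<zeta>. norm \<zeta> = 1 \<Longrightarrow> \<kappa> \<le> \<bar>\<zeta> \<bullet> column i B\<bar> \<or> \<kappa> \<le> \<bar>\<zeta> \<bullet> (A *v column i B)\<bar>"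
  obtains DF Dg where "affine_control_system F G DF Dg K0 \<kappa>"
proof -
  obtain DF where DF: "0 \<le> L" "\<And>x. linear (DF x)" "\<And>h. continuous_on UNIV (\<lambda>x. DF x h)" "\<And>h. DF 0 h = A *v h"
    "continuous_on UNIV F"
    "\<And>x x'. norm (F x - F x' - DF x' (x - x')) \<le> 3 * L * (norm (x - x'))\<^sup>2"
    "\<And>x h. norm (DF x h - DF 0 h) \<le> 2 * L * norm x * norm h"
    by (rule C11_Taylor[OF F(1,3)], rule that)
  obtain DG where DG: "\<And>x. linear (DG x)" "\<And>h. continuous_on UNIV (\<lambda>x. DG x h)" "\<And>h. DG 0 h = 0"
    "continuous_on UNIV G"
    "\<And>x x'. norm (G x - G x' - DG x' (x - x')) \<le> 3 * L * (norm (x - x'))\<^sup>2"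
    "\<And>x h. norm (DG x h - DG 0 h) \<le> 2 * L * norm x * norm h"
    by (rule C11_Taylor[OF G(1,3)], rule that)
  have L: "0 \<le> L" by fact
  have bl: "bounded_linear (column i :: real^'m^2 \<Rightarrow> real^2)" for i
    using linear_column linear_conv_bounded_linear by blast
  have coldiff: "column i M - column i N = column i (M - N)" for i and M N :: "real^'m^2"
    using linear_diff[OF linear_column] by metis
  have near: "norm x + norm x' \<le> 2" if "norm x \<le> 1" "norm x' \<le> 1" for x x' :: "real^2" using that by simp
  have DFb: "norm (DF x h) \<le> (a + 2 * L) * norm h" if x: "norm x \<le> 1" for x h
  proof -
    have "norm (DF x h) \<le> norm (DF 0 h) + norm (DF x h - DF 0 h)" by (rule norm_triangle_sub)
    moreover have "2 * L * norm x * norm h \<le> 2 * L * 1 * norm h"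
      using x L by (intro mult_right_mono mult_left_mono) auto
    ultimately show ?thesis using A(1)[of h] DF(7)[of x h] unfolding DF(4) by (simp add: distrib_right)
  qed
  have K0L: "(a + 2 * L) \<le> K0" "a + 8 * L \<le> K0" "8 * L \<le> K0" "norm B + 8 * L \<le> K0" "1 \<le> K0"
    using L A(2) unfolding K0 by auto
  have Fl: "norm (F x - F x') \<le> K0 * norm (x - x')" if x: "norm x \<le> 1" "norm x' \<le> 1" for x x'
  proof -
    have "norm (x - x') \<le> 2" using norm_triangle_ineq4[of x x'] x by simp
    then have "3 * L * norm (x - x') * norm (x - x') \<le> 3 * L * 2 * norm (x - x')"
      using L by (intro mult_right_mono mult_left_mono) auto
    then have "norm (F x - F x') \<le> (a + 2 * L) * norm (x - x') + 6 * L * norm (x - x')"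
      using norm_triangle_sub[of "F x - F x'" "DF x' (x - x')"] DFb[OF x(2), of "x - x'"] DF(6)[of x x']
      by (simp add: power2_eq_square mult_ac)
    also have "\<dots> = (a + 8 * L) * norm (x - x')" by (simp add: algebra_simps)
    also have "\<dots> \<le> K0 * norm (x - x')" by (rule mult_right_mono[OF K0L(2)]) simp
    finally show ?thesis .
  qed
  have Gl: "norm (G x - G x') \<le> 5 * L * (norm x + norm x') * norm (x - x')" for x x'
  proof -
    have "3 * L * norm (x - x') * norm (x - x') \<le> 3 * L * (norm x + norm x') * norm (x - x')"
      using L norm_triangle_ineq4[of x x'] by (intro mult_right_mono mult_left_mono) auto
    moreover have "norm (DG x' (x - x')) \<le> 2 * L * norm x' * norm (x - x')"
      using DG(6)[of x' "x - x'"] unfolding DG(3) by simp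
    moreover have "2 * L * norm x' * norm (x - x') \<le> 2 * L * (norm x + norm x') * norm (x - x')"
      using L by (intro mult_right_mono mult_left_mono) auto
    ultimately have "norm (G x - G x') \<le> 2 * L * (norm x + norm x') * norm (x - x') + 3 * L * (norm x + norm x') * norm (x - x')"
      using norm_triangle_sub[of "G x - G x'" "DG x' (x - x')"] DG(5)[of x x']
      by (simp add: power2_eq_square mult_ac)
    also have "\<dots> = 5 * L * (norm x + norm x') * norm (x - x')" by (simp add: algebra_simps)
    finally show ?thesis .
  qed
  have le: "c * y \<le> K0 * y" if "c \<le> 8 * L" "0 \<le> y" for c y
    using that K0L(3) by (intro mult_right_mono) auto
  have "affine_control_system F G DF (\<lambda>i x h. column i (DG x h)) K0 \<kappa>"
  proof (intro affine_control_system.intro control_system.intro)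
    show "continuous_on UNIV (\<lambda>x. column i (G x))" for i
      by (rule bounded_linear.continuous_on[OF bl DG(4)])
    show "continuous_on UNIV (\<lambda>x. column i (DG x h))" for i h
      by (rule bounded_linear.continuous_on[OF bl DG(2)])
    show "linear (DF x)" for x by (rule DF(2))
    show "linear (\<lambda>h. column i (DG x h))" for i x
      using linear_compose[OF DG(1) linear_column] by (simp add: o_def)
    show "norm (F x - F x' - DF x' (x - x')) \<le> K0 * (norm (x - x'))\<^sup>2" for x x'
      by (rule order_trans[OF DF(6) le]) (use L in auto)
    show "norm (DF x h - DF 0 h) \<le> K0 * norm x * norm h" for x h
      using order_trans[OF DF(7)[of x h, unfolded mult.assoc] le[of "2 * L" "norm x * norm h", unfolded mult.assoc]] L
      by (simp add: mult.assoc)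
    show "norm (DF x h) \<le> K0 * norm h" if "norm x \<le> 1" for x h
      by (rule order_trans[OF DFb[OF that] mult_right_mono[OF K0L(1)]]) simp
    show "norm (column i (G x)) \<le> K0" if x: "norm x \<le> 1" for i x
    proof -
      have "5 * L * norm x * norm x \<le> 5 * L * 1 * 1" using x L by (intro mult_mono) auto
      then have "norm (G x) \<le> norm B + 5 * L"
        using Gl[of x 0] norm_triangle_sub[of "G x" B] G(2) by simp
      also have "\<dots> \<le> K0" using K0L(4) L by simp
      finally show ?thesis using norm_column_le[of i "G x"] by simp
    qed
    show "norm (column i (G x) - column i (G x')) \<le> K0 * (norm x + norm x') * norm (x - x')" for i x x'
    proof -
      have "norm (column i (G x) - column i (G x')) \<le> 5 * L * (norm x + norm x') * norm (x - x')"
        unfolding coldiff by (rule order_trans[OF norm_column_le Gl])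
      also have "\<dots> \<le> K0 * ((norm x + norm x') * norm (x - x'))"
        unfolding mult.assoc[of "5 * L"] by (rule le) (use L in auto)
      finally show ?thesis by (simp add: mult.assoc)
    qed
    show "norm (column i (G x) - column i (G x') - column i (DG x' (x - x'))) \<le> K0 * (norm (x - x'))\<^sup>2" for i x x'
      unfolding coldiff by (rule order_trans[OF norm_column_le order_trans[OF DG(5) le]]) (use L in auto)
    show "norm (column i (DG x h)) \<le> K0 * norm x * norm h" for i x h
    proof -
      have "norm (column i (DG x h)) \<le> norm (DG x h)" by (rule norm_column_le)
      also have "\<dots> \<le> 2 * L * (norm x * norm h)" using DG(6)[of x h] unfolding DG(3) by (simp add: mult.assoc)
      also have "\<dots> \<le> K0 * (norm x * norm h)" by (rule le) (use L in auto)
      finally show ?thesis by (simp add: mult.assoc)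
    qed
    show "\<kappa> \<le> \<bar>\<zeta> \<bullet> column i (G 0)\<bar> \<or> \<kappa> \<le> \<bar>\<zeta> \<bullet> DF 0 (column i (G 0))\<bar>" if "norm \<zeta> = 1" for i \<zeta>
      unfolding G(2) DF(4) by (rule kappa(2)[OF that])
  qed (use F(2) K0L(5) kappa(1) DF Fl in auto)
  then show thesis by (rule that)
qed

lemma C11_minus:
  assumes "C11 L f"
  shows "C11 L (\<lambda>x. - f x)"
proof -
  obtain D where D: "\<And>j x. ((\<lambda>h. f (x + h *\<^sub>R axis j 1)) has_vector_derivative D j x) (at 0)"
    "\<And>j. L-lipschitz_on UNIV (D j)"
    using assms unfolding C11_def by metis
  show ?thesis
    unfolding C11_def
    by (rule exI[of _ "\<lambda>j x. - D j x"])
      (use D in \<open>auto intro!: has_vector_derivative_minus simp: lipschitz_on_minus\<close>)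
qed

text \<open>Rank 2 means that no unit vector is orthogonal to both columns, so the larger of the two
  absolute inner products is positive on the circle and, by compactness, has a positive minimum; the
  least one over the finitely many \<open>i\<close> serves all columns.\<close>

lemma nondegeneracy_constant:
  fixes A :: "real^2^2" and B :: "real^'m^2"
  assumes "\<forall>i. rank (transpose (vector [column i B, A *v column i B] :: real^2^2)) = 2"
  obtains \<kappa> where "0 < \<kappa>"
    "\<And>i \<zeta>. norm \<zeta> = 1 \<Longrightarrow> \<kappa> \<le> \<bar>\<zeta> \<bullet> column i B\<bar> \<or> \<kappa> \<le> \<bar>\<zeta> \<bullet> (A *v column i B)\<bar>"
proof -
  have "\<exists>k>0. \<forall>\<zeta>. norm \<zeta> = 1 \<longrightarrow> k \<le> \<bar>\<zeta> \<bullet> column i B\<bar> \<or> k \<le> \<bar>\<zeta> \<bullet> (A *v column i B)\<bar>" for i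
  proof -
    let ?b = "column i B" and ?c = "A *v column i B"
    let ?M = "vector [?b, ?c] :: real^2^2"
    have "rank ?M = CARD(2)" using assms rank_transpose[of ?M] by simp
    then have inj: "inj ((*v) ?M)" by (simp only: full_rank_injective)
    have M: "(?M *v \<zeta>) $ 1 = ?b \<bullet> \<zeta>" "(?M *v \<zeta>) $ 2 = ?c \<bullet> \<zeta>" for \<zeta>
      by (simp_all add: matrix_vector_mul_component)
    let ?f = "\<lambda>\<zeta>. max \<bar>\<zeta> \<bullet> ?b\<bar> \<bar>\<zeta> \<bullet> ?c\<bar>"
    have "continuous_on (sphere 0 1) ?f" by (intro continuous_intros)
    moreover have "sphere (0::real^2) 1 \<noteq> {}" by simp
    ultimately obtain \<zeta>0 where \<zeta>0: "\<zeta>0 \<in> sphere 0 1" "\<And>\<zeta>. \<zeta> \<in> sphere 0 1 \<Longrightarrow> ?f \<zeta>0 \<le> ?f \<zeta>"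
      using continuous_attains_inf[OF compact_sphere, of 0 1 ?f] by blast
    have "?f \<zeta>0 \<noteq> 0"
    proof
      assume "?f \<zeta>0 = 0"
      then have "\<zeta>0 \<bullet> ?b = 0" "\<zeta>0 \<bullet> ?c = 0" by (auto simp: max_def split: if_splits)
      then have "?M *v \<zeta>0 = ?M *v 0" by (simp add: vec_eq_iff forall_2 M inner_commute)
      then have "\<zeta>0 = 0" by (rule injD[OF inj])
      then show False using \<zeta>0(1) by simp
    qed
    moreover have "0 \<le> ?f \<zeta>0" by auto
    ultimately have "0 < ?f \<zeta>0" by linarith
    moreover have "?f \<zeta>0 \<le> \<bar>\<zeta> \<bullet> ?b\<bar> \<or> ?f \<zeta>0 \<le> \<bar>\<zeta> \<bullet> ?c\<bar>" if "norm \<zeta> = 1" for \<zeta>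
      using \<zeta>0(2)[of \<zeta>] that unfolding le_max_iff_disj by simp
    ultimately show ?thesis by blast
  qed
  then obtain k where k: "\<And>i. 0 < k i"
    "\<And>i \<zeta>. norm \<zeta> = 1 \<Longrightarrow> k i \<le> \<bar>\<zeta> \<bullet> column i B\<bar> \<or> k i \<le> \<bar>\<zeta> \<bullet> (A *v column i B)\<bar>"
    by metis
  have le: "Min (range k) \<le> k i" for i by (rule Min_le) auto
  show thesis
  proof (rule that[of "Min (range k)"])
    show "0 < Min (range k)" using k(1) by (subst Min_gr_iff) auto
    show "Min (range k) \<le> \<bar>\<zeta> \<bullet> column i B\<bar> \<or> Min (range k) \<le> \<bar>\<zeta> \<bullet> (A *v column i B)\<bar>" if "norm \<zeta> = 1" for i \<zeta>
      using k(2)[OF that, of i] le[of i] by linarith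
  qed
qed

context affine_control_system
begin

text \<open>The minimum time is governed by the reversed system, which has the same
  \<open>K\<close>, \<open>T0\<close> and \<open>c0\<close> because these depend only on
  \<open>K0\<close>, \<open>\<kappa>\<close> and the number of controls. The forward reachable set
  lies in the ball of radius \<open>K * \<tau>\<close>, and \<open>small\<close> places that ball
  inside the reversed reachable set at time \<open>T0 / 2\<close>, where
  \<open>INF_time_continuous_on\<close> applies.\<close>

lemma minimum_time_continuous_on:
  assumes rev: "affine_control_system (\<lambda>x. - F x) (\<lambda>x. - G x) DF' Dg' K0 \<kappa>"
    and tau: "0 < \<tau>" "\<tau> \<le> T0" and small: "K * \<tau> < (c0 / 2) * (T0 / 2)\<^sup>2"
  shows "continuous_on (reachable F G \<tau>) (minimum_time F G)"
proof -
  interpret R: affine_control_system "\<lambda>x. - F x" "\<lambda>x. - G x" DF' Dg' K0 \<kappa> by (rule rev)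
  let ?R = "reachable (\<lambda>x. - F x) (\<lambda>x. - G x)"
  have T: "0 \<le> T0 / 2" "T0 / 2 \<le> T0" using T0_pos by auto
  have "continuous_on (reachable F G \<tau>) (\<lambda>x. INF t\<in>{t. 0 \<le> t \<and> x \<in> ?R t}. ereal t)"
  proof (rule INF_time_continuous_on[of "c0 / 2" T0])
    fix x z and s t :: real
    assume *: "x \<in> ?R t" "0 \<le> s" "0 \<le> t" "s + t \<le> T0" "norm (z - x) < c0 / 2 * s\<^sup>2"
    have "x \<in> R.reach t" using *(1) R.reachable_eq_reach[of t] *(2-4) by simp
    then have "z \<in> R.reach (s + t)" by (rule R.reach_growth) (use * in auto)
    then show "z \<in> ?R (s + t)" using R.reachable_eq_reach[of "s + t"] *(2-4) by simp
  next
    show "reachable F G \<tau> \<subseteq> ?R (T0 / 2)"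
    proof
      fix x assume "x \<in> reachable F G \<tau>"
      then have "norm x \<le> K * \<tau>" using reach_bounded[of x \<tau>] reachable_eq_reach[of \<tau>] tau by simp
      then have "x \<in> ball 0 ((c0 / 2) * (T0 / 2)\<^sup>2)" using small by simp
      then show "x \<in> ?R (T0 / 2)" using R.ball_subset_reach[OF T] R.reachable_eq_reach[OF T] by blast
    qed
  qed (use c0_pos T0_pos in auto)
  moreover have "minimum_time F G = (\<lambda>x. INF t\<in>{t. 0 \<le> t \<and> x \<in> ?R t}. ereal t)"
    by (rule ext) (rule minimum_time_eq)
  ultimately show ?thesis by simp
qed

end

text \<open>Negating \<open>A\<close> and \<open>B\<close> preserves both norms and the two absolute
  inner products, the second because the signs in \<open>A *v column i B\<close> cancel; so
  \<open>K0\<close> and \<open>\<kappa>\<close> carry over.\<close>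

lemma affine_control_system_reverse_exists:
  fixes F :: "real^2 \<Rightarrow> real^2" and G :: "real^2 \<Rightarrow> real^'m^2"
  assumes F: "C11 L F" "F 0 = 0" "(F has_derivative (\<lambda>h. A *v h)) (at 0)"
    and G: "C11 L G" "G 0 = B" "(G has_derivative (\<lambda>h. 0)) (at 0)"
    and A: "\<And>h. norm (A *v h) \<le> a * norm h" "0 \<le> a"
    and K0: "K0 = 1 + a + 8 * \<bar>L\<bar> + norm B"
    and kappa: "0 < \<kappa>" "\<And>i \<zeta>. norm \<zeta> = 1 \<Longrightarrow> \<kappa> \<le> \<bar>\<zeta> \<bullet> column i B\<bar> \<or> \<kappa> \<le> \<bar>\<zeta> \<bullet> (A *v column i B)\<bar>"
  obtains DF Dg where "affine_control_system (\<lambda>x. - F x) (\<lambda>x. - G x) DF Dg K0 \<kappa>"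
proof (rule affine_control_system_exists[of L "\<lambda>x. - F x" "- A" "\<lambda>x. - G x" "- B" a K0 \<kappa>])
  have neg: "(- A) *v h = - (A *v h)" for h :: "real^2"
    by (simp add: vec_eq_iff matrix_vector_mult_def sum_negf)
  have col: "column i (- B) = - column i B" for i by (simp add: vec_eq_iff column_def)
  have mneg: "A *v (- h) = - (A *v h)" for h :: "real^2"
    by (simp add: vec_eq_iff matrix_vector_mult_def sum_negf)
  show "((\<lambda>x. - F x) has_derivative (\<lambda>h. - A *v h)) (at 0)"
    unfolding neg by (rule has_derivative_minus[OF F(3)])
  show "((\<lambda>x. - G x) has_derivative (\<lambda>h. 0)) (at 0)"
    using has_derivative_minus[OF G(3)] by simp
  show "norm (- A *v h) \<le> a * norm h" for h unfolding neg using A(1) by simp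
  show "\<kappa> \<le> \<bar>\<zeta> \<bullet> column i (- B)\<bar> \<or> \<kappa> \<le> \<bar>\<zeta> \<bullet> (- A *v column i (- B))\<bar>" if "norm \<zeta> = 1" for i \<zeta>
    unfolding col neg mneg using kappa(2)[OF that, of i] by simp
qed (use assms C11_minus that in auto)

theorem theorem5p1:
  fixes L :: real and A :: "real^2^2" and B :: "real^'m^2"
  assumes "CARD('m) = 1 \<or> CARD('m) = 2"
    and "\<forall>i. rank (transpose (vector [column i B, A *v column i B] :: real^2^2)) = 2"
  shows "\<exists>T \<gamma> T' \<gamma>' \<gamma>'' T''.
    0 < T \<and> 0 < \<gamma> \<and> T < T' \<and> 0 \<le> \<gamma>' \<and> 0 < \<gamma>'' \<and> 0 < T'' \<and> T'' \<le> T \<and>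
    (\<forall>(F :: real^2 \<Rightarrow> real^2) (G :: real^2 \<Rightarrow> real^'m^2).
       C11 L F \<and> C11 L G \<and> F 0 = 0 \<and> (F has_derivative (\<lambda>h. A *v h)) (at 0) \<and>
       G 0 = B \<and> (G has_derivative (\<lambda>h. 0)) (at 0)
       \<longrightarrow>
       (\<forall>\<tau>. 0 < \<tau> \<and> \<tau> \<le> T \<longrightarrow>
          (\<forall>x\<in>frontier (reachable F G \<tau>).
             \<exists>u. admissible {0..\<tau>} u \<and> steers F G u 0 \<tau> x \<and>
                 bang_bang \<tau> u \<and> finitely_many_switchings \<tau> u \<and>
                 (\<forall>v. admissible {0..\<tau>} v \<and> steers F G v 0 \<tau> x \<longrightarrow>
                      (AE t in lebesgue_on {0..\<tau>}. v t = u t)))) \<and>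
       (\<forall>\<tau>. 0 < \<tau> \<and> \<tau> < T \<longrightarrow>
          strictly_convex (reachable F G \<tau>) \<and>
          (\<forall>x1\<in>frontier (reachable F G \<tau>). \<forall>x2\<in>reachable F G \<tau>.
             \<forall>\<zeta>\<in>proximal_normal_cone (reachable F G \<tau>) x1.
               \<zeta> \<bullet> (x2 - x1) \<le> - \<gamma> * norm \<zeta> * (norm (x2 - x1))\<^sup>2)) \<and>
       (\<forall>\<tau>. 0 < \<tau> \<and> \<tau> < T' \<longrightarrow>
          positive_reach (reachable F G \<tau>) \<and>
          (\<forall>x1\<in>frontier (reachable F G \<tau>). \<forall>x2\<in>reachable F G \<tau>.
             \<forall>\<zeta>\<in>proximal_normal_cone (reachable F G \<tau>) x1.
               \<zeta> \<bullet> (x2 - x1) \<le> \<gamma>' * norm \<zeta> * (norm (x2 - x1))\<^sup>2)) \<and>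
       (\<forall>\<tau>. 0 < \<tau> \<and> \<tau> < T'' \<longrightarrow> ball 0 (\<gamma>'' * \<tau>\<^sup>2) \<subseteq> reachable F G \<tau>) \<and>
       (\<forall>\<tau>. 0 < \<tau> \<and> \<tau> < T'' \<longrightarrow> continuous_on (reachable F G \<tau>) (minimum_time F G)))"
proof -
  obtain a where a: "\<And>h. norm (A *v h) \<le> norm h * a" "0 < a"
    using bounded_linear.pos_bounded[OF matrix_vector_mul_bounded_linear[of A]] by blast
  obtain \<kappa> where \<kappa>: "0 < \<kappa>"
    "\<And>i \<zeta>. norm \<zeta> = 1 \<Longrightarrow> \<kappa> \<le> \<bar>\<zeta> \<bullet> column i B\<bar> \<or> \<kappa> \<le> \<bar>\<zeta> \<bullet> (A *v column i B)\<bar>"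
    by (rule nondegeneracy_constant[OF assms(2)]) blast
  \<comment> \<open>The constants of the locale are repeated outside it, since they have to be fixed
    before \<open>F\<close> and \<open>G\<close> are introduced.\<close>
  define K0 where "K0 = 1 + a + 8 * \<bar>L\<bar> + norm B"
  define K where "K = (1 + 2 * real CARD('m)) * K0"
  define T1 where "T1 = min (1 / (2 * K)) (\<kappa> / (1024 * real CARD('m) * K ^ 3))"
  define c where "c = \<kappa> / (32 * real CARD('m))"
  define gm where "gm = c / (8 * K\<^sup>2)"
  \<comment> \<open>The second entry is the hypothesis \<open>small\<close> of the continuity of the
    minimum time, solved for \<open>\<tau>\<close>.\<close>
  define T2 where "T2 = min (T1 / 2) ((c / 2) * (T1 / 2)\<^sup>2 / K)"
  have card: "0 < real CARD('m)" by simp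
  have "1 \<le> K0" using a(2) by (simp add: K0_def)
  then have K: "0 < K" unfolding K_def using card by (intro mult_pos_pos) auto
  have T1: "0 < T1" unfolding T1_def using K \<kappa>(1) card by simp
  have c: "0 < c" unfolding c_def using \<kappa>(1) card by simp
  have gm: "0 < gm" unfolding gm_def using c K by simp
  have T2: "0 < T2" unfolding T2_def using T1 c K by simp
  have main: "(\<forall>\<tau>. 0 < \<tau> \<and> \<tau> \<le> T1 / 2 \<longrightarrow>
          (\<forall>x\<in>frontier (reachable F G \<tau>).
             \<exists>u. admissible {0..\<tau>} u \<and> steers F G u 0 \<tau> x \<and>
                 bang_bang \<tau> u \<and> finitely_many_switchings \<tau> u \<and>
                 (\<forall>v. admissible {0..\<tau>} v \<and> steers F G v 0 \<tau> x \<longrightarrow>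
                      (AE t in lebesgue_on {0..\<tau>}. v t = u t)))) \<and>
       (\<forall>\<tau>. 0 < \<tau> \<and> \<tau> < T1 / 2 \<longrightarrow>
          strictly_convex (reachable F G \<tau>) \<and>
          (\<forall>x1\<in>frontier (reachable F G \<tau>). \<forall>x2\<in>reachable F G \<tau>.
             \<forall>\<zeta>\<in>proximal_normal_cone (reachable F G \<tau>) x1.
               \<zeta> \<bullet> (x2 - x1) \<le> - gm * norm \<zeta> * (norm (x2 - x1))\<^sup>2)) \<and>
       (\<forall>\<tau>. 0 < \<tau> \<and> \<tau> < T1 \<longrightarrow>
          positive_reach (reachable F G \<tau>) \<and>
          (\<forall>x1\<in>frontier (reachable F G \<tau>). \<forall>x2\<in>reachable F G \<tau>.
             \<forall>\<zeta>\<in>proximal_normal_cone (reachable F G \<tau>) x1.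
               \<zeta> \<bullet> (x2 - x1) \<le> 0 * norm \<zeta> * (norm (x2 - x1))\<^sup>2)) \<and>
       (\<forall>\<tau>. 0 < \<tau> \<and> \<tau> < T2 \<longrightarrow> ball 0 (c / 2 * \<tau>\<^sup>2) \<subseteq> reachable F G \<tau>) \<and>
       (\<forall>\<tau>. 0 < \<tau> \<and> \<tau> < T2 \<longrightarrow> continuous_on (reachable F G \<tau>) (minimum_time F G))"
    if H: "C11 L F" "C11 L G" "F 0 = 0" "(F has_derivative (\<lambda>h. A *v h)) (at 0)"
      "G 0 = B" "(G has_derivative (\<lambda>h. 0)) (at 0)"
    for F :: "real^2 \<Rightarrow> real^2" and G :: "real^2 \<Rightarrow> real^'m^2"
  proof -
    have a': "norm (A *v h) \<le> a * norm h" for h using a(1)[of h] by (simp add: mult.commute)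
    note hyps = H(1) H(3) H(4) H(2) H(5) H(6) a' less_imp_le[OF a(2)] K0_def \<kappa>
    obtain DF Dg where S: "affine_control_system F G DF Dg K0 \<kappa>"
      by (rule affine_control_system_exists[OF hyps])
    obtain DF' Dg' where R: "affine_control_system (\<lambda>x. - F x) (\<lambda>x. - G x) DF' Dg' K0 \<kappa>"
      by (rule affine_control_system_reverse_exists[OF hyps])
    interpret S: affine_control_system F G DF Dg K0 \<kappa> by (rule S)
    have KS: "S.K = K" unfolding S.K_def K_def ..
    have TS: "S.T0 = T1" unfolding S.T0_def T1_def KS ..
    have cS: "S.c0 = c" unfolding S.c0_def c_def ..
    have gS: "S.gam = gm" unfolding S.gam_def gm_def KS cS ..
    have RS: "reachable F G \<tau> = S.reach \<tau>" if "0 < \<tau>" "\<tau> \<le> T1" for \<tau>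
      using S.reachable_eq_reach[of \<tau>] that TS by simp
    show ?thesis
    proof (intro conjI allI impI ballI; elim conjE)
      fix \<tau> x assume "0 < \<tau>" "\<tau> \<le> T1 / 2" "x \<in> frontier (reachable F G \<tau>)"
      then show "\<exists>u. admissible {0..\<tau>} u \<and> steers F G u 0 \<tau> x \<and>
               bang_bang \<tau> u \<and> finitely_many_switchings \<tau> u \<and>
               (\<forall>v. admissible {0..\<tau>} v \<and> steers F G v 0 \<tau> x \<longrightarrow>
                    (AE t in lebesgue_on {0..\<tau>}. v t = u t))"
        using T1 TS by (intro S.unique_bang_bang_control) auto
    next
      fix \<tau> assume "0 < \<tau>" "\<tau> < T1 / 2"
      then have t: "0 < \<tau>" "\<tau> \<le> T1" using T1 by auto
      show "strictly_convex (reachable F G \<tau>)"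
        unfolding RS[OF t] using t TS by (intro S.strictly_convex_reach) auto
      fix x1 x2 \<zeta> assume "x1 \<in> frontier (reachable F G \<tau>)" "x2 \<in> reachable F G \<tau>"
        "\<zeta> \<in> proximal_normal_cone (reachable F G \<tau>) x1"
      then show "\<zeta> \<bullet> (x2 - x1) \<le> - gm * norm \<zeta> * (norm (x2 - x1))\<^sup>2"
        using S.proximal_normal_reach[of \<tau> x1 x2 \<zeta>] t TS unfolding RS[OF t] gS by blast
    next
      fix \<tau> assume "0 < \<tau>" "\<tau> < T1"
      then have t: "0 < \<tau>" "\<tau> \<le> T1" by auto
      have cc: "closed (S.reach \<tau>)" "convex (S.reach \<tau>)" "S.reach \<tau> \<noteq> {}"
        using S.reach_closed_convex[of \<tau>] S.zero_in_reach[of \<tau>] t TS by auto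
      show "positive_reach (reachable F G \<tau>)"
        unfolding RS[OF t] by (rule positive_reach_convex[OF cc])
      fix x1 x2 \<zeta> assume *: "x1 \<in> frontier (reachable F G \<tau>)" "x2 \<in> reachable F G \<tau>"
        "\<zeta> \<in> proximal_normal_cone (reachable F G \<tau>) x1"
      then have "x1 \<in> S.reach \<tau>" using cc(1) unfolding RS[OF t] frontier_def by auto
      then show "\<zeta> \<bullet> (x2 - x1) \<le> 0 * norm \<zeta> * (norm (x2 - x1))\<^sup>2"
        using proximal_normal_convex[OF cc(2), of x1 x2 \<zeta>] * unfolding RS[OF t] by simp
    next
      fix \<tau> assume "0 < \<tau>" "\<tau> < T2"
      then have t: "0 < \<tau>" "\<tau> \<le> T1" unfolding T2_def using T1 by auto
      show "ball 0 (c / 2 * \<tau>\<^sup>2) \<subseteq> reachable F G \<tau>"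
        using S.ball_subset_reach[of \<tau>] t TS unfolding RS[OF t] cS by simp
    next
      fix \<tau> assume tau: "0 < \<tau>" "\<tau> < T2"
      then have t: "0 < \<tau>" "\<tau> \<le> S.T0" unfolding T2_def TS using T1 by auto
      have "\<tau> < (c / 2) * (T1 / 2)\<^sup>2 / K" using tau unfolding T2_def by simp
      then have "S.K * \<tau> < (S.c0 / 2) * (S.T0 / 2)\<^sup>2"
        unfolding KS cS TS using K by (simp add: less_divide_eq mult_ac)
      then show "continuous_on (reachable F G \<tau>) (minimum_time F G)"
        by (rule S.minimum_time_continuous_on[OF R t])
    qed
  qed
  \<comment> \<open>Every estimate holds below \<open>T1\<close>. Taking half of it as the first
    time leaves room for a strictly larger second one, and since the sets are convex up to
    \<open>T1\<close>, the constant of the positive reach estimate can be 0.\<close>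
  have pos: "0 < T1 / 2" "T1 / 2 < T1" "(0::real) \<le> 0" "0 < c / 2" "T2 \<le> T1 / 2"
    using T1 c by (auto simp: T2_def)
  show ?thesis
    by (rule exI[of _ "T1 / 2"], rule exI[of _ gm], rule exI[of _ T1], rule exI[of _ 0],
        rule exI[of _ "c / 2"], rule exI[of _ T2],
        intro conjI[OF pos(1)] conjI[OF gm] conjI[OF pos(2)] conjI[OF pos(3)] conjI[OF pos(4)]
          conjI[OF T2] conjI[OF pos(5)] allI impI, elim conjE, rule main; assumption)
qed

end
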